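(* Let $p\in[1,2)$. For each integer $n\ge 2$ let $k_n\in\{1,\ldots,n-1\}$, and assume that the limit $\lambda:=\lim_{n\to\infty}\frac{k_n}{n}$ exists in $(0,1]$. For each $n\ge 2$ let $X^{(n)}$ be a random point uniformly distributed in $\mathbb{B}_p^n=\{x\in\mathbb{R}^n:\|x\|_p\le 1\}$, and let $E^{(n)}$ be a random $k_n$-dimensional linear subspace of $\mathbb{R}^n$, independent of $X^{(n)}$ and distributed according to the Haar probability measure on the Grassmannian $\mathbb{G}_{n,k_n}$. Let $P_{E^{(n)}}$ denote the orthogonal projection onto $E^{(n)}$. Then the sequence of random variables $$\Big(n^{\frac1p-\frac12}\,\big\|P_{E^{(n)}}X^{(n)}\big\|_2\Big)_{n}$$ satisfies a large deviation principle with speed $n^{p/2}$ and rate function $$ \mathcal{I}(y)=\begin{cases} \frac1p\Big(\frac{y^2}{\lambda}-m\Big)^{p/2} &: y\geq \sqrt{\lambda m}\\ +\infty &: \text{otherwise}, \end{cases} \qquad\text{where } m=m_p:=\frac{p^{2/p}}{3}\,\frac{\Gamma(1+\frac3p)}{\Gamma(1+\frac1p)}. $$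
   Context: Large deviation principle (LDP): a sequence $(X^{(n)})_n$ of $\mathbb{R}^d$-valued random vectors satisfies a (full) LDP with speed $s(n)\in[0,\infty]$ and (good) rate function $\mathcal{I}:\mathbb{R}^d\to[0,\infty]$ if $\mathcal{I}$ is lower semi-continuous with compact level sets $\{x:\mathcal{I}(x)\le\alpha\}$, $\alpha\in\mathbb{R}$, and for all Lebesgue measurable $A\subset\mathbb{R}^d$, $$-\inf_{x\in A^\circ}\mathcal{I}(x)\le\liminf_{n\to\infty}\tfrac{1}{s(n)}\log\mathbb{P}(X^{(n)}\in A)\le\limsup_{n\to\infty}\tfrac{1}{s(n)}\log\mathbb{P}(X^{(n)}\in A)\le-\inf_{x\in\overline{A}}\mathcal{I}(x),$$ where $A^\circ$ and $\overline A$ are the interior and closure of $A$. Conventions: $\log 0=-\infty$, $\inf\emptyset=+\infty$. For $p\in[1,\infty)$, $\|x\|_p=(\sum_i|x_i|^p)^{1/p}$. *)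

theory Defs
  imports "HOL-Probability.Probability" "HOL-Library.Function_Algebras"
begin

subsection \<open>Large deviation principles\<close>

definition log_prob :: "real \<Rightarrow> ereal" where
  "log_prob q = (if q = 0 then -\<infinity> else ereal (ln q))"

definition good_rate_function :: "('a::euclidean_space \<Rightarrow> ereal) \<Rightarrow> bool" where
  "good_rate_function I \<longleftrightarrow>
     (\<forall>x. 0 \<le> I x) \<and>
     (\<forall>x. I x \<le> Liminf (at x) I) \<and>
     (\<forall>\<alpha>::real. compact {x. I x \<le> ereal \<alpha>})"

text \<open>
  The sets \<open>A\<close> range over all Lebesgue measurable sets, and for such an \<open>A\<close> the event
  \<open>X n \<in> A\<close> need not belong to the \<open>\<sigma>\<close>-algebra of \<open>M\<close> when \<open>M\<close> is not complete.
  Its probability is therefore taken in the completion of \<open>M\<close>; on the events of \<open>M\<close>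
  this is the original probability.
\<close>
definition (in prob_space) satisfies_LDP ::
    "(nat \<Rightarrow> 'a \<Rightarrow> 'b::euclidean_space) \<Rightarrow> (nat \<Rightarrow> ereal) \<Rightarrow> ('b \<Rightarrow> ereal) \<Rightarrow> bool" where
  "satisfies_LDP X s I \<longleftrightarrow>
     good_rate_function I \<and>
     (\<forall>A \<in> sets lebesgue.
        let r = (\<lambda>n. 1 / s n * log_prob (measure (completion M) {\<omega> \<in> space M. X n \<omega> \<in> A}))
        in - (INF x \<in> interior A. I x) \<le> liminf r \<and>
           liminf r \<le> limsup r \<and>
           limsup r \<le> - (INF x \<in> closure A. I x))"


subsection \<open>The spaces \<open>\<real>\<^sup>n\<close>\<close>

text \<open>
  As \<open>n\<close> varies within a single statement, \<open>\<real>\<^sup>n\<close> is realised as the space of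
  real sequences that vanish from index \<open>n\<close> on. The pointwise vector space structure on
  functions makes the library notions of linear map, subspace and dimension available.
\<close>

instantiation "fun" :: (type, real_vector) real_vector
begin

definition scaleR_fun :: "real \<Rightarrow> ('a \<Rightarrow> 'b) \<Rightarrow> 'a \<Rightarrow> 'b" where
  "scaleR_fun c f = (\<lambda>x. c *\<^sub>R f x)"

instance
  by standard (simp_all add: scaleR_fun_def fun_eq_iff scaleR_add_right scaleR_add_left)

end

definition Rn :: "nat \<Rightarrow> (nat \<Rightarrow> real) set" where
  "Rn n = {x. \<forall>i\<ge>n. x i = 0}"

definition inner_Rn :: "nat \<Rightarrow> (nat \<Rightarrow> real) \<Rightarrow> (nat \<Rightarrow> real) \<Rightarrow> real" where
  "inner_Rn n x y = (\<Sum>i<n. x i * y i)"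

definition lp_norm :: "real \<Rightarrow> nat \<Rightarrow> (nat \<Rightarrow> real) \<Rightarrow> real" where
  "lp_norm p n x = (\<Sum>i<n. \<bar>x i\<bar> powr p) powr (1 / p)"

definition lp_ball :: "real \<Rightarrow> nat \<Rightarrow> (nat \<Rightarrow> real) set" where
  "lp_ball p n = {x \<in> Rn n. lp_norm p n x \<le> 1}"

text \<open>
  The product measure lives on functions that are \<open>undefined\<close> outside \<open>{..<n}\<close>;
  it is transported to \<^term>\<open>Rn n\<close> by extending with zero. It is a Borel measure on all
  sequences, concentrated on \<^term>\<open>Rn n\<close>.
\<close>
definition lborel_Rn :: "nat \<Rightarrow> (nat \<Rightarrow> real) measure" where
  "lborel_Rn n = distr (\<Pi>\<^sub>M i\<in>{..<n}. lborel) borel (\<lambda>x i. if i < n then x i else 0)"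

definition orthogonal_group :: "nat \<Rightarrow> ((nat \<Rightarrow> real) \<Rightarrow> (nat \<Rightarrow> real)) set" where
  "orthogonal_group n =
     {g. linear g \<and> g ` Rn n \<subseteq> Rn n \<and>
         (\<forall>x\<in>Rn n. \<forall>y\<in>Rn n. inner_Rn n (g x) (g y) = inner_Rn n x y)}"


subsection \<open>Grassmannians\<close>

definition grassmannian :: "nat \<Rightarrow> nat \<Rightarrow> (nat \<Rightarrow> real) set set" where
  "grassmannian n k = {E. subspace E \<and> E \<subseteq> Rn n \<and> dim E = k}"

definition proj_onto :: "nat \<Rightarrow> (nat \<Rightarrow> real) set \<Rightarrow> (nat \<Rightarrow> real) \<Rightarrow> (nat \<Rightarrow> real)" where
  "proj_onto n E x = (THE y. y \<in> E \<and> (\<forall>z\<in>E. inner_Rn n (x - y) z = 0))"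

text \<open>
  The Grassmannian carries the usual topology, in which \<open>E\<close> is identified with the matrix of
  the orthogonal projection onto \<open>E\<close>. All entries with an index \<open>\<ge> n\<close> are zero.
\<close>
definition proj_matrix :: "nat \<Rightarrow> (nat \<Rightarrow> real) set \<Rightarrow> (nat \<times> nat \<Rightarrow> real)" where
  "proj_matrix n E = (\<lambda>(i, j). proj_onto n E (\<lambda>l. if l = j then 1 else 0) i)"

definition grassmannian_topology :: "nat \<Rightarrow> nat \<Rightarrow> (nat \<Rightarrow> real) set topology" where
  "grassmannian_topology n k = pullback_topology (grassmannian n k) (proj_matrix n) euclidean"

definition grassmannian_borel :: "nat \<Rightarrow> nat \<Rightarrow> (nat \<Rightarrow> real) set measure" where
  "grassmannian_borel n k =
     sigma (grassmannian n k) {U. openin (grassmannian_topology n k) U}"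

text \<open>
  The Haar probability measure on the Grassmannian is the unique Borel probability measure
  invariant under the action of the orthogonal group.
\<close>
definition haar_grassmannian :: "nat \<Rightarrow> nat \<Rightarrow> (nat \<Rightarrow> real) set measure \<Rightarrow> bool" where
  "haar_grassmannian n k \<nu> \<longleftrightarrow>
     prob_space \<nu> \<and> sets \<nu> = sets (grassmannian_borel n k) \<and>
     (\<forall>g\<in>orthogonal_group n. \<forall>\<A>\<in>sets \<nu>. emeasure \<nu> ((\<lambda>E. g ` E) ` \<A>) = emeasure \<nu> \<A>)"


subsection \<open>The rate function\<close>

definition m_const :: "real \<Rightarrow> real" where
  "m_const p = p powr (2 / p) / 3 * (Gamma (1 + 3 / p) / Gamma (1 + 1 / p))"

definition rate_fun :: "real \<Rightarrow> real \<Rightarrow> real \<Rightarrow> ereal" where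
  "rate_fun p l y =
     (if y \<ge> sqrt (l * m_const p)
      then ereal (1 / p * (y\<^sup>2 / l - m_const p) powr (p / 2))
      else \<infinity>)"

end

theory Submission
  imports Defs "HOL-Real_Asymp.Real_Asymp"
begin

text \<open>
  Write \<open>\<parallel>P\<^sub>E X\<parallel>\<^sup>2 = W * \<parallel>X\<parallel>\<^sup>2\<close>, where \<open>W\<close> is the share of the squared length of \<open>X\<close> that the
  subspace captures. By invariance of the Haar measure, the law of \<open>W\<close> for a fixed vector does not
  depend on the direction of the vector, so the direction may be replaced by that of a Gaussian
  vector; then \<open>W\<close> is a ratio of chi-square variables and differs from \<open>k / n\<close> by \<open>\<epsilon>\<close> with a
  probability that is exponentially small in \<open>n\<close> (\<open>haar_projection_concentration\<close>). Since \<open>p < 2\<close>,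
  this is negligible at speed \<open>n powr (p / 2)\<close>. Hence \<open>W\<close> acts as the constant \<open>l\<close>, and everything is
  decided by the fluctuations of \<open>V = n powr (2 / p - 1) * \<parallel>X\<parallel>\<^sup>2\<close>.

  To describe these, let \<open>Z\<close> have independent coordinates with density proportional to
  \<open>exp (- \<bar>z\<bar>\<^sup>p / p)\<close>. The layer cake formula for this exponential shows that
  \<open>Z = T powr (1 / p) * X\<close>, where \<open>T\<close> is independent of \<open>X\<close> and Gamma distributed
  (\<open>gen_gauss_pow_radial_decomposition\<close>). As \<open>T / n\<close> is close to one outside an event of exponentially small
  probability, \<open>V\<close> may be replaced by the mean of the squares \<open>Z\<^sub>i\<^sup>2\<close>, whose expectation is \<open>m\<close>. A square has the
  tail \<open>exp (- u powr (p / 2) / p)\<close>, which is heavier than exponential because \<open>p / 2 < 1\<close>. The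
  cheapest way for the mean to exceed \<open>m\<close> by \<open>v\<close> is therefore that a single square is about \<open>n * v\<close>,
  at the cost \<open>n powr (p / 2) * v powr (p / 2) / p\<close>. The upper bound
  (\<open>gen_gauss_pow_square_sum_upper_tail\<close>) separates the event of one such large square from its complement, where
  a truncated exponential moment suffices; the lower bound
  (\<open>gen_gauss_pow_square_sum_local_lower_bound\<close>) prescribes one coordinate and leaves the others typical.
  The left tail, \<open>V\<close> below \<open>m\<close>, is exponentially small in \<open>n\<close>. Since \<open>y\<^sup>2 = l * V\<close>, the cost of
  \<open>y\<close> is obtained with \<open>v = y\<^sup>2 / l - m\<close>.

  These bounds concern rays and small intervals. As the rate increases on \<open>{sqrt (l * m)..}\<close> and is
  infinite to the left of it, they give the principle for all sets
  (\<open>satisfies_LDP_increasing_rate\<close>). That an event with a Lebesgue set belongs to the completion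
  follows from absolute continuity, which holds because the length of a projection is homogeneous in
  \<open>X\<close> (\<open>homogeneous_preimage_null\<close>).
\<close>

section \<open>Exponential negligibility\<close>

text \<open>
  Negligibility at speed \<open>n\<^sup>\<alpha>\<close>: such a term never affects a large deviation bound at
  that speed. The rate \<open>q\<close> ranges over all reals, which expresses that the logarithm divided by
  \<open>n\<^sup>\<alpha>\<close> tends to \<open>-\<infinity>\<close> without taking the logarithm of zero.
\<close>
definition exp_small :: "real \<Rightarrow> (nat \<Rightarrow> real) \<Rightarrow> bool" where
  "exp_small \<alpha> f \<longleftrightarrow> (\<forall>q. \<forall>\<^sub>F n in sequentially. f n \<le> exp (- q * real n powr \<alpha>))"

text \<open>
  Probabilities that are exponentially small in \<open>n\<close> are negligible at every sublinear speed.
\<close>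
lemma exp_small_linear:
  assumes "0 < c" "\<alpha> < 1"
  shows "exp_small \<alpha> (\<lambda>n. C * exp (- c * real n))"
  unfolding exp_small_def
proof
  fix q :: real
  have "(\<lambda>n. real n powr (\<alpha> - 1)) \<longlonglongrightarrow> 0"
    using assms by (intro tendsto_neg_powr filterlim_real_sequentially) auto
  then have "(\<lambda>n. \<bar>q\<bar> * real n powr (\<alpha> - 1)) \<longlonglongrightarrow> \<bar>q\<bar> * 0"
    by (rule tendsto_mult_left)
  then have "\<forall>\<^sub>F n in sequentially. \<bar>q\<bar> * real n powr (\<alpha> - 1) < c / 2"
    using assms by (intro order_tendstoD(2)) auto
  moreover have "\<forall>\<^sub>F n in sequentially. \<bar>C\<bar> * exp (- (c/2) * real n) < 1"
    using assms(1) by real_asymp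
  ultimately show "\<forall>\<^sub>F n in sequentially. C * exp (- c * real n) \<le> exp (- q * real n powr \<alpha>)"
    using eventually_gt_at_top[of 0]
  proof eventually_elim
    case (elim n)
    have "q * real n powr \<alpha> \<le> (\<bar>q\<bar> * real n powr (\<alpha> - 1)) * real n"
      using elim by (simp add: powr_diff mult_right_mono)
    also have "\<dots> \<le> (c / 2) * real n" using elim by (intro mult_right_mono) auto
    finally have 1: "- (c / 2) * real n \<le> - q * real n powr \<alpha>" by simp
    have "C * exp (- c * real n) \<le> \<bar>C\<bar> * exp (- c * real n)" by (simp add: mult_right_mono)
    also have "\<dots> = (\<bar>C\<bar> * exp (- (c/2) * real n)) * exp (- (c/2) * real n)"
      by (simp add: exp_add[symmetric] mult.assoc)
    also have "\<dots> \<le> 1 * exp (- (c/2) * real n)" using elim by (intro mult_right_mono) auto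
    also have "\<dots> \<le> exp (- q * real n powr \<alpha>)" using 1 by simp
    finally show ?case .
  qed
qed

lemma exp_small_mono:
  assumes "exp_small \<alpha> f" "\<forall>\<^sub>F n in sequentially. g n \<le> f n"
  shows "exp_small \<alpha> g"
  using assms unfolding exp_small_def by (fast elim: eventually_elim2 intro: order_trans)

text \<open>
  A sum decays at the slower of the two rates; the factor \<open>2\<close> is absorbed by an
  arbitrarily small loss in the rate.
\<close>
lemma eventually_add_le_exp:
  assumes f: "\<And>q'. q' < Q \<Longrightarrow> \<forall>\<^sub>F n in sequentially. f n \<le> exp (- q' * real n powr \<alpha>)"
    and g: "\<And>q'. q' < Q \<Longrightarrow> \<forall>\<^sub>F n in sequentially. g n \<le> exp (- q' * real n powr \<alpha>)"
    and "q < Q" "0 < \<alpha>"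
  shows "\<forall>\<^sub>F n in sequentially. f n + g n \<le> exp (- q * real n powr \<alpha>)"
proof -
  define r where "r = (q + Q) / 2"
  have r: "q < r" "r < Q" using assms by (auto simp: r_def)
  have "\<forall>\<^sub>F n in sequentially. 2 * exp (- (r - q) * real n powr \<alpha>) < 1"
    using r assms(4) by real_asymp
  with f[OF r(2)] g[OF r(2)] show ?thesis
  proof eventually_elim
    case (elim n)
    have "f n + g n \<le> 2 * exp (- r * real n powr \<alpha>)" using elim by simp
    also have "\<dots> = (2 * exp (- (r - q) * real n powr \<alpha>)) * exp (- q * real n powr \<alpha>)"
      by (simp add: exp_add[symmetric] mult.assoc algebra_simps)
    also have "\<dots> \<le> 1 * exp (- q * real n powr \<alpha>)" using elim by (intro mult_right_mono) auto
    finally show ?case by simp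
  qed
qed

lemma exp_small_add:
  assumes "exp_small \<alpha> f" "exp_small \<alpha> g" "0 < \<alpha>"
  shows "exp_small \<alpha> (\<lambda>n. f n + g n)"
  unfolding exp_small_def
proof
  fix q
  show "\<forall>\<^sub>F n in sequentially. f n + g n \<le> exp (- q * real n powr \<alpha>)"
    using assms by (intro eventually_add_le_exp[where Q="q+1"]) (auto simp: exp_small_def)
qed

lemma exp_small_eventually_less:
  assumes "exp_small \<alpha> f" "0 < \<alpha>" "0 < \<epsilon>"
  shows "\<forall>\<^sub>F n in sequentially. f n < \<epsilon>"
proof -
  have "\<forall>\<^sub>F n in sequentially. exp (- 1 * real n powr \<alpha>) < \<epsilon>"
    using assms(2,3) by real_asymp
  moreover have "\<forall>\<^sub>F n in sequentially. f n \<le> exp (- 1 * real n powr \<alpha>)"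
    using assms(1) unfolding exp_small_def by blast
  ultimately show ?thesis by eventually_elim linarith
qed

text \<open>
  The exponential Markov inequality. A general majorant \<open>h\<close>, rather than the
  exponential of a function, lets it also be applied to truncated exponentials.
\<close>
lemma emeasure_le_exp_nn_integral:
  assumes "A \<in> sets M" "h \<in> borel_measurable M" "\<And>x. x \<in> A \<Longrightarrow> ennreal (exp c) \<le> h x"
  shows "emeasure M A \<le> ennreal (exp (- c)) * (\<integral>\<^sup>+x. h x \<partial>M)"
proof -
  have "emeasure M A = (\<integral>\<^sup>+x. indicator A x \<partial>M)" using assms by simp
  also have "\<dots> \<le> (\<integral>\<^sup>+x. ennreal (exp (- c)) * h x \<partial>M)"
  proof (rule nn_integral_mono)
    fix x
    show "indicator A x \<le> ennreal (exp (- c)) * h x"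
    proof (cases "x \<in> A")
      case True
      have "(1::ennreal) = ennreal (exp (- c)) * ennreal (exp c)"
        by (simp add: ennreal_mult[symmetric] exp_add[symmetric])
      also have "\<dots> \<le> ennreal (exp (- c)) * h x" using assms(3)[OF True] by (rule mult_left_mono) simp
      finally show ?thesis using True by simp
    qed simp
  qed
  also have "\<dots> = ennreal (exp (- c)) * (\<integral>\<^sup>+x. h x \<partial>M)" using assms by (intro nn_integral_cmult)
  finally show ?thesis .
qed

lemma eventually_poly_exp_le:
  assumes "0 < \<alpha>" "q < Q"
  shows "\<forall>\<^sub>F n in sequentially. real n * C * exp (- Q * real n powr \<alpha>) \<le> exp (- q * real n powr \<alpha>)"
proof -
  have "\<forall>\<^sub>F n in sequentially. real n * \<bar>C\<bar> * exp (- (Q - q) * real n powr \<alpha>) < 1"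
    using assms by real_asymp
  then show ?thesis
  proof eventually_elim
    case (elim n)
    have "real n * C * exp (- Q * real n powr \<alpha>) \<le> real n * \<bar>C\<bar> * exp (- Q * real n powr \<alpha>)"
      by (intro mult_right_mono mult_left_mono) auto
    also have "\<dots> = (real n * \<bar>C\<bar> * exp (- (Q - q) * real n powr \<alpha>)) * exp (- q * real n powr \<alpha>)"
      by (simp add: exp_add[symmetric] algebra_simps)
    also have "\<dots> \<le> 1 * exp (- q * real n powr \<alpha>)" using elim by (intro mult_right_mono) auto
    finally show ?case by simp
  qed
qed

text \<open>
  The counterpart for lower bounds: a negligible summand can be dropped at the price of an
  arbitrarily small loss in the rate.
\<close>
lemma eventually_exp_le_of_add:
  assumes f: "\<forall>\<^sub>F n in sequentially. exp (- q' * real n powr \<alpha>) \<le> f n + g n" and g: "exp_small \<alpha> g"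
    and q: "q' < q" and \<alpha>: "0 < \<alpha>"
  shows "\<forall>\<^sub>F n in sequentially. exp (- q * real n powr \<alpha>) \<le> f n"
proof -
  have "\<forall>\<^sub>F n in sequentially. g n \<le> exp (- (q' + 1) * real n powr \<alpha>)"
    using g unfolding exp_small_def by blast
  moreover have "\<forall>\<^sub>F n in sequentially. exp (- 1 * real n powr \<alpha>) + exp (- (q - q') * real n powr \<alpha>) < 1"
  proof -
    have "0 < q - q'" using q by simp
    then have "\<forall>\<^sub>F n in sequentially. exp (- (q - q') * real n powr \<alpha>) < 1 / 2"
      using \<alpha> by real_asymp
    moreover have "\<forall>\<^sub>F n in sequentially. exp (- 1 * real n powr \<alpha>) < 1 / 2" using \<alpha> by real_asymp
    ultimately show ?thesis by eventually_elim linarith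
  qed
  ultimately show ?thesis using f
  proof eventually_elim
    case (elim n)
    let ?E = "exp (- q' * real n powr \<alpha>)"
    have "?E * (exp (- 1 * real n powr \<alpha>) + exp (- (q - q') * real n powr \<alpha>)) \<le> ?E * 1"
      using elim(2) by (intro mult_left_mono) auto
    moreover have "?E * exp (- 1 * real n powr \<alpha>) = exp (- (q' + 1) * real n powr \<alpha>)"
      "?E * exp (- (q - q') * real n powr \<alpha>) = exp (- q * real n powr \<alpha>)"
      by (simp_all only: exp_add[symmetric] distrib_right[symmetric]) simp_all
    ultimately have "exp (- (q' + 1) * real n powr \<alpha>) + exp (- q * real n powr \<alpha>) \<le> ?E"
      by (simp only: distrib_left mult_1_right)
    then show ?case using elim(1,3) by linarith
  qed
qed

lemma eventually_at_right_0_obtain: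
  assumes "\<forall>\<^sub>F \<delta> in at_right (0::real). P \<delta>"
  obtains \<delta> where "0 < \<delta>" "\<delta> < 1" "P \<delta>"
proof -
  have "\<forall>\<^sub>F \<delta> in at_right (0::real). 0 < \<delta>" by (simp add: eventually_at_right_less)
  moreover have "\<forall>\<^sub>F \<delta> in at_right (0::real). \<delta> < 1" by (rule eventually_at_right_real[of 0 1, THEN eventually_mono]) auto
  ultimately have "\<forall>\<^sub>F \<delta> in at_right (0::real). 0 < \<delta> \<and> \<delta> < 1 \<and> P \<delta>" using assms by eventually_elim simp
  from eventually_happens[OF this] show ?thesis using that by auto
qed

text \<open>
  The bound on Gamma-type moment generating functions: with \<open>s\<close> of either sign it serves both
  tails.
\<close>
lemma one_minus_powr_neg_le:
  assumes "\<bar>s\<bar> \<le> 1 / 2" "0 \<le> (b::real)"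
  shows "(1 - s) powr (- b) \<le> exp (b * (s + 2 * s\<^sup>2))"
proof -
  have "\<bar>ln (1 + - s) - - s\<bar> \<le> 2 * (- s)\<^sup>2"
    using assms by (intro abs_ln_one_plus_x_minus_x_bound) auto
  then have "- ln (1 - s) \<le> s + 2 * s\<^sup>2" by simp
  then have "b * - ln (1 - s) \<le> b * (s + 2 * s\<^sup>2)" using assms by (intro mult_left_mono)
  moreover have "s < 1" using assms by linarith
  ultimately show ?thesis by (simp add: powr_def)
qed

lemma exp_le_quadratic:
  assumes "0 \<le> (x::real)"
  shows "exp x \<le> 1 + x + x\<^sup>2 * exp x"
proof -
  have "exp (-x) \<ge> 1 - x" using exp_ge_add_one_self[of "-x"] by simp
  then have 1: "(1 - x) * exp x \<le> 1"
    by (metis exp_gt_zero exp_minus_inverse mult.commute mult_le_cancel_left_pos exp_minus right_inverse)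
  then have "(1 + x) * ((1 - x) * exp x) \<le> (1 + x) * 1" using assms by (intro mult_left_mono) auto
  then show ?thesis by (simp add: algebra_simps power2_eq_square)
qed

lemma exp_minus_le_quadratic:
  assumes "0 \<le> (x::real)"
  shows "exp (- x) \<le> 1 - x + x\<^sup>2"
proof (cases "x \<le> 1")
  case True
  have "1 + x \<le> exp x" by (rule exp_ge_add_one_self)
  then have "exp (- x) \<le> 1 / (1 + x)" using assms by (simp add: exp_minus divide_simps)
  also have "\<dots> \<le> 1 - x + x\<^sup>2"
    using assms by (simp add: divide_simps) (simp add: algebra_simps power2_eq_square)
  finally show ?thesis .
next
  case False
  then have "exp (- x) \<le> 1" "x * 1 \<le> x * x" using assms by (auto intro!: mult_left_mono)
  then show ?thesis unfolding power2_eq_square by linarith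
qed

lemma power2_powr_half: "(z\<^sup>2) powr (p / 2) = \<bar>z::real\<bar> powr p"
proof (cases "z = 0")
  case False
  then have "z\<^sup>2 = \<bar>z\<bar> powr 2" by simp
  then show ?thesis by (simp only: powr_powr) simp
qed simp

section \<open>Large deviation principles with an increasing rate\<close>

lemma ereal_le_if_real_less:
  fixes a b :: ereal
  assumes "\<And>c. a < ereal c \<Longrightarrow> b \<le> ereal c"
  shows "b \<le> a"
proof (rule ccontr)
  assume "\<not> b \<le> a"
  then obtain c where "a < ereal c" "ereal c < b" using ereal_dense2[of a b] by (auto simp: not_le)
  with assms[of c] show False by simp
qed

lemma log_prob_le:
  assumes "0 \<le> q" "q \<le> exp (- c * N)" "0 < N"
  shows "1 / ereal N * log_prob q \<le> ereal (- c)"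
proof (cases "q = 0")
  case True
  then show ?thesis using assms by (simp add: log_prob_def one_ereal_def)
next
  case False
  then have "ln q \<le> - c * N" using assms by (metis exp_ge_zero less_eq_real_def ln_exp ln_le_cancel_iff exp_gt_zero)
  then have "1 / N * ln q \<le> - c" using assms by (simp add: field_simps)
  then show ?thesis using False assms by (simp add: log_prob_def one_ereal_def)
qed

lemma log_prob_ge:
  assumes "exp (- c * N) \<le> q" "0 < N"
  shows "ereal (- c) \<le> 1 / ereal N * log_prob q"
proof -
  have q: "0 < q" using assms(1) exp_gt_zero less_le_trans by blast
  then have "- c * N \<le> ln q" using assms by (simp add: ln_ge_iff)
  then have "- c \<le> 1 / N * ln q" using assms by (simp add: field_simps)
  then show ?thesis using q assms by (simp add: log_prob_def one_ereal_def)
qed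

lemma good_rate_function_increasing:
  fixes J :: "real \<Rightarrow> real"
  assumes cont: "continuous_on {y\<^sub>0..} J" and mono: "\<And>x y. y\<^sub>0 \<le> x \<Longrightarrow> x \<le> y \<Longrightarrow> J x \<le> J y"
    and zero: "J y\<^sub>0 = 0" and unb: "\<And>a. \<exists>b\<ge>y\<^sub>0. a < J b"
  shows "good_rate_function (\<lambda>y. if y\<^sub>0 \<le> y then ereal (J y) else \<infinity>)" (is "good_rate_function ?I")
  unfolding good_rate_function_def
proof (intro conjI allI)
  show "0 \<le> ?I x" for x using mono[of y\<^sub>0 x] zero by auto
  show "?I x \<le> Liminf (at x) ?I" for x
    unfolding le_Liminf_iff
  proof (intro allI impI)
    fix c assume c: "c < ?I x"
    show "\<forall>\<^sub>F z in at x. c < ?I z"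
    proof (cases "y\<^sub>0 \<le> x")
      case True
      then have "((\<lambda>z. ereal (J z)) \<longlongrightarrow> ereal (J x)) (at x within {y\<^sub>0..})"
        using cont by (intro tendsto_intros) (auto simp: continuous_on)
      then have "\<forall>\<^sub>F z in at x within {y\<^sub>0..}. c < ereal (J z)"
        using c True by (intro order_tendstoD(1)) auto
      then have "\<forall>\<^sub>F z in at x. z \<in> {y\<^sub>0..} \<longrightarrow> c < ereal (J z)"
        by (simp add: eventually_at_filter)
      then show ?thesis by (rule eventually_mono) (use c True in auto)
    next
      case False
      then have "\<forall>\<^sub>F z in at x. z < y\<^sub>0" by (intro order_tendstoD(2)[OF tendsto_ident_at]) auto
      then show ?thesis by (rule eventually_mono) (use c False in auto)
    qed
  qed
  show "compact {x. ?I x \<le> ereal a}" for a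
  proof -
    obtain b where b: "y\<^sub>0 \<le> b" "a < J b" using unb by blast
    have eq: "{x. ?I x \<le> ereal a} = {y\<^sub>0..b} \<inter> J -` {..a}"
    proof (intro equalityI subsetI)
      fix x assume "x \<in> {x. ?I x \<le> ereal a}"
      then have x: "y\<^sub>0 \<le> x" "J x \<le> a" by (auto split: if_splits)
      then have "x \<le> b" using mono[of b x] b by linarith
      then show "x \<in> {y\<^sub>0..b} \<inter> J -` {..a}" using x by simp
    qed auto
    have "continuous_on {y\<^sub>0..b} J" by (rule continuous_on_subset[OF cont]) auto
    then have "closed ({y\<^sub>0..b} \<inter> J -` {..a})" by (intro continuous_closed_preimage) auto
    moreover have "bounded ({y\<^sub>0..b} \<inter> J -` {..a})" by (rule bounded_subset[of "{y\<^sub>0..b}"]) auto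
    ultimately show ?thesis unfolding eq compact_eq_bounded_closed by blast
  qed
qed

text \<open>
  A Lebesgue set is a Borel set up to a subset of a Borel null set, and absolute continuity
  turns the latter into a null event.
\<close>
lemma (in prob_space) lebesgue_event_completion:
  fixes Y :: "'a \<Rightarrow> real"
  assumes Y: "Y \<in> borel_measurable M" and null: "\<And>N. N \<in> null_sets lborel \<Longrightarrow> emeasure M {\<omega> \<in> space M. Y \<omega> \<in> N} = 0"
    and A: "A \<in> sets lebesgue"
  shows "{\<omega> \<in> space M. Y \<omega> \<in> A} \<in> sets (completion M)"
proof -
  from A obtain S N N' where SN: "A = S \<union> N" "N \<subseteq> N'" "N' \<in> null_sets lborel" "S \<in> sets lborel"
    by (elim sets_completionE) auto
  have S: "{\<omega> \<in> space M. Y \<omega> \<in> S} \<in> sets M" using measurable_sets[OF Y, of S] SN(4) by (simp add: vimage_def Int_def conj_commute)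
  have "{\<omega> \<in> space M. Y \<omega> \<in> N'} \<in> sets M" using measurable_sets[OF Y, of N'] null_setsD2[OF SN(3)] by (simp add: vimage_def Int_def conj_commute)
  then have "{\<omega> \<in> space M. Y \<omega> \<in> N'} \<in> null_sets M" using null[OF SN(3)] by auto
  moreover have "{\<omega> \<in> space M. Y \<omega> \<in> A} = {\<omega> \<in> space M. Y \<omega> \<in> S} \<union> {\<omega> \<in> space M. Y \<omega> \<in> N}" using SN(1) by auto
  ultimately show ?thesis using S SN(2)
    by (intro sets_completionI[of _ "{\<omega> \<in> space M. Y \<omega> \<in> S}" "{\<omega> \<in> space M. Y \<omega> \<in> N}" "{\<omega> \<in> space M. Y \<omega> \<in> N'}"]) auto
qed

text \<open>
  A rate function that vanishes at \<open>y\<^sub>0\<close>, is infinite below and increases above is determined by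
  rays and small intervals. If \<open>y\<^sub>0\<close> lies outside the closure of \<open>A\<close>, then \<open>A\<close> is contained in a left
  ray strictly below \<open>y\<^sub>0\<close>, which is negligible, and in the right ray from the first point \<open>y\<^sub>1\<close> of
  the closure above \<open>y\<^sub>0\<close>; as the rate increases, \<open>y\<^sub>1\<close> attains its infimum. For the lower bound a
  point of the interior is moved slightly to the right, since the local bound is only assumed
  strictly above \<open>y\<^sub>0\<close>.
\<close>
lemma (in prob_space) satisfies_LDP_increasing_rate:
  fixes Y :: "nat \<Rightarrow> 'a \<Rightarrow> real" and J :: "real \<Rightarrow> real"
  assumes \<alpha>: "0 < \<alpha>"
    and cont: "continuous_on {y\<^sub>0..} J" and mono: "\<And>x y. y\<^sub>0 \<le> x \<Longrightarrow> x \<le> y \<Longrightarrow> J x \<le> J y"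
    and zero: "J y\<^sub>0 = 0" and unb: "\<And>a. \<exists>b\<ge>y\<^sub>0. a < J b"
    and Y: "\<forall>\<^sub>F n in sequentially. Y n \<in> borel_measurable M"
    and null: "\<forall>\<^sub>F n in sequentially. \<forall>N \<in> null_sets lborel. emeasure M {\<omega> \<in> space M. Y n \<omega> \<in> N} = 0"
    and upper: "\<And>y q. y\<^sub>0 < y \<Longrightarrow> q < J y \<Longrightarrow> \<forall>\<^sub>F n in sequentially. prob {\<omega> \<in> space M. y \<le> Y n \<omega>} \<le> exp (- q * real n powr \<alpha>)"
    and lower: "\<And>y. y < y\<^sub>0 \<Longrightarrow> exp_small \<alpha> (\<lambda>n. prob {\<omega> \<in> space M. Y n \<omega> \<le> y})"
    and local_lower: "\<And>y e q. y\<^sub>0 < y \<Longrightarrow> 0 < e \<Longrightarrow> J y < q \<Longrightarrow> \<forall>\<^sub>F n in sequentially. exp (- q * real n powr \<alpha>) \<le> prob {\<omega> \<in> space M. Y n \<omega> \<in> {y - e<..<y + e}}"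
  shows "satisfies_LDP Y (\<lambda>n. ereal (real n powr \<alpha>)) (\<lambda>y. if y\<^sub>0 \<le> y then ereal (J y) else \<infinity>)"
    (is "satisfies_LDP Y _ ?I")
  unfolding satisfies_LDP_def Let_def
proof (intro conjI ballI)
  interpret C: prob_space "completion M" by (rule prob_space_completion)
  show "good_rate_function ?I" by (rule good_rate_function_increasing[OF cont mono zero unb])
  fix A :: "real set" assume A: "A \<in> sets lebesgue"
  let ?P = "\<lambda>n A. measure (completion M) {\<omega> \<in> space M. Y n \<omega> \<in> A}"
  let ?r = "\<lambda>n. 1 / ereal (real n powr \<alpha>) * log_prob (?P n A)"
  show "liminf ?r \<le> limsup ?r" by (intro Liminf_le_Limsup) simp
  have pos: "\<forall>\<^sub>F n in sequentially. 0 < real n powr \<alpha>"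
    using eventually_gt_at_top[of 0] by eventually_elim simp
  have borel: "?P n B = prob {\<omega> \<in> space M. Y n \<omega> \<in> B} \<and> {\<omega> \<in> space M. Y n \<omega> \<in> B} \<in> events"
    if "Y n \<in> borel_measurable M" "B \<in> sets borel" for n B
  proof -
    note that [measurable]
    have "{\<omega> \<in> space M. Y n \<omega> \<in> B} \<in> events" by measurable
    then show ?thesis by simp
  qed
  show "- (INF x\<in>interior A. ?I x) \<le> liminf ?r"
  proof -
    have "- liminf ?r \<le> ?I y" if y: "y \<in> interior A" for y
    proof (cases "y\<^sub>0 \<le> y")
      case True
      have "- liminf ?r \<le> ereal (J y)"
      proof (rule ereal_le_if_real_less)
        fix c assume "ereal (J y) < ereal c"
        then have c: "J y < c" by simp
        have "(J \<longlongrightarrow> J y) (at y within {y\<^sub>0..})" using cont True by (auto simp: continuous_on)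
        then have "(J \<longlongrightarrow> J y) (at_right y)" by (rule tendsto_within_subset) (use True in auto)
        then have "\<forall>\<^sub>F z in at_right y. J z < c" using c by (rule order_tendstoD(2))
        moreover have "\<forall>\<^sub>F z in at_right y. z \<in> interior A"
          using y by (intro eventually_at_topological[THEN iffD2]) (auto intro!: exI[of _ "interior A"])
        moreover have "\<forall>\<^sub>F z in at_right y. y < z" by (simp add: eventually_at_right_less)
        ultimately have "\<forall>\<^sub>F z in at_right y. J z < c \<and> z \<in> interior A \<and> y < z" by eventually_elim simp
        from eventually_happens[OF this] obtain z where z: "J z < c" "z \<in> interior A" "y < z" by auto
        then obtain e where e: "0 < e" "ball z e \<subseteq> A" by (auto simp: mem_interior)
        have sub: "{z - e<..<z + e} \<subseteq> A" using e(2) by (auto simp: subset_eq dist_real_def)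
        have z0: "y\<^sub>0 < z" using True z by simp
        have "\<forall>\<^sub>F n in sequentially. ereal (- c) \<le> ?r n"
          using local_lower[OF z0 e(1) z(1)] Y null pos
        proof eventually_elim
          case (elim n)
          note b = borel[OF elim(2), of "{z - e<..<z + e}"]
          have "{\<omega> \<in> space M. Y n \<omega> \<in> A} \<in> sets (completion M)"
            by (rule lebesgue_event_completion[OF elim(2) _ A]) (use elim(3) in blast)
          then have "?P n {z - e<..<z + e} \<le> ?P n A"
            using sub by (intro C.finite_measure_mono) auto
          then show ?case using elim(1,4) b by (intro log_prob_ge) auto
        qed
        then have "ereal (- c) \<le> liminf ?r" by (rule Liminf_bounded)
        then have "- liminf ?r \<le> - ereal (- c)" by (simp only: ereal_minus_le_minus)
        then show "- liminf ?r \<le> ereal c" by (simp only: uminus_ereal.simps minus_minus)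
      qed
      then show ?thesis using True by simp
    qed simp
    then have "- liminf ?r \<le> (INF x\<in>interior A. ?I x)" by (rule INF_greatest)
    then show ?thesis by (simp add: ereal_uminus_le_reorder)
  qed
  show "limsup ?r \<le> - (INF x\<in>closure A. ?I x)"
  proof (rule ereal_le_if_real_less)
    fix d assume "- (INF x\<in>closure A. ?I x) < ereal d"
    define c where "c = - d"
    have c: "ereal c < (INF x\<in>closure A. ?I x)"
    proof -
      have "- (INF x\<in>closure A. ?I x) < - ereal c"
        using \<open>- (INF x\<in>closure A. ?I x) < ereal d\<close> unfolding c_def by (simp only: uminus_ereal.simps minus_minus)
      then show ?thesis by (simp only: ereal_minus_less_minus)
    qed
    have I: "ereal c < ?I y" if "y \<in> closure A" for y using c INF_lower[OF that, of ?I] by (rule less_le_trans)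
    have "\<forall>\<^sub>F n in sequentially. ?P n A \<le> exp (- c * real n powr \<alpha>)"
    proof (cases "c < 0")
      case True
      have "?P n A \<le> exp (- c * real n powr \<alpha>)" for n
      proof -
        have "?P n A \<le> 1" by (rule C.prob_le_1)
        also have "1 \<le> exp (- c * real n powr \<alpha>)" using True by (simp add: mult_nonpos_nonneg)
        finally show ?thesis .
      qed
      then show ?thesis by simp
    next
      case False
      then have "y\<^sub>0 \<notin> closure A" using I[of y\<^sub>0] zero by auto
      then have "y\<^sub>0 \<in> - closure A" "open (- closure A)" by auto
      then obtain e where e: "0 < e" "ball y\<^sub>0 e \<subseteq> - closure A" by (metis open_contains_ball)
      \<comment> \<open>\<open>y\<^sub>1\<close> is the first point of the closure above \<open>y\<^sub>0\<close>; without such a point, any point with large rate will do.\<close>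
      obtain y\<^sub>1 where y\<^sub>1: "y\<^sub>0 < y\<^sub>1" "c < J y\<^sub>1" "A \<subseteq> {..y\<^sub>0 - e / 2} \<union> {y\<^sub>1..}"
      proof -
        let ?K = "closure A \<inter> {y\<^sub>0..}"
        have left: "x \<le> y\<^sub>0 - e / 2" if "x \<in> A" "x < y\<^sub>0" for x
        proof (rule ccontr)
          assume "\<not> x \<le> y\<^sub>0 - e / 2"
          then have "x \<in> ball y\<^sub>0 e" using that(2) e(1) by (simp add: dist_real_def)
          then show False using e(2) closure_subset[of A] that(1) by auto
        qed
        show ?thesis
        proof (cases "?K = {}")
          case True
          obtain b where b: "y\<^sub>0 \<le> b" "max c 0 < J b" using unb by blast
          have "b \<noteq> y\<^sub>0" using b zero by auto
          moreover have "x < y\<^sub>0" if "x \<in> A" for x using True that closure_subset[of A] by (auto simp: not_le[symmetric])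
          ultimately show ?thesis using b left by (intro that[of b]) auto
        next
          case F: False
          have clo: "closed ?K" by (intro closed_Int) auto
          have bdd: "bdd_below ?K" by (rule bdd_belowI[of _ y\<^sub>0]) auto
          have inf: "Inf ?K \<in> ?K" by (rule closed_contains_Inf[OF F bdd clo])
          then have "y\<^sub>0 < Inf ?K" using \<open>y\<^sub>0 \<notin> closure A\<close> by (auto simp: less_le)
          moreover have "c < J (Inf ?K)" using I[of "Inf ?K"] inf by auto
          moreover have "A \<subseteq> {..y\<^sub>0 - e / 2} \<union> {Inf ?K..}"
          proof
            fix x assume x: "x \<in> A"
            show "x \<in> {..y\<^sub>0 - e / 2} \<union> {Inf ?K..}"
            proof (cases "x < y\<^sub>0")
              case False
              then have "x \<in> ?K" using x closure_subset[of A] by auto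
              then show ?thesis using cInf_lower[OF _ bdd] by auto
            qed (use left x in auto)
          qed
          ultimately show ?thesis by (rule that)
        qed
      qed
      have "\<forall>\<^sub>F n in sequentially. prob {\<omega> \<in> space M. Y n \<omega> \<le> y\<^sub>0 - e / 2} + prob {\<omega> \<in> space M. y\<^sub>1 \<le> Y n \<omega>} \<le> exp (- c * real n powr \<alpha>)"
      proof (rule eventually_add_le_exp[where Q="J y\<^sub>1"])
        show "\<forall>\<^sub>F n in sequentially. prob {\<omega> \<in> space M. Y n \<omega> \<le> y\<^sub>0 - e / 2} \<le> exp (- q' * real n powr \<alpha>)" for q'
          using lower[of "y\<^sub>0 - e / 2"] e(1) by (simp add: exp_small_def)
      qed (use upper y\<^sub>1 \<alpha> in auto)
      then show ?thesis using Y
      proof eventually_elim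
        case (elim n)
        let ?L = "{..y\<^sub>0 - e / 2}" and ?U = "{y\<^sub>1..}"
        note b = borel[OF elim(2), of ?L] borel[OF elim(2), of ?U] borel[OF elim(2), of "?L \<union> ?U"]
        have "?P n A \<le> ?P n (?L \<union> ?U)"
          using y\<^sub>1(3) b(3) by (intro C.finite_measure_mono) auto
        also have "\<dots> = prob ({\<omega> \<in> space M. Y n \<omega> \<in> ?L} \<union> {\<omega> \<in> space M. Y n \<omega> \<in> ?U})"
          using b(3) by (auto intro!: arg_cong[where f=prob])
        also have "\<dots> \<le> prob {\<omega> \<in> space M. Y n \<omega> \<in> ?L} + prob {\<omega> \<in> space M. Y n \<omega> \<in> ?U}"
          using b(1,2) by (intro measure_Un_le) auto
        finally show ?case using elim(1) by simp
      qed
    qed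
    then have "\<forall>\<^sub>F n in sequentially. ?r n \<le> ereal (- c)"
      using pos by eventually_elim (intro log_prob_le; simp)
    then have "limsup ?r \<le> ereal (- c)" by (rule Limsup_bounded)
    then show "limsup ?r \<le> ereal d" by (simp add: c_def)
  qed
qed

section \<open>Moments of the generalised Gaussian density\<close>

lemma nn_integral_exp_tail:
  assumes "0 < a"
  shows "(\<integral>\<^sup>+u. ennreal (a * exp (- a * u)) * indicator {b..} u \<partial>lborel) = ennreal (exp (- a * b))"
proof -
  have lim: "((\<lambda>u. - exp (- a * u)) \<longlongrightarrow> - 0) at_top"
    using assms by real_asymp
  have "(\<integral>\<^sup>+u. ennreal (a * exp (- a * u)) * indicator {b..} u \<partial>lborel) = ennreal (- 0 - (- exp (- a * b)))"
    by (rule nn_integral_FTC_atLeast[OF _ _ _ lim])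
      (use assms in \<open>auto intro!: derivative_eq_intros\<close>)
  then show ?thesis by simp
qed

text \<open>
  Writing \<open>exp (- a N)\<close> as the integral of the exponential density over \<open>{N..}\<close> turns an
  integral against \<open>exp (- a N)\<close> into a mixture over the sublevel sets of \<open>N\<close>. It is used on the line
  to compute moments and in \<open>n\<close> dimensions to relate the generalised Gaussian to the ball.
\<close>
lemma layer_cake_exp:
  fixes N :: "'a \<Rightarrow> real"
  assumes "sigma_finite_measure L" and [measurable]: "f \<in> borel_measurable L" "N \<in> borel_measurable L"
    and a: "0 < a"
  shows "(\<integral>\<^sup>+x. f x * ennreal (exp (- a * N x)) \<partial>L)
    = (\<integral>\<^sup>+u. ennreal (a * exp (- a * u)) * (\<integral>\<^sup>+x. f x * indicator {x. N x \<le> u} x \<partial>L) \<partial>lborel)"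
proof -
  interpret L: sigma_finite_measure L by fact
  interpret P: pair_sigma_finite lborel L ..
  have "(\<integral>\<^sup>+x. f x * ennreal (exp (- a * N x)) \<partial>L)
     = (\<integral>\<^sup>+x. f x * (\<integral>\<^sup>+u. ennreal (a * exp (- a * u)) * indicator {N x..} u \<partial>lborel) \<partial>L)"
    by (simp only: nn_integral_exp_tail[OF a])
  also have "\<dots> = (\<integral>\<^sup>+x. (\<integral>\<^sup>+u. ennreal (a * exp (- a * u)) * (f x * indicator {x. N x \<le> u} x) \<partial>lborel) \<partial>L)"
  proof (rule nn_integral_cong)
    fix x
    have "f x * (\<integral>\<^sup>+u. ennreal (a * exp (- a * u)) * indicator {N x..} u \<partial>lborel)
       = (\<integral>\<^sup>+u. f x * (ennreal (a * exp (- a * u)) * indicator {N x..} u) \<partial>lborel)"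
      by (rule nn_integral_cmult[symmetric]) simp
    also have "\<dots> = (\<integral>\<^sup>+u. ennreal (a * exp (- a * u)) * (f x * indicator {x. N x \<le> u} x) \<partial>lborel)"
      by (intro nn_integral_cong) (simp add: indicator_def mult.commute)
    finally show "f x * (\<integral>\<^sup>+u. ennreal (a * exp (- a * u)) * indicator {N x..} u \<partial>lborel)
      = (\<integral>\<^sup>+u. ennreal (a * exp (- a * u)) * (f x * indicator {x. N x \<le> u} x) \<partial>lborel)" .
  qed
  also have "\<dots> = (\<integral>\<^sup>+u. (\<integral>\<^sup>+x. ennreal (a * exp (- a * u)) * (f x * indicator {x. N x \<le> u} x) \<partial>L) \<partial>lborel)"
    by (rule P.Fubini') (simp add: indicator_def)
  also have "\<dots> = (\<integral>\<^sup>+u. ennreal (a * exp (- a * u)) * (\<integral>\<^sup>+x. f x * indicator {x. N x \<le> u} x \<partial>L) \<partial>lborel)"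
    by (intro nn_integral_cong nn_integral_cmult) (simp add: indicator_def)
  finally show ?thesis .
qed

lemma nn_integral_powr_exp:
  assumes a: "0 < a" and s: "-1 < s"
  shows "(\<integral>\<^sup>+u. ennreal (u powr s * exp (- a * u)) * indicator {0..} u \<partial>lborel)
    = ennreal (a powr (- (s + 1)) * Gamma (s + 1))"
proof -
  have 1: "(\<integral>\<^sup>+t. ennreal (t powr s * exp (- t)) * indicator {0..} t \<partial>lborel) = ennreal (Gamma (s + 1))"
    by (rule nn_integral_has_integral_lebesgue')
      (use Gamma_integral_real[of "s+1"] s in \<open>auto simp: exp_minus field_simps\<close>)
  have "ennreal (Gamma (s + 1)) = ennreal \<bar>a\<bar> * (\<integral>\<^sup>+u. ennreal ((0 + a * u) powr s * exp (- (0 + a * u))) * indicator {0..} (0 + a * u) \<partial>lborel)"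
    unfolding 1[symmetric] by (rule nn_integral_real_affine) (use a in auto)
  also have "\<dots> = ennreal \<bar>a\<bar> * (\<integral>\<^sup>+u. ennreal (a powr s) * (ennreal (u powr s * exp (- a * u)) * indicator {0..} u) \<partial>lborel)"
  proof (rule arg_cong[OF nn_integral_cong])
    fix u :: real
    show "ennreal ((0 + a * u) powr s * exp (- (0 + a * u))) * indicator {0..} (0 + a * u)
      = ennreal (a powr s) * (ennreal (u powr s * exp (- a * u)) * indicator {0..} u)"
      using a by (cases "0 \<le> u") (simp_all add: powr_mult ennreal_mult mult.assoc zero_le_mult_iff)
  qed
  also have "\<dots> = ennreal (a powr (s+1)) * (\<integral>\<^sup>+u. ennreal (u powr s * exp (- a * u)) * indicator {0..} u \<partial>lborel)"
    using a by (subst nn_integral_cmult) (simp_all add: powr_add mult.assoc[symmetric] ennreal_mult[symmetric] mult.commute)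
  finally have "ennreal (a powr (- (s + 1))) * ennreal (Gamma (s + 1)) = 
     ennreal (a powr (- (s + 1))) * (ennreal (a powr (s+1)) * (\<integral>\<^sup>+u. ennreal (u powr s * exp (- a * u)) * indicator {0..} u \<partial>lborel))"
    by simp
  also have "\<dots> = (\<integral>\<^sup>+u. ennreal (u powr s * exp (- a * u)) * indicator {0..} u \<partial>lborel)"
    using a by (simp add: mult.assoc[symmetric] ennreal_mult[symmetric] powr_add[symmetric])
  finally show ?thesis using s by (simp add: ennreal_mult[symmetric])
qed

lemma nn_integral_even_power_Icc:
  assumes "0 \<le> b"
  shows "(\<integral>\<^sup>+z. ennreal (z ^ (2 * j)) * indicator {-b..b} z \<partial>lborel) = ennreal (2 * b ^ (2 * j + 1) / (2 * j + 1))"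
proof -
  have "(\<integral>\<^sup>+z. ennreal (z ^ (2 * j)) * indicator {-b..b} z \<partial>lborel)
     = ennreal (b ^ (2*j+1) / real (2*j+1) - (-b) ^ (2*j+1) / real (2*j+1))"
    proof (rule nn_integral_FTC_Icc)
      show "- b \<le> b" using assms by simp
      show "0 \<le> z ^ (2 * j)" for z :: real by simp
      have "((\<lambda>z. z ^ (2*j+1) / real (2*j+1)) has_real_derivative (real (2*j+1) * z ^ (2*j)) / real (2*j+1)) (at z)" for z :: real
        by (intro DERIV_cdivide) (use DERIV_pow[of "2*j+1" z UNIV] in simp)
      then show "((\<lambda>z. z ^ (2*j+1) / real (2*j+1)) has_real_derivative z ^ (2*j)) (at z)" for z :: real
        by (simp del: of_nat_Suc of_nat_add)
    qed simp
  then show ?thesis by (simp add: add_divide_distrib[symmetric])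
qed

lemma abs_powr_le_iff:
  assumes "0 < p" "0 \<le> u"
  shows "\<bar>z::real\<bar> powr p \<le> u \<longleftrightarrow> \<bar>z\<bar> \<le> u powr (1 / p)"
proof -
  have "\<bar>z\<bar> powr p \<le> u" if "\<bar>z\<bar> \<le> u powr (1 / p)"
    using powr_mono2[OF _ _ that, of p] assms by (simp add: powr_powr)
  moreover have "\<bar>z\<bar> \<le> u powr (1 / p)" if "\<bar>z\<bar> powr p \<le> u"
    using powr_mono2[OF _ _ that, of "1/p"] assms by (simp add: powr_powr)
  ultimately show ?thesis by blast
qed

text \<open>
  The layer cake formula reduces the moments to integrals of powers over symmetric intervals
  and a Gamma integral.
\<close>
lemma nn_integral_even_power_exp_powr:
  assumes a: "0 < a" and p: "0 < p"
  shows "(\<integral>\<^sup>+z. ennreal (z ^ (2 * j) * exp (- a * \<bar>z\<bar> powr p)) \<partial>lborel)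
    = ennreal (2 / (2 * j + 1) * a powr (- ((2 * j + 1) / p)) * Gamma (1 + (2 * j + 1) / p))"
    (is "_ = ennreal ?R")
proof -
  define s where "s = (2 * real j + 1) / p"
  have s: "0 < s" unfolding s_def using p by (intro divide_pos_pos) auto
  have in1: "(\<integral>\<^sup>+z. ennreal (z ^ (2 * j)) * indicator {z. \<bar>z\<bar> powr p \<le> u} z \<partial>lborel)
      = ennreal (2 / (2 * real j + 1) * u powr s) * indicator {0..} u" for u :: real
  proof (cases "0 \<le> u")
    case True
    have "{z. \<bar>z\<bar> powr p \<le> u} = {- (u powr (1/p)) .. u powr (1/p)}"
      unfolding abs_powr_le_iff[OF p True] abs_le_iff minus_le_iff[of _ "u powr (1/p)"] by fastforce
    then have "(\<integral>\<^sup>+z. ennreal (z ^ (2 * j)) * indicator {z. \<bar>z\<bar> powr p \<le> u} z \<partial>lborel)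
       = ennreal (2 * (u powr (1/p)) ^ (2 * j + 1) / (2 * j + 1))"
      using nn_integral_even_power_Icc[of "u powr (1/p)" j] by simp
    also have "(u powr (1/p)) ^ (2 * j + 1) = u powr s"
    proof (cases "u = 0")
      case False
      with True have "0 < u powr (1/p)" by simp
      then have "(u powr (1/p)) ^ (2 * j + 1) = (u powr (1/p)) powr real (2*j+1)" by (rule powr_realpow[symmetric])
      then show ?thesis by (simp add: powr_powr s_def add.commute)
    qed (use p in simp)
    finally show ?thesis using True by simp
  next
    case False
    then have "\<not> \<bar>z\<bar> powr p \<le> u" for z
      by (metis order_trans powr_ge_zero)
    then show ?thesis using False by simp
  qed
  have "(\<integral>\<^sup>+z. ennreal (z ^ (2 * j) * exp (- a * \<bar>z\<bar> powr p)) \<partial>lborel)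
      = (\<integral>\<^sup>+z. ennreal (z ^ (2 * j)) * ennreal (exp (- a * \<bar>z\<bar> powr p)) \<partial>lborel)"
    by (intro nn_integral_cong ennreal_mult) auto
  also have "\<dots> = (\<integral>\<^sup>+u. ennreal (a * exp (- a * u)) * (ennreal (2 / (2 * real j + 1) * u powr s) * indicator {0..} u) \<partial>lborel)"
    by (subst layer_cake_exp[OF sigma_finite_lborel _ _ a]) (simp_all add: in1)
  also have "\<dots> = (\<integral>\<^sup>+u. ennreal (a * (2 / (2 * real j + 1))) * (ennreal (u powr s * exp (- a * u)) * indicator {0..} u) \<partial>lborel)"
  proof (rule nn_integral_cong)
    fix u
    show "ennreal (a * exp (- a * u)) * (ennreal (2 / (2 * real j + 1) * u powr s) * indicator {0..} u)
      = ennreal (a * (2 / (2 * real j + 1))) * (ennreal (u powr s * exp (- a * u)) * indicator {0..} u)"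
      using a by (cases "0 \<le> u") (simp_all add: ennreal_mult'[symmetric] ennreal_mult''[symmetric])
  qed
  also have "\<dots> = ennreal (a * (2 / (2 * real j + 1))) * ennreal (a powr (- (s + 1)) * Gamma (s + 1))"
    using nn_integral_powr_exp[OF a, of s] s by (subst nn_integral_cmult) simp_all
  also have "\<dots> = ennreal ?R"
  proof -
    have 1: "a * (a powr (- (s + 1)) * x) = a powr (- s) * x" for x
      using a powr_add[of a "- (s + 1)" 1] by (simp add: mult.commute mult.left_commute)
    have "a * (2 / (2 * real j + 1)) * (a powr (- (s + 1)) * Gamma (s + 1))
      = 2 / (2 * real j + 1) * (a * (a powr (- (s + 1)) * Gamma (s + 1)))"
      by simp
    then show ?thesis using a s unfolding 1
      by (subst ennreal_mult[symmetric]) (simp_all add: s_def add.commute[of _ 1] del: of_nat_Suc)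
  qed
  finally show ?thesis .
qed

section \<open>Sums of squares of generalised Gaussians\<close>

definition gen_gauss_const :: "real \<Rightarrow> real" where
  "gen_gauss_const p = 1 / (2 * p powr (1 / p) * Gamma (1 + 1 / p))"

text \<open>
  The generalised Gaussian law with density proportional to \<open>exp (- \<bar>z\<bar>\<^sup>p / p)\<close>. With the
  factor \<open>1 / p\<close> in the exponent, \<open>\<bar>z\<bar>\<^sup>p\<close> has mean one.
\<close>
definition gen_gauss :: "real \<Rightarrow> real measure" where
  "gen_gauss p = density lborel (\<lambda>z. ennreal (gen_gauss_const p * exp (- (1 / p) * \<bar>z\<bar> powr p)))"

definition gen_gauss_pow :: "real \<Rightarrow> nat \<Rightarrow> (nat \<Rightarrow> real) measure" where
  "gen_gauss_pow p n = (\<Pi>\<^sub>M i\<in>{..<n}. gen_gauss p)"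

definition sq_sum :: "nat \<Rightarrow> (nat \<Rightarrow> real) \<Rightarrow> real" where
  "sq_sum n x = (\<Sum>i<n. (x i)\<^sup>2)"

lemma sets_gen_gauss [simp, measurable_cong]: "sets (gen_gauss p) = sets borel"
  by (simp add: gen_gauss_def)

lemma space_gen_gauss [simp]: "space (gen_gauss p) = UNIV"
  by (simp add: gen_gauss_def)

lemma sets_gen_gauss_pow [measurable_cong]: "sets (gen_gauss_pow p n) = sets (\<Pi>\<^sub>M i\<in>{..<n}. borel)"
  unfolding gen_gauss_pow_def by (rule sets_PiM_cong) auto

lemma measurable_sq_sum [measurable]: "sq_sum n \<in> borel_measurable (\<Pi>\<^sub>M i\<in>{..<n}. borel)"
  unfolding sq_sum_def by measurable

lemma gen_gauss_const_pos: "0 < p \<Longrightarrow> 0 < gen_gauss_const p"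
  unfolding gen_gauss_const_def by (simp add: Gamma_real_pos add_pos_pos)

lemma nn_integral_gen_gauss:
  assumes "f \<in> borel_measurable borel" "0 < p"
  shows "(\<integral>\<^sup>+z. f z \<partial>gen_gauss p) = ennreal (gen_gauss_const p) * (\<integral>\<^sup>+z. ennreal (exp (- (1 / p) * \<bar>z\<bar> powr p)) * f z \<partial>lborel)"
proof -
  have "(\<integral>\<^sup>+z. f z \<partial>gen_gauss p) = (\<integral>\<^sup>+z. ennreal (gen_gauss_const p) * (ennreal (exp (- (1 / p) * \<bar>z\<bar> powr p)) * f z) \<partial>lborel)"
    unfolding gen_gauss_def using assms gen_gauss_const_pos[OF assms(2)]
    by (subst nn_integral_density) (simp_all add: ennreal_mult mult.assoc)
  also have "\<dots> = ennreal (gen_gauss_const p) * (\<integral>\<^sup>+z. ennreal (exp (- (1 / p) * \<bar>z\<bar> powr p)) * f z \<partial>lborel)"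
    using assms by (intro nn_integral_cmult) simp
  finally show ?thesis .
qed

text \<open>
  The exponential factor only changes the parameter of the density. Finiteness for
  every \<open>q < 1 / p\<close> is what yields the sharp constant in the upper tail below.
\<close>
lemma nn_integral_gen_gauss_moment:
  assumes p: "0 < p" and q: "q < 1 / p"
  shows "(\<integral>\<^sup>+z. ennreal (z ^ (2 * j) * exp (q * \<bar>z\<bar> powr p)) \<partial>gen_gauss p)
    = ennreal (gen_gauss_const p * (2 / (2 * real j + 1) * (1 / p - q) powr (- ((2 * real j + 1) / p)) * Gamma (1 + (2 * real j + 1) / p)))"
proof -
  have "(\<integral>\<^sup>+z. ennreal (z ^ (2 * j) * exp (q * \<bar>z\<bar> powr p)) \<partial>gen_gauss p)
    = ennreal (gen_gauss_const p) * (\<integral>\<^sup>+z. ennreal (z ^ (2 * j) * exp (- (1 / p - q) * \<bar>z\<bar> powr p)) \<partial>lborel)"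
  proof (subst nn_integral_gen_gauss[OF _ p])
    have "exp (- (1 / p - q) * \<bar>z\<bar> powr p) = exp (- (1 / p) * \<bar>z\<bar> powr p) * exp (q * \<bar>z\<bar> powr p)" for z
      by (simp add: exp_add[symmetric] left_diff_distrib)
    then have "ennreal (exp (- (1 / p) * \<bar>z\<bar> powr p)) * ennreal (z ^ (2 * j) * exp (q * \<bar>z\<bar> powr p))
       = ennreal (z ^ (2 * j) * exp (- (1 / p - q) * \<bar>z\<bar> powr p))" for z
      by (simp only: ennreal_mult'[symmetric] exp_ge_zero mult.left_commute)
    then show "ennreal (gen_gauss_const p) * (\<integral>\<^sup>+z. ennreal (exp (- (1 / p) * \<bar>z\<bar> powr p)) * ennreal (z ^ (2 * j) * exp (q * \<bar>z\<bar> powr p)) \<partial>lborel)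
      = ennreal (gen_gauss_const p) * (\<integral>\<^sup>+z. ennreal (z ^ (2 * j) * exp (- (1 / p - q) * \<bar>z\<bar> powr p)) \<partial>lborel)"
      by simp
  qed simp
  also have "\<dots> = ennreal (gen_gauss_const p) * ennreal (2 / (2 * real j + 1) * (1 / p - q) powr (- ((2 * real j + 1) / p)) * Gamma (1 + (2 * real j + 1) / p))"
    using q p by (subst nn_integral_even_power_exp_powr) simp_all
  also have "\<dots> = ennreal (gen_gauss_const p * (2 / (2 * real j + 1) * (1 / p - q) powr (- ((2 * real j + 1) / p)) * Gamma (1 + (2 * real j + 1) / p)))"
    using gen_gauss_const_pos[OF p] by (intro ennreal_mult'[symmetric]) simp
  finally show ?thesis .
qed

lemma prob_space_gen_gauss:
  assumes p: "0 < p"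
  shows "prob_space (gen_gauss p)"
proof
  have "emeasure (gen_gauss p) (space (gen_gauss p)) = (\<integral>\<^sup>+z. 1 \<partial>gen_gauss p)" by simp
  also have "\<dots> = ennreal (gen_gauss_const p * (2 * (1 / p) powr (- (1 / p)) * Gamma (1 + 1 / p)))"
    using nn_integral_gen_gauss_moment[OF p, of 0 0] p by simp
  also have "gen_gauss_const p * (2 * (1 / p) powr (- (1 / p)) * Gamma (1 + 1 / p)) = 1"
    using p Gamma_real_pos[of "1 + 1 / p"] unfolding gen_gauss_const_def
    by (simp add: powr_minus powr_divide add_pos_pos less_imp_neq[symmetric])
  finally show "emeasure (gen_gauss p) (space (gen_gauss p)) = 1" by simp
qed

text \<open>
  The constant \<open>m\<close> is the second moment of the generalised Gaussian.
\<close>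
lemma nn_integral_gen_gauss_square:
  assumes p: "0 < p"
  shows "(\<integral>\<^sup>+z. ennreal (z\<^sup>2) \<partial>gen_gauss p) = ennreal (m_const p)"
proof -
  have "(\<integral>\<^sup>+z. ennreal (z\<^sup>2) \<partial>gen_gauss p) = ennreal (gen_gauss_const p * (2 / 3 * (1 / p) powr (- (3 / p)) * Gamma (1 + 3 / p)))"
    using nn_integral_gen_gauss_moment[OF p, of 0 1] p by simp
  also have "gen_gauss_const p * (2 / 3 * (1 / p) powr (- (3 / p)) * Gamma (1 + 3 / p)) = m_const p"
  proof -
    have "p powr (3 / p) = p powr (1 / p) * p powr (2 / p)" using p by (simp add: powr_add[symmetric] add_divide_distrib[symmetric])
    then show ?thesis
      using p Gamma_real_pos[of "1 + 1 / p"] unfolding gen_gauss_const_def m_const_def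
      by (simp add: powr_minus powr_divide add_pos_pos less_imp_neq[symmetric] field_simps)
  qed
  finally show ?thesis .
qed

lemma m_const_pos: "0 < p \<Longrightarrow> 0 < m_const p"
  unfolding m_const_def by (simp add: Gamma_real_pos add_pos_pos)

lemma prob_space_gen_gauss_pow: "0 < p \<Longrightarrow> prob_space (gen_gauss_pow p n)"
  unfolding gen_gauss_pow_def by (intro prob_space_PiM prob_space_gen_gauss)

lemma nn_integral_gen_gauss_pow_prod:
  assumes "0 < p" "f \<in> borel_measurable borel"
  shows "(\<integral>\<^sup>+x. (\<Prod>i<n. f (x i)) \<partial>gen_gauss_pow p n) = (\<integral>\<^sup>+z. f z \<partial>gen_gauss p) ^ n"
proof -
  interpret prob_space "gen_gauss p" by (rule prob_space_gen_gauss) fact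
  interpret product_sigma_finite "\<lambda>_::nat. gen_gauss p" ..
  show ?thesis unfolding gen_gauss_pow_def
    using assms by (subst product_nn_integral_prod) simp_all
qed

text \<open>
  Squares are bounded below, so the left tail has a genuine exponential moment and Chernoff's
  method gives a bound that is exponential in \<open>n\<close>.
\<close>
lemma gen_gauss_pow_square_sum_lower_tail:
  assumes p: "0 < p" "p < 2" and t: "t < m_const p"
  shows "exp_small (p / 2) (\<lambda>n. measure (gen_gauss_pow p n) {x \<in> space (gen_gauss_pow p n). sq_sum n x \<le> real n * t})"
proof -
  interpret G: prob_space "gen_gauss p" by (rule prob_space_gen_gauss) fact
  let ?m = "m_const p"
  define C where "C = gen_gauss_const p * (2 / (2 * real 2 + 1) * (1 / p - 0) powr (- ((2 * real 2 + 1) / p)) * Gamma (1 + (2 * real 2 + 1) / p))"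
  have C: "(\<integral>\<^sup>+z. ennreal (z ^ 4) \<partial>gen_gauss p) = ennreal C"
    using nn_integral_gen_gauss_moment[OF p(1), of 0 2] p unfolding C_def by simp
  have C0: "0 < C" unfolding C_def
    using p gen_gauss_const_pos[OF p(1)] by (intro mult_pos_pos Gamma_real_pos) (auto intro: add_pos_pos)
  define s where "s = (?m - t) / (2 * C)"
  have s: "0 < s" using C0 t by (simp add: s_def)
  obtain e where e: "(\<integral>\<^sup>+z. ennreal (exp (- s * z\<^sup>2)) \<partial>gen_gauss p) = ennreal e" "0 \<le> e"
  proof -
    have "(\<integral>\<^sup>+z. ennreal (exp (- s * z\<^sup>2)) \<partial>gen_gauss p) \<le> (\<integral>\<^sup>+z. 1 \<partial>gen_gauss p)"
      using s by (intro nn_integral_mono) simp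
    also have "\<dots> = 1" by (simp add: G.emeasure_space_1[simplified])
    finally have "(\<integral>\<^sup>+z. ennreal (exp (- s * z\<^sup>2)) \<partial>gen_gauss p) \<noteq> top" by (auto simp: top_unique)
    then show ?thesis using that by (metis ennreal_cases)
  qed
  \<comment> \<open>The quadratic bound on the exponential gives \<open>E exp (- s Z\<^sup>2) \<le> 1 - s m + s\<^sup>2 E Z\<^sup>4\<close>.\<close>
  have "ennreal (e + s * ?m) = (\<integral>\<^sup>+z. ennreal (exp (- s * z\<^sup>2)) + ennreal s * ennreal (z\<^sup>2) \<partial>gen_gauss p)"
    using s e m_const_pos[OF p(1)]
    by (subst nn_integral_add) (simp_all add: nn_integral_cmult nn_integral_gen_gauss_square[OF p(1)] ennreal_mult)
  also have "\<dots> \<le> (\<integral>\<^sup>+z. 1 + ennreal (s\<^sup>2) * ennreal (z ^ 4) \<partial>gen_gauss p)"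
  proof (rule nn_integral_mono)
    fix z :: real
    have "exp (- s * z\<^sup>2) + s * z\<^sup>2 \<le> 1 + s\<^sup>2 * z ^ 4"
      using exp_minus_le_quadratic[of "s * z\<^sup>2"] s by (simp add: power_mult_distrib power_mult[symmetric])
    then have "ennreal (exp (- s * z\<^sup>2) + s * z\<^sup>2) \<le> ennreal (1 + s\<^sup>2 * z ^ 4)" by (rule ennreal_leI)
    then show "ennreal (exp (- s * z\<^sup>2)) + ennreal s * ennreal (z\<^sup>2) \<le> 1 + ennreal (s\<^sup>2) * ennreal (z ^ 4)"
      using s by (simp add: ennreal_plus ennreal_mult)
  qed
  also have "\<dots> = ennreal (1 + s\<^sup>2 * C)"
    using C0 by (subst nn_integral_add) (simp_all add: nn_integral_cmult C G.emeasure_space_1[simplified] ennreal_mult)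
  finally have "e + s * ?m \<le> 1 + s\<^sup>2 * C" using C0 by (subst (asm) ennreal_le_iff) auto
  moreover have "1 + (- s * ?m + s\<^sup>2 * C) \<le> exp (- s * ?m + s\<^sup>2 * C)" by (rule exp_ge_add_one_self)
  ultimately have e_le: "e \<le> exp (- s * ?m + s\<^sup>2 * C)" by linarith
  define c where "c = (?m - t)\<^sup>2 / (4 * C)"
  have c: "0 < c" using t C0 by (simp add: c_def)
  have c_eq: "s * t + (- s * ?m + s\<^sup>2 * C) = - c"
    using C0 unfolding s_def c_def by (simp add: divide_simps power2_eq_square) (simp add: algebra_simps)
  have bound: "measure (gen_gauss_pow p n) {x \<in> space (gen_gauss_pow p n). sq_sum n x \<le> real n * t} \<le> 1 * exp (- c * real n)" for n
  proof -
    interpret P: prob_space "gen_gauss_pow p n" by (rule prob_space_gen_gauss_pow) fact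
    let ?A = "{x \<in> space (gen_gauss_pow p n). sq_sum n x \<le> real n * t}"
    have "emeasure (gen_gauss_pow p n) ?A \<le> ennreal (exp (- (- s * (real n * t)))) * (\<integral>\<^sup>+x. (\<Prod>i<n. ennreal (exp (- s * (x i)\<^sup>2))) \<partial>gen_gauss_pow p n)"
    proof (rule emeasure_le_exp_nn_integral)
      fix x assume "x \<in> ?A"
      then have "s * sq_sum n x \<le> s * (real n * t)" using s by (intro mult_left_mono) auto
      then show "ennreal (exp (- s * (real n * t))) \<le> (\<Prod>i<n. ennreal (exp (- s * (x i)\<^sup>2)))"
        by (simp add: prod_ennreal exp_sum[symmetric] sum_negf sum_distrib_left[symmetric] sq_sum_def)
    qed measurable
    also have "\<dots> = ennreal (exp (s * (real n * t)) * e ^ n)"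
      using nn_integral_gen_gauss_pow_prod[OF p(1), of "\<lambda>z. ennreal (exp (- s * z\<^sup>2))" n] e by (simp add: ennreal_mult ennreal_power)
    also have "\<dots> \<le> ennreal (exp (s * (real n * t)) * exp (- s * ?m + s\<^sup>2 * C) ^ n)"
      using e e_le by (intro ennreal_leI mult_left_mono power_mono) auto
    also have "exp (s * (real n * t)) * exp (- s * ?m + s\<^sup>2 * C) ^ n = exp (real n * (s * t + (- s * ?m + s\<^sup>2 * C)))"
      by (simp add: exp_of_nat_mult[symmetric] exp_add[symmetric] algebra_simps)
    also have "\<dots> = 1 * exp (- c * real n)" unfolding c_eq by (simp add: mult.commute)
    finally show ?thesis unfolding P.emeasure_eq_measure by simp
  qed
  show ?thesis
    by (rule exp_small_mono[OF exp_small_linear[OF c, of "p/2" 1]]) (use p bound in auto)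
qed

text \<open>
  The single big jump: \<open>Z\<^sup>2 > r\<close> means \<open>\<bar>Z\<bar>\<^sup>p > r powr (p / 2)\<close>, an exponential tail.
\<close>
lemma gen_gauss_pow_component_tail:
  assumes p: "0 < p" and q: "0 \<le> q" "q < 1 / p" and i: "i < n" and r: "0 \<le> r"
    and C: "(\<integral>\<^sup>+z. ennreal (exp (q * \<bar>z\<bar> powr p)) \<partial>gen_gauss p) = ennreal C" "0 \<le> C"
  shows "measure (gen_gauss_pow p n) {x \<in> space (gen_gauss_pow p n). r < (x i)\<^sup>2} \<le> C * exp (- q * r powr (p / 2))"
proof -
  interpret G: prob_space "gen_gauss p" by (rule prob_space_gen_gauss) fact
  interpret P: product_prob_space "\<lambda>_. gen_gauss p" "{..<n}" ..
  interpret PP: prob_space "gen_gauss_pow p n" by (rule prob_space_gen_gauss_pow) fact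
  have "distr (gen_gauss_pow p n) (gen_gauss p) (\<lambda>x. x i) = gen_gauss p"
    unfolding gen_gauss_pow_def using i by (intro P.PiM_component) simp
  then have "emeasure (gen_gauss p) {z. r < z\<^sup>2} = emeasure (distr (gen_gauss_pow p n) (gen_gauss p) (\<lambda>x. x i)) {z. r < z\<^sup>2}"
    by simp
  also have "\<dots> = emeasure (gen_gauss_pow p n) ((\<lambda>x. x i) -` {z. r < z\<^sup>2} \<inter> space (gen_gauss_pow p n))"
    using i by (intro emeasure_distr) (auto simp: gen_gauss_pow_def)
  also have "(\<lambda>x. x i) -` {z. r < z\<^sup>2} \<inter> space (gen_gauss_pow p n) = {x \<in> space (gen_gauss_pow p n). r < (x i)\<^sup>2}"
    by auto
  finally have "emeasure (gen_gauss_pow p n) {x \<in> space (gen_gauss_pow p n). r < (x i)\<^sup>2} = emeasure (gen_gauss p) {z. r < z\<^sup>2}" by simp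
  also have "\<dots> \<le> ennreal (exp (- (q * r powr (p / 2)))) * (\<integral>\<^sup>+z. ennreal (exp (q * \<bar>z\<bar> powr p)) \<partial>gen_gauss p)"
  proof (rule emeasure_le_exp_nn_integral)
    fix z :: real assume "z \<in> {z. r < z\<^sup>2}"
    then have "r powr (p / 2) \<le> (z\<^sup>2) powr (p / 2)" using r p by (intro powr_mono2) auto
    then have "q * r powr (p / 2) \<le> q * \<bar>z\<bar> powr p" unfolding power2_powr_half using q by (intro mult_left_mono)
    then show "ennreal (exp (q * r powr (p / 2))) \<le> ennreal (exp (q * \<bar>z\<bar> powr p))" by (intro ennreal_leI) simp
  qed auto
  also have "\<dots> = ennreal (C * exp (- q * r powr (p / 2)))"
    using C by (simp add: ennreal_mult[symmetric] mult.commute)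
  finally show ?thesis using C by (simp add: PP.emeasure_eq_measure)
qed

text \<open>
  \<open>Z\<^sup>2\<close> has no exponential moments, but on the truncation event the linear function
  \<open>\<theta> z\<^sup>2\<close> stays below the integrable exponent \<open>q \<bar>z\<bar>\<^sup>p\<close>, because a concave power lies
  above its chord. Hence \<open>E exp (\<theta> Z\<^sup>2)\<close>, restricted to that event, is at most
  \<open>1 + \<theta> m + C \<theta>\<^sup>2\<close>, and the first two terms are the ones that matter as \<open>\<theta>\<close> tends to zero.
\<close>
lemma gen_gauss_pow_truncated_square_sum_tail:
  assumes p: "0 < p" "p < 2" and q: "0 < q" "q < 1 / p" and u: "0 < u" and n: "0 < n"
    and C: "(\<integral>\<^sup>+z. ennreal (z ^ 4 * exp (q * \<bar>z\<bar> powr p)) \<partial>gen_gauss p) = ennreal C" "0 \<le> C"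
  shows "measure (gen_gauss_pow p n) {x \<in> space (gen_gauss_pow p n). real n * (m_const p + u) \<le> sq_sum n x \<and> (\<forall>i<n. (x i)\<^sup>2 \<le> real n * u)}
    \<le> exp (- q * (real n * u) powr (p / 2) + real n * C * (q * (real n * u) powr (p / 2 - 1))\<^sup>2)"
proof -
  interpret G: prob_space "gen_gauss p" by (rule prob_space_gen_gauss) fact
  interpret P: prob_space "gen_gauss_pow p n" by (rule prob_space_gen_gauss_pow) fact
  let ?m = "m_const p"
  have m: "0 < ?m" by (rule m_const_pos) fact
  define b where "b = real n * u"
  have b: "0 < b" using n u by (simp add: b_def)
  \<comment> \<open>The slope of the chord of \<open>q * r powr (p / 2)\<close> on \<open>{0..b}\<close>.\<close>
  define \<theta> where "\<theta> = q * b powr (p / 2 - 1)"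
  have \<theta>: "0 < \<theta>" using q b by (simp add: \<theta>_def)
  have \<theta>b: "\<theta> * b = q * b powr (p / 2)" using b by (simp add: \<theta>_def powr_diff)
  \<comment> \<open>On the truncation event the exponent is at most \<open>q * \<bar>z\<bar> powr p\<close>, whose exponential is integrable.\<close>
  have exponent: "\<theta> * z\<^sup>2 \<le> q * \<bar>z\<bar> powr p" if "z\<^sup>2 \<le> b" for z :: real
  proof (cases "z = 0")
    case False
    then have z2: "0 < z\<^sup>2" by simp
    have "b powr (p / 2 - 1) \<le> (z\<^sup>2) powr (p / 2 - 1)"
      using that z2 p by (intro powr_mono2') auto
    then have "b powr (p / 2 - 1) * z\<^sup>2 \<le> (z\<^sup>2) powr (p / 2 - 1) * z\<^sup>2"
      using z2 by (intro mult_right_mono) auto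
    also have "\<dots> = \<bar>z\<bar> powr p" unfolding power2_powr_half[symmetric] using z2 by (simp add: powr_diff)
    finally show ?thesis using q by (simp add: \<theta>_def mult.assoc)
  qed simp
  define h where "h z = ennreal (exp (\<theta> * z\<^sup>2)) * indicator {z. z\<^sup>2 \<le> b} z" for z :: real
  have [measurable]: "h \<in> borel_measurable borel" unfolding h_def by measurable
  have "(\<integral>\<^sup>+z. h z \<partial>gen_gauss p) \<le> (\<integral>\<^sup>+z. (1 + ennreal \<theta> * ennreal (z\<^sup>2)) + ennreal (\<theta>\<^sup>2) * ennreal (z ^ 4 * exp (q * \<bar>z\<bar> powr p)) \<partial>gen_gauss p)"
  proof (rule nn_integral_mono)
    fix z :: real
    show "h z \<le> (1 + ennreal \<theta> * ennreal (z\<^sup>2)) + ennreal (\<theta>\<^sup>2) * ennreal (z ^ 4 * exp (q * \<bar>z\<bar> powr p))"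
    proof (cases "z\<^sup>2 \<le> b")
      case True
      have "exp (\<theta> * z\<^sup>2) \<le> 1 + \<theta> * z\<^sup>2 + (\<theta> * z\<^sup>2)\<^sup>2 * exp (\<theta> * z\<^sup>2)"
        using \<theta> by (intro exp_le_quadratic) simp
      also have "\<dots> \<le> 1 + \<theta> * z\<^sup>2 + (\<theta> * z\<^sup>2)\<^sup>2 * exp (q * \<bar>z\<bar> powr p)"
        using exponent[OF True] by (intro add_left_mono mult_left_mono) auto
      also have "\<dots> = 1 + \<theta> * z\<^sup>2 + \<theta>\<^sup>2 * (z ^ 4 * exp (q * \<bar>z\<bar> powr p))"
        by (simp add: power_mult_distrib power_mult[symmetric] mult.assoc)
      finally have "ennreal (exp (\<theta> * z\<^sup>2)) \<le> ennreal (1 + \<theta> * z\<^sup>2 + \<theta>\<^sup>2 * (z ^ 4 * exp (q * \<bar>z\<bar> powr p)))"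
        by (rule ennreal_leI)
      then show ?thesis using \<theta> True by (simp add: h_def ennreal_plus ennreal_mult)
    qed (simp add: h_def)
  qed
  also have "\<dots> = ennreal (1 + \<theta> * ?m + \<theta>\<^sup>2 * C)"
    using \<theta> C m by (simp add: nn_integral_add nn_integral_cmult nn_integral_gen_gauss_square[OF p(1)] G.emeasure_space_1[simplified] ennreal_mult ennreal_plus)
  also have "\<dots> \<le> ennreal (exp (\<theta> * ?m + \<theta>\<^sup>2 * C))"
    using exp_ge_add_one_self[of "\<theta> * ?m + \<theta>\<^sup>2 * C"] by (intro ennreal_leI) (simp only: add.assoc)
  finally have h_le: "(\<integral>\<^sup>+z. h z \<partial>gen_gauss p) \<le> ennreal (exp (\<theta> * ?m + \<theta>\<^sup>2 * C))" .
  let ?A = "{x \<in> space (gen_gauss_pow p n). real n * (?m + u) \<le> sq_sum n x \<and> (\<forall>i<n. (x i)\<^sup>2 \<le> b)}"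
  have "emeasure (gen_gauss_pow p n) ?A \<le> ennreal (exp (- (\<theta> * (real n * (?m + u))))) * (\<integral>\<^sup>+x. (\<Prod>i<n. h (x i)) \<partial>gen_gauss_pow p n)"
  proof (rule emeasure_le_exp_nn_integral)
    fix x assume x: "x \<in> ?A"
    then have "\<theta> * (real n * (?m + u)) \<le> \<theta> * sq_sum n x" using \<theta> by (intro mult_left_mono) auto
    moreover have "(\<Prod>i<n. h (x i)) = (\<Prod>i<n. ennreal (exp (\<theta> * (x i)\<^sup>2)))"
      using x by (intro prod.cong) (auto simp: h_def)
    ultimately show "ennreal (exp (\<theta> * (real n * (?m + u)))) \<le> (\<Prod>i<n. h (x i))"
      by (simp add: prod_ennreal exp_sum[symmetric] sum_distrib_left[symmetric] sq_sum_def)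
  qed measurable
  also have "\<dots> \<le> ennreal (exp (- (\<theta> * (real n * (?m + u))))) * ennreal (exp (\<theta> * ?m + \<theta>\<^sup>2 * C)) ^ n"
    unfolding nn_integral_gen_gauss_pow_prod[OF p(1) \<open>h \<in> borel_measurable borel\<close>]
    using h_le by (intro mult_left_mono power_mono) auto
  also have "\<dots> = ennreal (exp (- (\<theta> * (real n * (?m + u))) + real n * (\<theta> * ?m + \<theta>\<^sup>2 * C)))"
    by (simp only: ennreal_power exp_ge_zero ennreal_mult'[symmetric] exp_of_nat_mult[symmetric] exp_add[symmetric])
  also have "- (\<theta> * (real n * (?m + u))) + real n * (\<theta> * ?m + \<theta>\<^sup>2 * C) = - (\<theta> * b) + real n * C * \<theta>\<^sup>2"
    by (simp add: b_def algebra_simps)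
  finally show ?thesis unfolding \<theta>b unfolding P.emeasure_eq_measure b_def[symmetric] \<theta>_def[symmetric] by simp
qed

text \<open>
  Either some square exceeds \<open>n (t - m)\<close>, or all are below this level and the truncated
  Chernoff bound applies. Both cases have the same exponential cost, and \<open>\<kappa>\<close> may be taken
  arbitrarily close to \<open>1 / p\<close>.
\<close>
lemma gen_gauss_pow_square_sum_upper_tail:
  assumes p: "0 < p" "p < 2" and t: "m_const p < t" and q: "q < (1 / p) * (t - m_const p) powr (p / 2)"
  shows "\<forall>\<^sub>F n in sequentially. measure (gen_gauss_pow p n) {x \<in> space (gen_gauss_pow p n). real n * t \<le> sq_sum n x}
    \<le> exp (- q * real n powr (p / 2))"
proof -
  define u where "u = t - m_const p"
  have u: "0 < u" and t_eq: "t = m_const p + u" using t by (auto simp: u_def)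
  define U where "U = u powr (p / 2)"
  have U: "0 < U" using u by (simp add: U_def)
  have "max 0 (q / U) < 1 / p" using q U p by (simp add: U_def u_def field_simps)
  then obtain \<kappa> where \<kappa>: "max 0 (q / U) < \<kappa>" "\<kappa> < 1 / p" using dense by blast
  have \<kappa>0: "0 < \<kappa>" and q\<kappa>: "q < \<kappa> * U" using \<kappa>(1) U by (auto simp: field_simps)
  define C\<^sub>0 where "C\<^sub>0 = gen_gauss_const p * (2 / (2 * real 0 + 1) * (1 / p - \<kappa>) powr (- ((2 * real 0 + 1) / p)) * Gamma (1 + (2 * real 0 + 1) / p))"
  define C\<^sub>4 where "C\<^sub>4 = gen_gauss_const p * (2 / (2 * real 2 + 1) * (1 / p - \<kappa>) powr (- ((2 * real 2 + 1) / p)) * Gamma (1 + (2 * real 2 + 1) / p))"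
  have C\<^sub>0: "(\<integral>\<^sup>+z. ennreal (exp (\<kappa> * \<bar>z\<bar> powr p)) \<partial>gen_gauss p) = ennreal C\<^sub>0"
    using nn_integral_gen_gauss_moment[OF p(1) \<kappa>(2), of 0] unfolding C\<^sub>0_def by simp
  have C\<^sub>4: "(\<integral>\<^sup>+z. ennreal (z ^ 4 * exp (\<kappa> * \<bar>z\<bar> powr p)) \<partial>gen_gauss p) = ennreal C\<^sub>4"
    using nn_integral_gen_gauss_moment[OF p(1) \<kappa>(2), of 2] unfolding C\<^sub>4_def by simp
  have pos: "0 \<le> C\<^sub>0" "0 \<le> C\<^sub>4" unfolding C\<^sub>0_def C\<^sub>4_def
    using p gen_gauss_const_pos[OF p(1)] by (auto intro!: mult_nonneg_nonneg less_imp_le[OF Gamma_real_pos] simp: add_pos_pos)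
  define D where "D = C\<^sub>4 * (\<kappa> * u powr (p / 2 - 1))\<^sup>2"
  have bound: "measure (gen_gauss_pow p n) {x \<in> space (gen_gauss_pow p n). real n * t \<le> sq_sum n x}
     \<le> real n * C\<^sub>0 * exp (- (\<kappa> * U) * real n powr (p / 2))
      + exp (- (\<kappa> * U - D * real n powr (p / 2 - 1)) * real n powr (p / 2))" if n: "0 < n" for n
  proof -
    interpret P: prob_space "gen_gauss_pow p n" by (rule prob_space_gen_gauss_pow) fact
    let ?A = "\<lambda>i. {x \<in> space (gen_gauss_pow p n). real n * u < (x i)\<^sup>2}"
    let ?B = "{x \<in> space (gen_gauss_pow p n). real n * (m_const p + u) \<le> sq_sum n x \<and> (\<forall>i<n. (x i)\<^sup>2 \<le> real n * u)}"
    have [measurable]: "?A i \<in> sets (gen_gauss_pow p n)" if "i < n" for i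
    proof -
      have [measurable]: "(\<lambda>x. x i) \<in> borel_measurable (gen_gauss_pow p n)"
        unfolding measurable_cong_sets[OF sets_gen_gauss_pow refl] using that by (intro measurable_component_singleton) simp
      show ?thesis by measurable
    qed
    have B[measurable]: "?B \<in> sets (gen_gauss_pow p n)" by measurable
    have scale: "(real n * u) powr a = real n powr a * u powr a" for a using n u by (simp add: powr_mult)
    have "measure (gen_gauss_pow p n) {x \<in> space (gen_gauss_pow p n). real n * t \<le> sq_sum n x} \<le> measure (gen_gauss_pow p n) ((\<Union>i<n. ?A i) \<union> ?B)"
      by (intro P.finite_measure_mono) (auto simp: t_eq not_le)
    also have "\<dots> \<le> measure (gen_gauss_pow p n) (\<Union>i<n. ?A i) + measure (gen_gauss_pow p n) ?B"
      by (intro measure_Un_le) auto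
    also have "measure (gen_gauss_pow p n) (\<Union>i<n. ?A i) \<le> (\<Sum>i<n. measure (gen_gauss_pow p n) (?A i))"
      by (intro P.finite_measure_subadditive_finite) auto
    also have "\<dots> \<le> (\<Sum>i<n. C\<^sub>0 * exp (- \<kappa> * (real n * u) powr (p / 2)))"
      by (intro sum_mono gen_gauss_pow_component_tail[OF p(1) _ \<kappa>(2) _ _ C\<^sub>0 pos(1)]) (use u \<kappa>0 in \<open>simp_all add: less_imp_le\<close>)
    also have "\<dots> = real n * C\<^sub>0 * exp (- (\<kappa> * U) * real n powr (p / 2))"
      unfolding scale U_def by simp
    also have "measure (gen_gauss_pow p n) ?B \<le> exp (- \<kappa> * (real n * u) powr (p / 2) + real n * C\<^sub>4 * (\<kappa> * (real n * u) powr (p / 2 - 1))\<^sup>2)"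
      by (rule gen_gauss_pow_truncated_square_sum_tail[OF p \<kappa>0 \<kappa>(2) u n C\<^sub>4 pos(2)])
    also have "- \<kappa> * (real n * u) powr (p / 2) + real n * C\<^sub>4 * (\<kappa> * (real n * u) powr (p / 2 - 1))\<^sup>2
      = - (\<kappa> * U - D * real n powr (p / 2 - 1)) * real n powr (p / 2)"
    proof -
      have "real n * real n powr (p / 2 - 1) = real n powr (p / 2)" using n by (simp add: powr_diff)
      then show ?thesis unfolding scale U_def D_def
        by (simp add: power2_eq_square algebra_simps) 
    qed
    finally show ?thesis by simp
  qed
  have "(\<lambda>n. real n powr (p / 2 - 1)) \<longlonglongrightarrow> 0"
    using p by (intro tendsto_neg_powr filterlim_real_sequentially) auto
  then have "(\<lambda>n. \<kappa> * U - D * real n powr (p / 2 - 1)) \<longlonglongrightarrow> \<kappa> * U - D * 0"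
    by (intro tendsto_intros)
  then have lim: "(\<lambda>n. \<kappa> * U - D * real n powr (p / 2 - 1)) \<longlonglongrightarrow> \<kappa> * U" by simp
  have "\<forall>\<^sub>F n in sequentially. real n * C\<^sub>0 * exp (- (\<kappa> * U) * real n powr (p / 2))
      + exp (- (\<kappa> * U - D * real n powr (p / 2 - 1)) * real n powr (p / 2)) \<le> exp (- q * real n powr (p / 2))"
  proof (rule eventually_add_le_exp[where Q="\<kappa> * U"])
    fix q' assume q': "q' < \<kappa> * U"
    show "\<forall>\<^sub>F n in sequentially. real n * C\<^sub>0 * exp (- (\<kappa> * U) * real n powr (p / 2)) \<le> exp (- q' * real n powr (p / 2))"
      using p q' by (intro eventually_poly_exp_le) auto
    have "\<forall>\<^sub>F n in sequentially. q' < \<kappa> * U - D * real n powr (p / 2 - 1)"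
      using lim q' by (rule order_tendstoD(1))
    then show "\<forall>\<^sub>F n in sequentially. exp (- (\<kappa> * U - D * real n powr (p / 2 - 1)) * real n powr (p / 2)) \<le> exp (- q' * real n powr (p / 2))"
      by eventually_elim (simp only: exp_le_cancel_iff mult_minus_left neg_le_iff_le, intro mult_right_mono, auto)
  qed (use q\<kappa> p in auto)
  then show ?thesis
    using eventually_gt_at_top[of 0] by eventually_elim (use bound in \<open>blast intro: order_trans\<close>)
qed

text \<open>
  Independence of the last coordinate, in the form used to let it carry the excess.
\<close>
lemma gen_gauss_pow_Suc_square_sum_ge:
  assumes p: "0 < p" and J: "J \<in> sets borel" and A: "A \<in> sets borel" and S: "S \<in> sets borel"
    and sub: "\<And>s z. s \<in> A \<Longrightarrow> z \<in> J \<Longrightarrow> s + z\<^sup>2 \<in> S"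
  shows "measure (gen_gauss p) J * measure (gen_gauss_pow p n) {x \<in> space (gen_gauss_pow p n). sq_sum n x \<in> A}
    \<le> measure (gen_gauss_pow p (Suc n)) {x \<in> space (gen_gauss_pow p (Suc n)). sq_sum (Suc n) x \<in> S}"
proof -
  interpret G: prob_space "gen_gauss p" by (rule prob_space_gen_gauss) fact
  interpret P: product_sigma_finite "\<lambda>_::nat. gen_gauss p" ..
  interpret P1: prob_space "gen_gauss_pow p n" by (rule prob_space_gen_gauss_pow) fact
  interpret P2: prob_space "gen_gauss_pow p (Suc n)" by (rule prob_space_gen_gauss_pow) fact
  note [measurable] = J A S
  let ?A = "{x \<in> space (gen_gauss_pow p n). sq_sum n x \<in> A}"
  let ?S = "{x \<in> space (gen_gauss_pow p (Suc n)). sq_sum (Suc n) x \<in> S}"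
  have [measurable]: "?A \<in> sets (gen_gauss_pow p n)" "?S \<in> sets (gen_gauss_pow p (Suc n))"
    by measurable
  have "ennreal (measure (gen_gauss p) J * measure (gen_gauss_pow p n) ?A) = emeasure (gen_gauss p) J * emeasure (gen_gauss_pow p n) ?A"
    by (simp add: G.emeasure_eq_measure P1.emeasure_eq_measure ennreal_mult)
  also have "\<dots> = (\<integral>\<^sup>+x. (\<integral>\<^sup>+z. indicator ?A x * indicator J z \<partial>gen_gauss p) \<partial>gen_gauss_pow p n)"
    by (simp add: nn_integral_cmult mult.commute nn_integral_multc)
  also have "\<dots> \<le> (\<integral>\<^sup>+x. (\<integral>\<^sup>+z. indicator ?S (x(n := z)) \<partial>gen_gauss p) \<partial>gen_gauss_pow p n)"
  proof (intro nn_integral_mono)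
    fix x z assume x: "x \<in> space (gen_gauss_pow p n)"
    have "sq_sum (Suc n) (x(n := z)) = sq_sum n x + z\<^sup>2" by (simp add: sq_sum_def)
    moreover have "x(n := z) \<in> space (gen_gauss_pow p (Suc n))"
      using x by (auto simp: gen_gauss_pow_def space_PiM PiE_iff extensional_def)
    ultimately show "indicator ?A x * indicator J z \<le> (indicator ?S (x(n := z)) :: ennreal)"
      using sub by (auto split: split_indicator)
  qed
  also have "\<dots> = (\<integral>\<^sup>+x. indicator ?S x \<partial>Pi\<^sub>M (insert n {..<n}) (\<lambda>_. gen_gauss p))"
  proof (subst P.product_nn_integral_insert)
    have "indicator ?S \<in> borel_measurable (gen_gauss_pow p (Suc n))" by measurable
    then show "indicator ?S \<in> borel_measurable (Pi\<^sub>M (insert n {..<n}) (\<lambda>_. gen_gauss p))"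
      by (simp add: gen_gauss_pow_def lessThan_Suc)
  qed (auto simp: gen_gauss_pow_def)
  also have "\<dots> = emeasure (gen_gauss_pow p (Suc n)) ?S"
    unfolding lessThan_Suc[symmetric] gen_gauss_pow_def[symmetric] by (rule nn_integral_indicator) measurable
  finally show ?thesis by (simp add: P2.emeasure_eq_measure)
qed

lemma gen_gauss_square_interval_ge:
  assumes p: "0 < p" and "0 \<le> a" "a < b"
  shows "gen_gauss_const p * (sqrt b - sqrt a) * exp (- (1 / p) * b powr (p / 2)) \<le> measure (gen_gauss p) {sqrt a .. sqrt b}"
proof -
  interpret G: prob_space "gen_gauss p" by (rule prob_space_gen_gauss) fact
  have ab: "0 \<le> sqrt b - sqrt a" using assms by simp
  have "ennreal (gen_gauss_const p * (sqrt b - sqrt a) * exp (- (1 / p) * b powr (p / 2)))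
    = (\<integral>\<^sup>+z. ennreal (gen_gauss_const p * exp (- (1 / p) * b powr (p / 2))) * indicator {sqrt a..sqrt b} z \<partial>lborel)"
    using ab gen_gauss_const_pos[OF p] assms
    by (subst nn_integral_cmult_indicator) (auto simp: ennreal_mult'[symmetric] mult_ac)
  also have "\<dots> \<le> (\<integral>\<^sup>+z. ennreal (gen_gauss_const p * exp (- (1 / p) * \<bar>z\<bar> powr p)) * indicator {sqrt a..sqrt b} z \<partial>lborel)"
  proof (intro nn_integral_mono)
    fix z :: real
    have "exp (- (1 / p) * b powr (p / 2)) \<le> exp (- (1 / p) * \<bar>z\<bar> powr p)" if "z \<in> {sqrt a..sqrt b}"
    proof -
      have "0 \<le> z" using that assms by (metis atLeastAtMost_iff order_trans real_sqrt_ge_zero)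
      then have "\<bar>z\<bar> powr p \<le> \<bar>sqrt b\<bar> powr p" using that p assms by (intro powr_mono2) auto
      also have "\<dots> = b powr (p / 2)" using assms unfolding power2_powr_half[symmetric] by simp
      finally show ?thesis using p by (simp add: divide_right_mono)
    qed
    then show "ennreal (gen_gauss_const p * exp (- (1 / p) * b powr (p / 2))) * indicator {sqrt a..sqrt b} z
      \<le> ennreal (gen_gauss_const p * exp (- (1 / p) * \<bar>z\<bar> powr p)) * indicator {sqrt a..sqrt b} z"
      using gen_gauss_const_pos[OF p] by (auto split: split_indicator intro!: ennreal_leI)
  qed
  also have "\<dots> = emeasure (gen_gauss p) {sqrt a .. sqrt b}"
    unfolding gen_gauss_def by (subst emeasure_density) auto
  finally show ?thesis by (simp add: G.emeasure_eq_measure)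
qed

text \<open>
  One coordinate carries the excess \<open>n (y - m)\<close>, up to \<open>n \<delta>\<close>, while the
  others behave typically. The weak law of large numbers for the latter follows from the two tail
  bounds.
\<close>
lemma gen_gauss_pow_square_sum_local_lower_bound:
  assumes p: "0 < p" "p < 2" and y: "a < y" "y < b" "m_const p < y"
    and q: "(1 / p) * (y - m_const p) powr (p / 2) < q"
  shows "\<forall>\<^sub>F n in sequentially. exp (- q * real n powr (p / 2))
    \<le> measure (gen_gauss_pow p n) {x \<in> space (gen_gauss_pow p n). sq_sum n x \<in> {real n * a<..<real n * b}}"
proof -
  define m where "m = m_const p"
  define v where "v = y - m"
  have v: "0 < v" using y by (simp add: v_def m_def)
  have "((\<lambda>\<delta>. (1 / p) * (v + \<delta>) powr (p / 2)) \<longlongrightarrow> (1 / p) * (v + 0) powr (p / 2)) (at_right 0)"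
    using v by (intro tendsto_intros) auto
  then have "\<forall>\<^sub>F \<delta> in at_right 0. (1 / p) * (v + \<delta>) powr (p / 2) < q"
    using q by (intro order_tendstoD(2)) (auto simp: v_def m_def)
  then obtain \<epsilon> where \<epsilon>: "0 < \<epsilon>" "\<And>\<delta>. 0 < \<delta> \<Longrightarrow> \<delta> < \<epsilon> \<Longrightarrow> (1 / p) * (v + \<delta>) powr (p / 2) < q"
    unfolding eventually_at_right_field by auto
  define \<delta> where "\<delta> = min (\<epsilon> / 2) (min ((y - a) / 4) ((b - y) / 4))"
  have \<delta>: "0 < \<delta>" "\<delta> \<le> (y - a) / 4" "\<delta> \<le> (b - y) / 4" "(1 / p) * (v + \<delta>) powr (p / 2) < q"
  proof -
    have le: "\<delta> \<le> \<epsilon> / 2" "\<delta> \<le> (y - a) / 4" "\<delta> \<le> (b - y) / 4" unfolding \<delta>_def by linarith+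
    moreover have "0 < \<delta>" using \<epsilon>(1) y unfolding \<delta>_def by simp
    ultimately show "0 < \<delta>" "\<delta> \<le> (y - a) / 4" "\<delta> \<le> (b - y) / 4" "(1 / p) * (v + \<delta>) powr (p / 2) < q"
      using \<epsilon> by auto
  qed
  \<comment> \<open>The interval for the large coordinate has length \<open>\<kappa> * sqrt n\<close>; this factor beats the constants.\<close>
  define \<kappa> where "\<kappa> = sqrt (v + \<delta>) - sqrt v"
  have \<kappa>: "0 < \<kappa>" using \<delta> v by (simp add: \<kappa>_def)
  note c = gen_gauss_const_pos[OF p(1)]
  let ?A = "\<lambda>n. {real n * (m - \<delta>)<..<real n * (m + \<delta>)}"
  let ?P = "\<lambda>n T. measure (gen_gauss_pow p n) {x \<in> space (gen_gauss_pow p n). sq_sum n x \<in> T}"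
  have low: "\<forall>\<^sub>F n in sequentially. ?P n {..real n * (m - \<delta>)} < 1 / 4"
    using exp_small_eventually_less[OF gen_gauss_pow_square_sum_lower_tail[OF p, of "m - \<delta>"], of "1/4"] p \<delta> by (simp add: m_def)
  have "0 < (1 / p) * \<delta> powr (p / 2)" using p \<delta> by simp
  then obtain r where r: "0 < r" "r < (1 / p) * \<delta> powr (p / 2)" using dense by blast
  have "\<forall>\<^sub>F n in sequentially. ?P n {real n * (m + \<delta>)..} \<le> exp (- r * real n powr (p / 2))"
    using gen_gauss_pow_square_sum_upper_tail[OF p, of "m + \<delta>" r] \<delta> r by (simp add: m_def)
  moreover have "\<forall>\<^sub>F n in sequentially. exp (- r * real n powr (p / 2)) < 1 / 4"
    using r p by real_asymp
  ultimately have "\<forall>\<^sub>F n in sequentially. ?P n {real n * (m + \<delta>)..} < 1 / 4"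
    by eventually_elim simp
  with low have A: "\<forall>\<^sub>F n in sequentially. 1 / 2 \<le> ?P n (?A n)"
  proof eventually_elim
    case (elim n)
    interpret P: prob_space "gen_gauss_pow p n" by (rule prob_space_gen_gauss_pow) fact
    have [measurable]: "{x \<in> space (gen_gauss_pow p n). sq_sum n x \<in> T} \<in> sets (gen_gauss_pow p n)" if "T \<in> sets borel" for T
      using that by measurable
    have "1 = measure (gen_gauss_pow p n) (space (gen_gauss_pow p n))" by (simp add: P.prob_space)
    also have "\<dots> \<le> measure (gen_gauss_pow p n) ({x \<in> space (gen_gauss_pow p n). sq_sum n x \<in> ?A n}
        \<union> ({x \<in> space (gen_gauss_pow p n). sq_sum n x \<in> {..real n * (m - \<delta>)}}
        \<union> {x \<in> space (gen_gauss_pow p n). sq_sum n x \<in> {real n * (m + \<delta>)..}}))"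
      by (intro P.finite_measure_mono) auto
    also have "\<dots> \<le> ?P n (?A n) + (?P n {..real n * (m - \<delta>)} + ?P n {real n * (m + \<delta>)..})"
      by (intro order_trans[OF measure_Un_le] add_left_mono measure_Un_le) auto
    finally show ?case using elim by simp
  qed
  have 1: "\<forall>\<^sub>F n in sequentially. a - v < real n * (y - a - \<delta>)"
  proof -
    have "0 < y - a - \<delta>" using \<delta>(2) y by argo
    then show ?thesis by real_asymp
  qed
  have 2: "\<forall>\<^sub>F n in sequentially. v + \<delta> - b < real n * (b - y - 2 * \<delta>)"
  proof -
    have "0 < b - y - 2 * \<delta>" using \<delta>(3) y by argo
    then show ?thesis by real_asymp
  qed
  have 3: "\<forall>\<^sub>F n in sequentially. 2 < gen_gauss_const p * \<kappa> * sqrt (real (Suc n))"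
    using c \<kappa> by real_asymp
  have "\<forall>\<^sub>F n in sequentially. exp (- q * real (Suc n) powr (p / 2))
    \<le> ?P (Suc n) {real (Suc n) * a<..<real (Suc n) * b}"
    using A 1 2 3
  proof eventually_elim
    case (elim n)
    let ?N = "real (Suc n)"
    let ?J = "{sqrt (?N * v) .. sqrt (?N * (v + \<delta>))}"
    have sub: "s + z\<^sup>2 \<in> {?N * a<..<?N * b}" if s: "s \<in> ?A n" and z: "z \<in> ?J" for s z
    proof -
      have z0: "0 \<le> sqrt (?N * v)" "0 \<le> ?N * v" "0 \<le> ?N * (v + \<delta>)" using v \<delta> by auto
      have "(sqrt (?N * v))\<^sup>2 \<le> z\<^sup>2" using z z0 by (intro power_mono) auto
      moreover have "z\<^sup>2 \<le> (sqrt (?N * (v + \<delta>)))\<^sup>2" using z order_trans[OF z0(1), of z] by (intro power_mono) auto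
      ultimately have z2: "?N * v \<le> z\<^sup>2" "z\<^sup>2 \<le> ?N * (v + \<delta>)" using z0(2,3) by simp_all
      have "?N * a \<le> real n * (m - \<delta>) + ?N * v" using elim(2) by (simp add: v_def algebra_simps)
      moreover have "real n * (m + \<delta>) + ?N * (v + \<delta>) \<le> ?N * b" using elim(3) by (simp add: v_def algebra_simps)
      ultimately show ?thesis using s z2 by auto
    qed
    have "exp (- q * ?N powr (p / 2)) \<le> exp (- (1 / p) * (?N * (v + \<delta>)) powr (p / 2))"
    proof -
      have "(1 / p) * (v + \<delta>) powr (p / 2) * ?N powr (p / 2) \<le> q * ?N powr (p / 2)"
        using \<delta> by (intro mult_right_mono) auto
      moreover have "(?N * (v + \<delta>)) powr (p / 2) = ?N powr (p / 2) * (v + \<delta>) powr (p / 2)"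
        using v \<delta> by (simp add: powr_mult)
      ultimately show ?thesis by (simp add: mult_ac)
    qed
    also have "\<dots> \<le> (gen_gauss_const p * (sqrt (?N * (v + \<delta>)) - sqrt (?N * v)) * exp (- (1 / p) * (?N * (v + \<delta>)) powr (p / 2))) * (1 / 2)"
    proof -
      have "2 \<le> gen_gauss_const p * (sqrt (?N * (v + \<delta>)) - sqrt (?N * v))"
        using elim(4) unfolding real_sqrt_mult \<kappa>_def right_diff_distrib[symmetric] by (simp only: mult_ac less_imp_le)
      from mult_right_mono[OF this, of "exp (- (1 / p) * (?N * (v + \<delta>)) powr (p / 2))"] show ?thesis
        unfolding le_divide_eq_numeral1 times_divide_eq_right mult_1_right by (simp only: exp_ge_zero mult.commute)
    qed
    also have "\<dots> \<le> measure (gen_gauss p) ?J * ?P n (?A n)"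
      using elim(1) v \<delta> by (intro mult_mono gen_gauss_square_interval_ge[OF p(1)]) auto
    also have "\<dots> \<le> ?P (Suc n) {?N * a<..<?N * b}"
      by (rule gen_gauss_pow_Suc_square_sum_ge[OF p(1) _ _ _ sub]) auto
    finally show ?case .
  qed
  then show ?thesis by (rule eventually_sequentially_Suc[THEN iffD1])
qed

section \<open>The uniform law on the ball\<close>

text \<open>
  Lebesgue measure on extensional functions \<open>{..<n} \<rightarrow> \<real>\<close>, where product integrals are available.
\<close>
definition leb_pow :: "nat \<Rightarrow> (nat \<Rightarrow> real) measure" where
  "leb_pow n = (\<Pi>\<^sub>M i\<in>{..<n}. lborel)"

definition pow_sum :: "real \<Rightarrow> nat \<Rightarrow> (nat \<Rightarrow> real) \<Rightarrow> real" where
  "pow_sum p n x = (\<Sum>i<n. \<bar>x i\<bar> powr p)"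

definition dilate :: "nat \<Rightarrow> real \<Rightarrow> (nat \<Rightarrow> real) \<Rightarrow> nat \<Rightarrow> real" where
  "dilate n c x = (\<lambda>i\<in>{..<n}. c * x i)"

definition pow_ball :: "real \<Rightarrow> nat \<Rightarrow> (nat \<Rightarrow> real) set" where
  "pow_ball p n = {x \<in> space (leb_pow n). pow_sum p n x \<le> 1}"

definition ball_law :: "real \<Rightarrow> nat \<Rightarrow> (nat \<Rightarrow> real) measure" where
  "ball_law p n = uniform_measure (leb_pow n) (pow_ball p n)"

text \<open>
  The Gamma law with shape \<open>n / p + 1\<close> and scale \<open>p\<close>.
\<close>
definition radial_law :: "real \<Rightarrow> nat \<Rightarrow> real measure" where
  "radial_law p n = density lborel (\<lambda>u. ennreal (1 / (p powr (real n / p + 1) * Gamma (real n / p + 1)))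
     * (ennreal (u powr (real n / p) * exp (- (1 / p) * u)) * indicator {0..} u))"

lemma sets_leb_pow [measurable_cong]: "sets (leb_pow n) = sets (\<Pi>\<^sub>M i\<in>{..<n}. borel)"
  unfolding leb_pow_def by (rule sets_PiM_cong) auto

lemma space_leb_pow: "space (leb_pow n) = extensional {..<n}"
  by (auto simp: leb_pow_def space_PiM PiE_def)

lemma space_gen_gauss_pow: "space (gen_gauss_pow p n) = space (leb_pow n)"
  by (simp add: leb_pow_def gen_gauss_pow_def space_PiM)

lemma sets_gen_gauss_pow_leb_pow: "sets (gen_gauss_pow p n) = sets (leb_pow n)"
  by (simp add: sets_leb_pow sets_gen_gauss_pow)

lemma sigma_finite_leb_pow: "sigma_finite_measure (leb_pow n)"
proof -
  interpret product_sigma_finite "\<lambda>_::nat. lborel :: real measure" by standard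
  show ?thesis unfolding leb_pow_def by (rule sigma_finite) simp
qed

lemma measurable_pow_sum [measurable]: "pow_sum p n \<in> borel_measurable (\<Pi>\<^sub>M i\<in>{..<n}. borel)"
  unfolding pow_sum_def by measurable

lemma pow_sum_nonneg: "0 \<le> pow_sum p n x"
  unfolding pow_sum_def by (intro sum_nonneg) simp

lemma pow_ball_sets [measurable]: "pow_ball p n \<in> sets (leb_pow n)"
  unfolding pow_ball_def by measurable

lemma sets_ball_law [measurable_cong]: "sets (ball_law p n) = sets (\<Pi>\<^sub>M i\<in>{..<n}. borel)"
  by (simp add: ball_law_def sets_leb_pow)

lemma space_ball_law: "space (ball_law p n) = space (leb_pow n)"
  by (simp add: ball_law_def)

lemma sets_radial_law [simp, measurable_cong]: "sets (radial_law p n) = sets borel"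
  by (simp add: radial_law_def)

lemma space_radial_law [simp]: "space (radial_law p n) = UNIV"
  by (simp add: radial_law_def)

lemma dilate_measurable [measurable]:
  assumes "f \<in> borel_measurable M" "g \<in> measurable M (\<Pi>\<^sub>M i\<in>{..<n}. borel)"
  shows "(\<lambda>w. dilate n (f w) (g w)) \<in> measurable M (\<Pi>\<^sub>M i\<in>{..<n}. borel)"
proof -
  note assms [measurable]
  have [measurable]: "(\<lambda>w. g w i) \<in> borel_measurable M" if "i \<in> {..<n}" for i
    using measurable_compose[OF assms(2) measurable_component_singleton[OF that]] .
  show ?thesis unfolding dilate_def by (rule measurable_restrict) measurable
qed

lemma emeasure_lborel_scale:
  assumes "0 < c" "A \<in> sets borel"
  shows "emeasure lborel A = ennreal c * emeasure lborel {x::real. c * x \<in> A}"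
proof -
  have [measurable]: "{x. c * x \<in> A} \<in> sets borel"
    using assms(2) by measurable
  have "emeasure lborel A = (\<integral>\<^sup>+x. indicator A x \<partial>lborel)" using assms by simp
  also have "\<dots> = ennreal \<bar>c\<bar> * (\<integral>\<^sup>+x. indicator A (0 + c * x) \<partial>lborel)"
    using assms by (intro nn_integral_real_affine) auto
  also have "(\<integral>\<^sup>+x. indicator A (0 + c * x) \<partial>lborel) = (\<integral>\<^sup>+x. indicator {x. c * x \<in> A} x \<partial>lborel)"
    by (intro nn_integral_cong) (auto split: split_indicator)
  also have "\<dots> = emeasure lborel {x::real. c * x \<in> A}" by simp
  finally show ?thesis using assms by simp
qed

lemma leb_pow_dilate:
  assumes c: "0 < c"
  shows "density (distr (leb_pow n) (leb_pow n) (dilate n c)) (\<lambda>_. ennreal (c ^ n)) = leb_pow n"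
proof -
  interpret product_sigma_finite "\<lambda>_::nat. lborel :: real measure" by standard
  have [measurable]: "dilate n c \<in> measurable (leb_pow n) (leb_pow n)"
    unfolding measurable_cong_sets[OF sets_leb_pow sets_leb_pow] by measurable
  have "density (distr (leb_pow n) (leb_pow n) (dilate n c)) (\<lambda>_. ennreal (c ^ n)) = (\<Pi>\<^sub>M i\<in>{..<n}. lborel)"
  proof (rule PiM_eqI)
    fix A :: "nat \<Rightarrow> real set" assume A: "\<And>i. i \<in> {..<n} \<Longrightarrow> A i \<in> sets lborel"
    have PA: "Pi\<^sub>E {..<n} A \<in> sets (leb_pow n)" unfolding leb_pow_def using A by (intro sets_PiM_I_finite) auto
    have B: "{x. c * x \<in> A i} \<in> sets lborel" if "i \<in> {..<n}" for i
      using A[OF that] by simp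
    have "emeasure (density (distr (leb_pow n) (leb_pow n) (dilate n c)) (\<lambda>_. ennreal (c ^ n))) (Pi\<^sub>E {..<n} A)
      = ennreal (c ^ n) * emeasure (leb_pow n) (dilate n c -` Pi\<^sub>E {..<n} A \<inter> space (leb_pow n))"
      using PA by (simp add: emeasure_density_const emeasure_distr)
    also have "dilate n c -` Pi\<^sub>E {..<n} A \<inter> space (leb_pow n) = Pi\<^sub>E {..<n} (\<lambda>i. {x. c * x \<in> A i})"
    proof (rule set_eqI)
      fix x :: "nat \<Rightarrow> real"
      have "dilate n c x \<in> Pi\<^sub>E {..<n} A \<longleftrightarrow> (\<forall>i<n. c * x i \<in> A i)"
        by (simp add: dilate_def PiE_iff Ball_def)
      then show "x \<in> dilate n c -` Pi\<^sub>E {..<n} A \<inter> space (leb_pow n) \<longleftrightarrow> x \<in> Pi\<^sub>E {..<n} (\<lambda>i. {x. c * x \<in> A i})"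
        unfolding space_leb_pow vimage_def Int_iff mem_Collect_eq PiE_iff by (simp add: Ball_def)
    qed
    also have "emeasure (leb_pow n) \<dots> = (\<Prod>i<n. emeasure lborel {x. c * x \<in> A i})"
      unfolding leb_pow_def using B by (intro emeasure_PiM) auto
    also have "ennreal (c ^ n) * (\<Prod>i<n. emeasure lborel {x. c * x \<in> A i}) = (\<Prod>i<n. ennreal c * emeasure lborel {x. c * x \<in> A i})"
      using c by (simp add: prod.distrib ennreal_power)
    also have "\<dots> = (\<Prod>i<n. emeasure lborel (A i))"
      using A c by (intro prod.cong refl emeasure_lborel_scale[symmetric]) auto
    finally show "emeasure (density (distr (leb_pow n) (leb_pow n) (dilate n c)) (\<lambda>_. ennreal (c ^ n))) (Pi\<^sub>E {..<n} A)
      = (\<Prod>i<n. emeasure lborel (A i))" .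
  qed (simp_all add: leb_pow_def)
  then show ?thesis by (simp add: leb_pow_def)
qed

lemma emeasure_leb_pow_dilate:
  assumes c: "0 < c" and S: "S \<in> sets (leb_pow n)"
  shows "emeasure (leb_pow n) S = ennreal (c ^ n) * emeasure (leb_pow n) {x \<in> space (leb_pow n). dilate n c x \<in> S}"
proof -
  have [measurable]: "dilate n c \<in> measurable (leb_pow n) (leb_pow n)"
    unfolding measurable_cong_sets[OF sets_leb_pow sets_leb_pow] by measurable
  have "emeasure (leb_pow n) S = emeasure (density (distr (leb_pow n) (leb_pow n) (dilate n c)) (\<lambda>_. ennreal (c ^ n))) S"
    unfolding leb_pow_dilate[OF c] ..
  also have "\<dots> = ennreal (c ^ n) * emeasure (leb_pow n) (dilate n c -` S \<inter> space (leb_pow n))"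
    using S by (simp add: emeasure_density_const emeasure_distr)
  also have "dilate n c -` S \<inter> space (leb_pow n) = {x \<in> space (leb_pow n). dilate n c x \<in> S}" by auto
  finally show ?thesis .
qed

lemma gen_gauss_pow_eq_density:
  assumes p: "0 < p"
  shows "gen_gauss_pow p n = density (leb_pow n) (\<lambda>x. ennreal (gen_gauss_const p ^ n) * ennreal (exp (- (1 / p) * pow_sum p n x)))"
proof -
  interpret product_sigma_finite "\<lambda>_::nat. lborel :: real measure" by standard
  interpret G: prob_space "gen_gauss p" by (rule prob_space_gen_gauss) fact
  interpret P: product_sigma_finite "\<lambda>_::nat. gen_gauss p" by standard
  let ?f = "\<lambda>z. ennreal (gen_gauss_const p * exp (- (1 / p) * \<bar>z\<bar> powr p))"
  note c = gen_gauss_const_pos[OF p]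
  have prod: "ennreal (gen_gauss_const p ^ n) * ennreal (exp (- (1 / p) * pow_sum p n x)) = (\<Prod>i<n. ?f (x i))" for x
  proof -
    have "(\<Prod>i<n. gen_gauss_const p * exp (- (1 / p) * \<bar>x i\<bar> powr p)) = gen_gauss_const p ^ n * exp (- (1 / p) * pow_sum p n x)"
      unfolding pow_sum_def sum_distrib_left exp_sum[OF finite_lessThan] by (simp add: prod.distrib)
    then show ?thesis using c by (simp add: prod_ennreal ennreal_mult[symmetric])
  qed
  have "density (leb_pow n) (\<lambda>x. \<Prod>i<n. ?f (x i)) = (\<Pi>\<^sub>M i\<in>{..<n}. gen_gauss p)"
  proof (rule P.PiM_eqI)
    fix A :: "nat \<Rightarrow> real set" assume A: "\<And>i. i \<in> {..<n} \<Longrightarrow> A i \<in> sets (gen_gauss p)"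
    have PA: "Pi\<^sub>E {..<n} A \<in> sets (leb_pow n)" unfolding leb_pow_def using A by (intro sets_PiM_I_finite) auto
    have "emeasure (density (leb_pow n) (\<lambda>x. \<Prod>i<n. ?f (x i))) (Pi\<^sub>E {..<n} A)
      = (\<integral>\<^sup>+x. (\<Prod>i<n. ?f (x i)) * indicator (Pi\<^sub>E {..<n} A) x \<partial>leb_pow n)"
      using PA by (intro emeasure_density) auto
    also have "\<dots> = (\<integral>\<^sup>+x. (\<Prod>i<n. ?f (x i) * indicator (A i) (x i)) \<partial>leb_pow n)"
    proof (rule nn_integral_cong)
      fix x assume x: "x \<in> space (leb_pow n)"
      show "(\<Prod>i<n. ?f (x i)) * indicator (Pi\<^sub>E {..<n} A) x = (\<Prod>i<n. ?f (x i) * indicator (A i) (x i))"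
      proof (cases "x \<in> Pi\<^sub>E {..<n} A")
        case True then show ?thesis by (auto intro!: prod.cong simp: PiE_iff)
      next
        case False
        then obtain i where "i < n" "x i \<notin> A i" using x by (auto simp: PiE_iff space_leb_pow)
        then have "(\<Prod>i<n. ?f (x i) * indicator (A i) (x i)) = 0" by (intro prod_zero) (auto intro!: bexI[of _ i])
        then show ?thesis using False by simp
      qed
    qed
    also have "\<dots> = (\<Prod>i<n. \<integral>\<^sup>+z. ?f z * indicator (A i) z \<partial>lborel)"
      unfolding leb_pow_def using A by (intro product_nn_integral_prod) auto
    also have "\<dots> = (\<Prod>i<n. emeasure (gen_gauss p) (A i))"
      using A unfolding gen_gauss_def by (intro prod.cong) (auto simp: emeasure_density)
    finally show "emeasure (density (leb_pow n) (\<lambda>x. \<Prod>i<n. ?f (x i))) (Pi\<^sub>E {..<n} A) = (\<Prod>i<n. emeasure (gen_gauss p) (A i))" .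
  qed (auto simp: sets_leb_pow sets_gen_gauss_pow[unfolded gen_gauss_pow_def])
  then show ?thesis unfolding gen_gauss_pow_def prod by simp
qed

lemma pow_sum_dilate:
  assumes "0 < p" "0 < u"
  shows "pow_sum p n (dilate n (u powr (1 / p)) x) = u * pow_sum p n x"
  unfolding pow_sum_def sum_distrib_left
  using assms by (intro sum.cong) (auto simp: dilate_def abs_mult powr_mult powr_powr)

lemma sq_sum_dilate: "sq_sum n (dilate n c x) = c\<^sup>2 * sq_sum n x"
  unfolding sq_sum_def sum_distrib_left by (intro sum.cong) (auto simp: dilate_def power_mult_distrib)

text \<open>
  Layer cake for \<open>exp (- \<parallel>x\<parallel>\<^sub>p\<^sup>p / p)\<close>: the sublevel set at height \<open>u\<close> is the ball of radius
  \<open>u powr (1 / p)\<close>, which dilation maps back to the unit ball at the price of the factor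
  \<open>u powr (n / p)\<close>.
\<close>
lemma emeasure_gen_gauss_pow_radial:
  assumes p: "0 < p" and S: "S \<in> sets (leb_pow n)"
  shows "emeasure (gen_gauss_pow p n) S = (\<integral>\<^sup>+u. ennreal (gen_gauss_const p ^ n * (1 / p)) * (ennreal (u powr (real n / p) * exp (- (1 / p) * u)) * indicator {0..} u)
      * emeasure (leb_pow n) (pow_ball p n \<inter> {x \<in> space (leb_pow n). dilate n (u powr (1 / p)) x \<in> S}) \<partial>lborel)"
proof -
  note [measurable] = S
  note c = gen_gauss_const_pos[OF p]
  have "emeasure (gen_gauss_pow p n) S = (\<integral>\<^sup>+x. (ennreal (gen_gauss_const p ^ n) * ennreal (exp (- (1 / p) * pow_sum p n x))) * indicator S x \<partial>leb_pow n)"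
    unfolding gen_gauss_pow_eq_density[OF p] by (rule emeasure_density) measurable
  also have "\<dots> = (\<integral>\<^sup>+x. (ennreal (gen_gauss_const p ^ n) * indicator S x) * ennreal (exp (- (1 / p) * pow_sum p n x)) \<partial>leb_pow n)"
    by (intro nn_integral_cong) (simp add: mult_ac)
  also have "\<dots> = (\<integral>\<^sup>+u. ennreal (1 / p * exp (- (1 / p) * u)) *
      (\<integral>\<^sup>+x. (ennreal (gen_gauss_const p ^ n) * indicator S x) * indicator {x. pow_sum p n x \<le> u} x \<partial>leb_pow n) \<partial>lborel)"
    by (rule layer_cake_exp[OF sigma_finite_leb_pow]) (use p in auto)
  also have "\<dots> = (\<integral>\<^sup>+u. ennreal (gen_gauss_const p ^ n * (1 / p)) * (ennreal (u powr (real n / p) * exp (- (1 / p) * u)) * indicator {0..} u)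
      * emeasure (leb_pow n) (pow_ball p n \<inter> {x \<in> space (leb_pow n). dilate n (u powr (1 / p)) x \<in> S}) \<partial>lborel)"
  proof (rule nn_integral_cong_AE)
    have "AE u in lborel. u \<noteq> (0::real)" by (rule AE_lborel_singleton)
    then show "AE u in lborel. ennreal (1 / p * exp (- (1 / p) * u)) *
      (\<integral>\<^sup>+x. (ennreal (gen_gauss_const p ^ n) * indicator S x) * indicator {x. pow_sum p n x \<le> u} x \<partial>leb_pow n)
      = ennreal (gen_gauss_const p ^ n * (1 / p)) * (ennreal (u powr (real n / p) * exp (- (1 / p) * u)) * indicator {0..} u)
      * emeasure (leb_pow n) (pow_ball p n \<inter> {x \<in> space (leb_pow n). dilate n (u powr (1 / p)) x \<in> S})"
    proof eventually_elim
      case (elim u)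
      let ?B = "{x \<in> space (leb_pow n). pow_sum p n x \<le> u \<and> x \<in> S}"
      have [measurable]: "?B \<in> sets (leb_pow n)" by measurable
      have B: "(\<integral>\<^sup>+x. (ennreal (gen_gauss_const p ^ n) * indicator S x) * indicator {x. pow_sum p n x \<le> u} x \<partial>leb_pow n)
        = ennreal (gen_gauss_const p ^ n) * emeasure (leb_pow n) ?B"
      proof -
        have "(\<integral>\<^sup>+x. (ennreal (gen_gauss_const p ^ n) * indicator S x) * indicator {x. pow_sum p n x \<le> u} x \<partial>leb_pow n)
          = (\<integral>\<^sup>+x. ennreal (gen_gauss_const p ^ n) * indicator ?B x \<partial>leb_pow n)"
          by (intro nn_integral_cong) (auto split: split_indicator)
        then show ?thesis by (simp add: nn_integral_cmult)
      qed
      show ?case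
      proof (cases "0 < u")
        case True
        define V where "V = emeasure (leb_pow n) (pow_ball p n \<inter> {x \<in> space (leb_pow n). dilate n (u powr (1 / p)) x \<in> S})"
        have "emeasure (leb_pow n) ?B = ennreal ((u powr (1 / p)) ^ n) * emeasure (leb_pow n) {x \<in> space (leb_pow n). dilate n (u powr (1 / p)) x \<in> ?B}"
          by (rule emeasure_leb_pow_dilate) (use True in auto)
        also have "{x \<in> space (leb_pow n). dilate n (u powr (1 / p)) x \<in> ?B} = pow_ball p n \<inter> {x \<in> space (leb_pow n). dilate n (u powr (1 / p)) x \<in> S}"
        proof -
          have "pow_sum p n (dilate n (u powr (1 / p)) x) \<le> u \<longleftrightarrow> pow_sum p n x \<le> 1" for x
            unfolding pow_sum_dilate[OF p True] using mult_le_cancel_left_pos[OF True, of "pow_sum p n x" 1] by simp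
          moreover have "dilate n a x \<in> space (leb_pow n)" for a x by (simp add: space_leb_pow dilate_def)
          ultimately show ?thesis unfolding pow_ball_def by blast
        qed
        also have "(u powr (1 / p)) ^ n = u powr (real n / p)"
          using True by (simp add: powr_realpow[symmetric] powr_powr)
        finally have B': "emeasure (leb_pow n) ?B = ennreal (u powr (real n / p)) * V" unfolding V_def .
        have collect: "ennreal x * (ennreal y * (ennreal z * V)) = ennreal (x * y * z) * V" if "0 \<le> x" "0 \<le> y" "0 \<le> z" for x y z
          using that by (simp add: ennreal_mult mult.assoc)
        have "ennreal (1 / p * exp (- (1 / p) * u)) * (ennreal (gen_gauss_const p ^ n) * (ennreal (u powr (real n / p)) * V))
          = ennreal ((1 / p * exp (- (1 / p) * u)) * gen_gauss_const p ^ n * u powr (real n / p)) * V"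
          by (rule collect) (use p c in auto)
        also have "(1 / p * exp (- (1 / p) * u)) * gen_gauss_const p ^ n * u powr (real n / p)
          = gen_gauss_const p ^ n * (1 / p) * (u powr (real n / p) * exp (- (1 / p) * u))" by (simp only: mult_ac)
        also have "ennreal \<dots> = ennreal (gen_gauss_const p ^ n * (1 / p)) * ennreal (u powr (real n / p) * exp (- (1 / p) * u))"
          using p c by (intro ennreal_mult) auto
        moreover have "indicator {0..} u = (1::ennreal)" using True by simp
        ultimately show ?thesis unfolding B unfolding B' V_def[symmetric] by (simp only: mult_1_right)
      next
        case False
        with elim have "u < 0" by linarith
        have "\<not> pow_sum p n x \<le> u" for x using pow_sum_nonneg[of p n x] \<open>u < 0\<close> by linarith
        then have B0: "?B = {}" by blast
        have i0: "indicator {0..} u = (0::ennreal)" using \<open>u < 0\<close> by simp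
        show ?thesis unfolding B unfolding B0 i0 by (simp only: emeasure_empty mult_zero_right mult_zero_left)
      qed
    qed
  qed
  finally show ?thesis .
qed

lemma nn_integral_radial_law:
  assumes [measurable]: "f \<in> borel_measurable borel"
  shows "(\<integral>\<^sup>+u. f u \<partial>radial_law p n) = ennreal (1 / (p powr (real n / p + 1) * Gamma (real n / p + 1)))
    * (\<integral>\<^sup>+u. (ennreal (u powr (real n / p) * exp (- (1 / p) * u)) * indicator {0..} u) * f u \<partial>lborel)"
  unfolding radial_law_def
  by (subst nn_integral_density, simp, simp, simp only: mult.assoc, rule nn_integral_cmult, measurable)

lemma radial_law_exp_moment:
  assumes p: "0 < p" and s: "s < 1"
  shows "(\<integral>\<^sup>+u. ennreal (exp (s / p * u)) \<partial>radial_law p n) = ennreal ((1 - s) powr (- (real n / p + 1)))"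
proof -
  let ?a = "real n / p + 1"
  have a: "0 < ?a" using p by (simp add: add_nonneg_pos)
  have 1: "0 < (1 - s) / p" using p s by simp
  have "(\<integral>\<^sup>+u. ennreal (exp (s / p * u)) \<partial>radial_law p n)
    = ennreal (1 / (p powr ?a * Gamma ?a)) * (\<integral>\<^sup>+u. ennreal (u powr (real n / p) * exp (- ((1 - s) / p) * u)) * indicator {0..} u \<partial>lborel)"
  proof (subst nn_integral_radial_law)
    have "u powr (real n / p) * exp (- (1 / p) * u) * exp (s / p * u) = u powr (real n / p) * exp (- ((1 - s) / p) * u)" for u
      unfolding mult.assoc exp_add[symmetric] by (simp add: diff_divide_distrib algebra_simps)
    then have "ennreal (u powr (real n / p) * exp (- (1 / p) * u)) * indicator {0..} u * ennreal (exp (s / p * u))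
       = ennreal (u powr (real n / p) * exp (- ((1 - s) / p) * u)) * indicator {0..} u" for u
      by (cases "0 \<le> u") (simp_all add: ennreal_mult''[symmetric])
    then show "ennreal (1 / (p powr ?a * Gamma ?a)) * (\<integral>\<^sup>+u. ennreal (u powr (real n / p) * exp (- (1 / p) * u)) * indicator {0..} u * ennreal (exp (s / p * u)) \<partial>lborel)
      = ennreal (1 / (p powr ?a * Gamma ?a)) * (\<integral>\<^sup>+u. ennreal (u powr (real n / p) * exp (- ((1 - s) / p) * u)) * indicator {0..} u \<partial>lborel)"
      by simp
  qed simp
  also have "\<dots> = ennreal (1 / (p powr ?a * Gamma ?a)) * ennreal (((1 - s) / p) powr (- ?a) * Gamma ?a)"
    using p by (subst nn_integral_powr_exp[OF 1]) (auto intro: less_le_trans[of _ 0])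
  also have "\<dots> = ennreal (1 / (p powr ?a * Gamma ?a) * (((1 - s) / p) powr (- ?a) * Gamma ?a))"
    using p by (intro ennreal_mult'[symmetric]) (simp add: Gamma_real_nonneg a less_imp_le)
  also have "1 / (p powr ?a * Gamma ?a) * (((1 - s) / p) powr (- ?a) * Gamma ?a) = (1 - s) powr (- ?a)"
  proof -
    have "1 / (p powr b * G) * (((1 - s) / p) powr (- b) * G) = (1 - s) powr (- b)" if "0 < G" for b G
      using that p s by (simp add: powr_divide powr_minus field_simps)
    then show ?thesis using Gamma_real_pos[OF a] by blast
  qed
  finally show ?thesis .
qed

lemma prob_space_radial_law: "0 < p \<Longrightarrow> prob_space (radial_law p n)"
  using radial_law_exp_moment[of p 0 n] by (intro prob_spaceI) simp

text \<open>
  The product law has total mass one; its decomposition into balls therefore determines the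
  volume of the unit ball.
\<close>
lemma emeasure_pow_ball:
  assumes p: "0 < p"
  shows "ennreal (gen_gauss_const p ^ n * (1 / p) * (p powr (real n / p + 1) * Gamma (real n / p + 1))) * emeasure (leb_pow n) (pow_ball p n) = 1"
proof -
  interpret P: prob_space "gen_gauss_pow p n" by (rule prob_space_gen_gauss_pow) fact
  let ?a = "real n / p + 1"
  have a: "0 < ?a" using p by (simp add: add_nonneg_pos)
  note c = gen_gauss_const_pos[OF p]
  have "1 = emeasure (gen_gauss_pow p n) (space (leb_pow n))" using P.emeasure_space_1 by (simp add: space_gen_gauss_pow)
  also have "\<dots> = (\<integral>\<^sup>+u. ennreal (gen_gauss_const p ^ n * (1 / p)) * (ennreal (u powr (real n / p) * exp (- (1 / p) * u)) * indicator {0..} u)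
      * emeasure (leb_pow n) (pow_ball p n) \<partial>lborel)"
  proof -
    have "pow_ball p n \<inter> {x \<in> space (leb_pow n). dilate n b x \<in> space (leb_pow n)} = pow_ball p n" for b
      by (auto simp: pow_ball_def space_leb_pow dilate_def)
    then show ?thesis by (subst emeasure_gen_gauss_pow_radial[OF p]) simp_all
  qed
  also have "\<dots> = ennreal (gen_gauss_const p ^ n * (1 / p)) * ennreal ((1 / p) powr (- ?a) * Gamma ?a) * emeasure (leb_pow n) (pow_ball p n)"
    using p nn_integral_powr_exp[of "1 / p" "real n / p"] by (simp add: nn_integral_multc nn_integral_cmult less_le_trans[of _ 0])
  also have "\<dots> = ennreal (gen_gauss_const p ^ n * (1 / p) * (p powr ?a * Gamma ?a)) * emeasure (leb_pow n) (pow_ball p n)"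
  proof -
    have "(1 / p) powr (- b) = p powr b" for b using p by (simp add: powr_divide powr_minus)
    then show ?thesis using p c by (subst ennreal_mult'[symmetric]) (simp_all only: divide_nonneg_nonneg mult_nonneg_nonneg zero_le_power less_imp_le zero_le_one)
  qed
  finally show ?thesis by simp
qed

lemma pow_ball_finite_pos:
  assumes "0 < p"
  shows "emeasure (leb_pow n) (pow_ball p n) \<noteq> 0" "emeasure (leb_pow n) (pow_ball p n) \<noteq> \<infinity>"
proof -
  define K where "K = gen_gauss_const p ^ n * (1 / p) * (p powr (real n / p + 1) * Gamma (real n / p + 1))"
  have K: "0 < K" unfolding K_def using assms gen_gauss_const_pos[OF assms]
    by (intro mult_pos_pos Gamma_real_pos) (auto simp: add_nonneg_pos)
  have eq: "ennreal K * emeasure (leb_pow n) (pow_ball p n) = 1" unfolding K_def by (rule emeasure_pow_ball) fact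
  show "emeasure (leb_pow n) (pow_ball p n) \<noteq> 0" using eq by auto
  show "emeasure (leb_pow n) (pow_ball p n) \<noteq> \<infinity>"
  proof
    assume "emeasure (leb_pow n) (pow_ball p n) = \<infinity>"
    then show False using eq K by (simp add: ennreal_mult_top)
  qed
qed

lemma prob_space_ball_law: "0 < p \<Longrightarrow> prob_space (ball_law p n)"
  unfolding ball_law_def by (intro prob_space_uniform_measure pow_ball_finite_pos)

text \<open>
  In terms of random vectors, \<open>Z = T powr (1 / p) * X\<close> with \<open>X\<close> uniform on the ball
  and \<open>T\<close> an independent variable with the radial law.
\<close>
lemma gen_gauss_pow_radial_decomposition:
  assumes p: "0 < p" and S: "S \<in> sets (leb_pow n)"
  shows "emeasure (gen_gauss_pow p n) S = (\<integral>\<^sup>+u. emeasure (ball_law p n) {x \<in> space (leb_pow n). dilate n (u powr (1 / p)) x \<in> S} \<partial>radial_law p n)"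
proof -
  note [measurable] = S
  interpret B: prob_space "ball_law p n" by (rule prob_space_ball_law) fact
  define V where "V = emeasure (leb_pow n) (pow_ball p n)"
  define K where "K = p powr (real n / p + 1) * Gamma (real n / p + 1)"
  define C where "C = gen_gauss_const p ^ n * (1 / p)"
  let ?D = "\<lambda>u. {x \<in> space (leb_pow n). dilate n (u powr (1 / p)) x \<in> S}"
  have K: "0 < K" unfolding K_def using p by (intro mult_pos_pos Gamma_real_pos) (auto simp: add_nonneg_pos)
  have C: "0 < C" unfolding C_def using p gen_gauss_const_pos[OF p] by simp
  have V: "ennreal (C * K) * V = 1" unfolding V_def K_def C_def by (rule emeasure_pow_ball[OF p])
  have [measurable]: "?D u \<in> sets (leb_pow n)" for u by measurable
  have m: "(\<lambda>u. emeasure (ball_law p n) (?D u)) \<in> borel_measurable borel"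
  proof -
    have "{z \<in> space (borel \<Otimes>\<^sub>M ball_law p n). dilate n (fst z powr (1 / p)) (snd z) \<in> S} \<in> sets (borel \<Otimes>\<^sub>M ball_law p n)"
      by measurable
    from B.measurable_emeasure_Pair[OF this] show ?thesis
      by (simp add: space_pair_measure space_ball_law vimage_def)
  qed
  have "ennreal C * X * emeasure (leb_pow n) (pow_ball p n \<inter> ?D u) = ennreal (1 / K) * (X * emeasure (ball_law p n) (?D u))" for X u
  proof -
    have e: "emeasure (ball_law p n) (?D u) = emeasure (leb_pow n) (pow_ball p n \<inter> ?D u) / V"
      unfolding ball_law_def V_def by (rule emeasure_uniform_measure) measurable
    have "emeasure (leb_pow n) (pow_ball p n \<inter> ?D u) = V * emeasure (ball_law p n) (?D u)"
      unfolding e ennreal_times_divide mult.commute[of V] using pow_ball_finite_pos[OF p, of n, folded V_def]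
      by (intro ennreal_mult_divide_eq[symmetric]) simp_all
    moreover have "ennreal C * V = ennreal (1 / K)"
    proof -
      have "ennreal (1 / K) = ennreal (1 / K) * (ennreal (C * K) * V)" unfolding V by simp
      also have "\<dots> = ennreal (1 / K * (C * K)) * V" unfolding mult.assoc[of "ennreal (1 / K)", symmetric] using K by (subst ennreal_mult'[symmetric]) auto
      also have "1 / K * (C * K) = C" using K by simp
      finally show ?thesis by simp
    qed
    moreover have "c * x * (v * y) = (c * v) * (x * y)" for c x v y :: ennreal by (simp only: mult_ac)
    ultimately show ?thesis by simp
  qed
  then have "emeasure (gen_gauss_pow p n) S = (\<integral>\<^sup>+u. ennreal (1 / K) * ((ennreal (u powr (real n / p) * exp (- (1 / p) * u)) * indicator {0..} u) * emeasure (ball_law p n) (?D u)) \<partial>lborel)"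
    unfolding emeasure_gen_gauss_pow_radial[OF p S] C_def[symmetric] by simp
  also have "\<dots> = (\<integral>\<^sup>+u. emeasure (ball_law p n) (?D u) \<partial>radial_law p n)"
    unfolding nn_integral_radial_law[OF m] K_def[symmetric] using m by (intro nn_integral_cmult) simp
  finally show ?thesis .
qed

lemma radial_law_chernoff:
  assumes p: "0 < p" and s: "\<bar>s\<bar> \<le> 1 / 2" and A: "A \<in> sets borel" "\<And>u. u \<in> A \<Longrightarrow> c \<le> s / p * u"
  shows "measure (radial_law p n) A \<le> exp ((real n / p + 1) * (s + 2 * s\<^sup>2) - c)"
proof -
  interpret R: prob_space "radial_law p n" by (rule prob_space_radial_law) fact
  have s1: "s < 1" using s by linarith
  have "emeasure (radial_law p n) A \<le> ennreal (exp (- c)) * (\<integral>\<^sup>+u. ennreal (exp (s / p * u)) \<partial>radial_law p n)"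
    using A by (intro emeasure_le_exp_nn_integral) (auto intro!: ennreal_leI)
  also have "\<dots> = ennreal (exp (- c) * (1 - s) powr (- (real n / p + 1)))"
    unfolding radial_law_exp_moment[OF p s1] by (rule ennreal_mult[symmetric]) auto
  also have "\<dots> \<le> ennreal (exp (- c) * exp ((real n / p + 1) * (s + 2 * s\<^sup>2)))"
    using p by (intro ennreal_leI mult_left_mono one_minus_powr_neg_le s) (auto simp: add_nonneg_pos less_imp_le)
  also have "exp (- c) * exp ((real n / p + 1) * (s + 2 * s\<^sup>2)) = exp ((real n / p + 1) * (s + 2 * s\<^sup>2) - c)"
    by (simp add: exp_add[symmetric])
  finally show ?thesis by (simp add: R.emeasure_eq_measure)
qed

text \<open>
  Chernoff with exponents \<open>\<plusminus> \<delta> / (4 p)\<close>, which minimise the quadratic bound on the logarithm.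
\<close>
lemma radial_law_concentration:
  assumes p: "0 < p" "p < 2" and \<delta>: "0 < \<delta>" "\<delta> \<le> 1"
  shows "exp_small (p / 2) (\<lambda>n. measure (radial_law p n) (- {real n * (1 - \<delta>) .. real n * (1 + \<delta>)}))"
proof -
  define c where "c = \<delta>\<^sup>2 / (8 * p)"
  have c: "0 < c" using p \<delta> by (simp add: c_def)
  define K where "K = exp (\<delta> / 4 + 2 * (\<delta> / 4)\<^sup>2)"
  have up: "measure (radial_law p n) {real n * (1 + \<delta>)<..} \<le> K * exp (- c * real n)" for n
  proof -
    have "measure (radial_law p n) {real n * (1 + \<delta>)<..} \<le> exp ((real n / p + 1) * (\<delta> / 4 + 2 * (\<delta> / 4)\<^sup>2) - \<delta> / 4 / p * (real n * (1 + \<delta>)))"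
      using p \<delta> by (intro radial_law_chernoff) (auto intro!: mult_left_mono divide_right_mono)
    also have "(real n / p + 1) * (\<delta> / 4 + 2 * (\<delta> / 4)\<^sup>2) - \<delta> / 4 / p * (real n * (1 + \<delta>))
      = (\<delta> / 4 + 2 * (\<delta> / 4)\<^sup>2) - c * real n"
      using p by (simp add: c_def field_simps power2_eq_square)
    finally show ?thesis unfolding K_def by (simp only: diff_conv_add_uminus exp_add mult_minus_left)
  qed
  have lo: "measure (radial_law p n) {..<real n * (1 - \<delta>)} \<le> K * exp (- c * real n)" for n
  proof -
    have "measure (radial_law p n) {..<real n * (1 - \<delta>)} \<le> exp ((real n / p + 1) * (- \<delta> / 4 + 2 * (- \<delta> / 4)\<^sup>2) - (- \<delta> / 4) / p * (real n * (1 - \<delta>)))"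
      using p \<delta> by (intro radial_law_chernoff) (auto intro!: mult_left_mono divide_right_mono)
    also have "(real n / p + 1) * (- \<delta> / 4 + 2 * (- \<delta> / 4)\<^sup>2) - (- \<delta> / 4) / p * (real n * (1 - \<delta>))
      = (- \<delta> / 4 + 2 * (\<delta> / 4)\<^sup>2) - c * real n"
      using p by (simp add: c_def field_simps power2_eq_square)
    also have "exp ((- \<delta> / 4 + 2 * (\<delta> / 4)\<^sup>2) - c * real n) \<le> exp ((\<delta> / 4 + 2 * (\<delta> / 4)\<^sup>2) - c * real n)" using \<delta> by simp
    finally show ?thesis unfolding K_def by (simp only: diff_conv_add_uminus exp_add mult_minus_left)
  qed
  have "measure (radial_law p n) (- {real n * (1 - \<delta>) .. real n * (1 + \<delta>)}) \<le> K * exp (- c * real n) + K * exp (- c * real n)" for n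
  proof -
    have "- {real n * (1 - \<delta>) .. real n * (1 + \<delta>)} = {..<real n * (1 - \<delta>)} \<union> {real n * (1 + \<delta>)<..}" by auto
    then have "measure (radial_law p n) (- {real n * (1 - \<delta>) .. real n * (1 + \<delta>)})
      \<le> measure (radial_law p n) {..<real n * (1 - \<delta>)} + measure (radial_law p n) {real n * (1 + \<delta>)<..}"
      by (simp only:) (rule measure_Un_le, auto)
    also have "\<dots> \<le> K * exp (- c * real n) + K * exp (- c * real n)" by (rule add_mono[OF lo up])
    finally show ?thesis .
  qed
  then show ?thesis
    using p by (intro exp_small_mono[OF exp_small_add[OF exp_small_linear[OF c, of "p / 2" K] exp_small_linear[OF c, of "p / 2" K]]]) auto
qed

text \<open>
  The comparison that transfers upper bounds from the product law to the ball: if the radial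
  variable lies in \<open>U\<close>, the event \<open>A\<close> for \<open>X\<close> forces the event \<open>S\<close> for \<open>Z\<close>. It is used with sets \<open>U\<close> of
  probability close to one.
\<close>
lemma ball_law_radial_le:
  assumes p: "0 < p" and A: "A \<in> sets (leb_pow n)" and S: "S \<in> sets (leb_pow n)" and U: "U \<in> sets borel"
    and sub: "\<And>u x. u \<in> U \<Longrightarrow> x \<in> A \<Longrightarrow> dilate n (u powr (1 / p)) x \<in> S"
  shows "measure (ball_law p n) A * measure (radial_law p n) U \<le> measure (gen_gauss_pow p n) S"
proof -
  interpret B: prob_space "ball_law p n" by (rule prob_space_ball_law) fact
  interpret R: prob_space "radial_law p n" by (rule prob_space_radial_law) fact
  interpret G: prob_space "gen_gauss_pow p n" by (rule prob_space_gen_gauss_pow) fact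
  note [measurable] = A S U
  have "ennreal (measure (ball_law p n) A * measure (radial_law p n) U) = (\<integral>\<^sup>+u. emeasure (ball_law p n) A * indicator U u \<partial>radial_law p n)"
    using U by (simp add: nn_integral_cmult B.emeasure_eq_measure R.emeasure_eq_measure ennreal_mult)
  also have "\<dots> \<le> (\<integral>\<^sup>+u. emeasure (ball_law p n) {x \<in> space (leb_pow n). dilate n (u powr (1 / p)) x \<in> S} \<partial>radial_law p n)"
  proof (rule nn_integral_mono)
    fix u
    have "emeasure (ball_law p n) A \<le> emeasure (ball_law p n) {x \<in> space (leb_pow n). dilate n (u powr (1 / p)) x \<in> S}" if "u \<in> U"
    proof (rule emeasure_mono)
      show "A \<subseteq> {x \<in> space (leb_pow n). dilate n (u powr (1 / p)) x \<in> S}"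
        using sub that sets.sets_into_space[OF A] by blast
      have "{x \<in> space (leb_pow n). dilate n (u powr (1 / p)) x \<in> S} \<in> sets (leb_pow n)" by measurable
      then show "{x \<in> space (leb_pow n). dilate n (u powr (1 / p)) x \<in> S} \<in> sets (ball_law p n)"
        by (simp only: sets_ball_law sets_leb_pow)
    qed
    then show "emeasure (ball_law p n) A * indicator U u \<le> emeasure (ball_law p n) {x \<in> space (leb_pow n). dilate n (u powr (1 / p)) x \<in> S}"
      by (auto split: split_indicator)
  qed
  also have "\<dots> = emeasure (gen_gauss_pow p n) S" by (rule gen_gauss_pow_radial_decomposition[OF p S, symmetric])
  finally show ?thesis by (simp add: G.emeasure_eq_measure)
qed

text \<open>
  The reverse comparison, for lower bounds; it is the previous one applied to complements.
\<close>
lemma gen_gauss_pow_le_ball_law_add: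
  assumes p: "0 < p" and A: "A \<in> sets (leb_pow n)" and S: "S \<in> sets (leb_pow n)" and U: "U \<in> sets borel"
    and sub: "\<And>u x. u \<in> U \<Longrightarrow> x \<in> space (leb_pow n) \<Longrightarrow> dilate n (u powr (1 / p)) x \<in> S \<Longrightarrow> x \<in> A"
  shows "measure (gen_gauss_pow p n) S \<le> measure (ball_law p n) A + measure (radial_law p n) (- U)"
proof -
  interpret B: prob_space "ball_law p n" by (rule prob_space_ball_law) fact
  interpret R: prob_space "radial_law p n" by (rule prob_space_radial_law) fact
  interpret G: prob_space "gen_gauss_pow p n" by (rule prob_space_gen_gauss_pow) fact
  define b r g where "b = measure (ball_law p n) A" and "r = measure (radial_law p n) U" and "g = measure (gen_gauss_pow p n) S"
  have "measure (ball_law p n) (space (leb_pow n) - A) * r \<le> measure (gen_gauss_pow p n) (space (leb_pow n) - S)"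
    unfolding r_def
  proof (rule ball_law_radial_le[OF p _ _ U])
    fix u x assume "u \<in> U" "x \<in> space (leb_pow n) - A"
    moreover have "dilate n (u powr (1 / p)) x \<in> space (leb_pow n)" by (simp add: space_leb_pow dilate_def)
    ultimately show "dilate n (u powr (1 / p)) x \<in> space (leb_pow n) - S" using sub by blast
  qed (use A S in auto)
  moreover have "measure (ball_law p n) (space (leb_pow n) - A) = 1 - b"
    unfolding b_def space_ball_law[symmetric, of n p] using A by (intro B.prob_compl) (simp add: sets_ball_law sets_leb_pow)
  moreover have "measure (gen_gauss_pow p n) (space (leb_pow n) - S) = 1 - g"
    unfolding g_def space_gen_gauss_pow[symmetric, of n p] using S by (intro G.prob_compl) (simp add: sets_gen_gauss_pow sets_leb_pow)
  moreover have "(1 - b) * r = r - b * r" by (simp only: left_diff_distrib mult_1_left)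
  moreover have "b * r \<le> b" using mult_left_mono[OF R.prob_le_1[of U], of b] by (simp add: b_def r_def)
  ultimately have "g \<le> b + (1 - r)" by simp
  also have "1 - r = measure (radial_law p n) (- U)"
    using U R.prob_compl[of U] by (simp add: Compl_eq_Diff_UNIV r_def)
  finally show ?thesis by (simp add: g_def b_def)
qed

lemma sq_sum_dilate_scaled:
  assumes "0 < p" "0 < n" "0 < u"
  shows "sq_sum n (dilate n (u powr (1 / p)) x)
    = real n * ((u / real n) powr (2 / p) * (real n powr (2 / p - 1) * sq_sum n x))"
proof -
  have "(u powr (1 / p))\<^sup>2 = u powr (2 / p)"
    using assms by (simp add: powr_power)
  moreover have "real n * ((u / real n) powr (2 / p) * real n powr (2 / p - 1)) = u powr (2 / p)"
    using assms by (simp add: powr_divide powr_diff)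
  ultimately show ?thesis unfolding sq_sum_dilate by (metis mult.assoc)
qed

text \<open>
  The law of \<open>n\<close> to the power \<open>2 / p - 1\<close> times the squared Euclidean norm of a uniform point of
  the \<open>p\<close>-ball.
\<close>
definition ball_prob :: "real \<Rightarrow> nat \<Rightarrow> real set \<Rightarrow> real" where
  "ball_prob p n T = measure (ball_law p n) {x \<in> space (leb_pow n). real n powr (2 / p - 1) * sq_sum n x \<in> T}"

lemma radial_window:
  assumes "0 < n" "0 < \<delta>" "\<delta> < 1" "u \<in> {real n * (1 - \<delta>) .. real n * (1 + \<delta>)}" "0 < p"
  shows "0 < u" "(1 - \<delta>) powr (2 / p) \<le> (u / real n) powr (2 / p)" "(u / real n) powr (2 / p) \<le> (1 + \<delta>) powr (2 / p)"
proof -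
  have "0 < real n * (1 - \<delta>)" using assms by simp
  then show "0 < u" using assms(4) by (meson atLeastAtMost_iff less_le_trans)
  show "(1 - \<delta>) powr (2 / p) \<le> (u / real n) powr (2 / p)" "(u / real n) powr (2 / p) \<le> (1 + \<delta>) powr (2 / p)"
    using assms \<open>0 < u\<close> by (auto intro!: powr_mono2 simp: field_simps)
qed

lemma eventually_radial_window_ge:
  assumes p: "0 < p" "p < 2" and \<delta>: "0 < \<delta>" "\<delta> < 1"
  shows "\<forall>\<^sub>F n in sequentially. 1 / 2 \<le> measure (radial_law p n) {real n * (1 - \<delta>) .. real n * (1 + \<delta>)}"
proof -
  have "\<forall>\<^sub>F n in sequentially. measure (radial_law p n) (- {real n * (1 - \<delta>) .. real n * (1 + \<delta>)}) < 1 / 2"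
    using radial_law_concentration[OF p, of \<delta>] p \<delta> by (intro exp_small_eventually_less[where \<alpha>="p / 2"]) auto
  then show ?thesis
  proof eventually_elim
    case (elim n)
    interpret R: prob_space "radial_law p n" by (rule prob_space_radial_law) fact
    show ?case using elim R.prob_compl[of "{real n * (1 - \<delta>) .. real n * (1 + \<delta>)}"] by (simp add: Compl_eq_Diff_UNIV)
  qed
qed

text \<open>
  The upper comparison on the window where \<open>T / n\<close> is within \<open>\<delta>\<close> of one; the
  window has probability at least one half, whence the factor \<open>2\<close>, here written as a sum.
\<close>
lemma ball_prob_eventually_le:
  assumes p: "0 < p" "p < 2" and \<delta>: "0 < \<delta>" "\<delta> < 1" and T: "T \<in> sets borel" and T': "\<And>n. T' n \<in> sets borel"
    and sub: "\<And>n w v. 0 < n \<Longrightarrow> (1 - \<delta>) powr (2 / p) \<le> w \<Longrightarrow> w \<le> (1 + \<delta>) powr (2 / p) \<Longrightarrow> v \<in> T \<Longrightarrow> 0 \<le> v \<Longrightarrow> real n * (w * v) \<in> T' n"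
  shows "\<forall>\<^sub>F n in sequentially. ball_prob p n T \<le>
    measure (gen_gauss_pow p n) {x \<in> space (gen_gauss_pow p n). sq_sum n x \<in> T' n} + measure (gen_gauss_pow p n) {x \<in> space (gen_gauss_pow p n). sq_sum n x \<in> T' n}"
  using eventually_radial_window_ge[OF p \<delta>] eventually_gt_at_top[of 0]
proof eventually_elim
  case (elim n)
  let ?U = "{real n * (1 - \<delta>) .. real n * (1 + \<delta>)}"
  note T [measurable] T' [measurable]
  have "ball_prob p n T * measure (radial_law p n) ?U \<le> measure (gen_gauss_pow p n) {x \<in> space (gen_gauss_pow p n). sq_sum n x \<in> T' n}"
    unfolding ball_prob_def
  proof (rule ball_law_radial_le[OF p(1)])
    show "{x \<in> space (leb_pow n). real n powr (2 / p - 1) * sq_sum n x \<in> T} \<in> sets (leb_pow n)" by measurable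
    have "{x \<in> space (gen_gauss_pow p n). sq_sum n x \<in> T' n} \<in> sets (gen_gauss_pow p n)" by measurable
    then show "{x \<in> space (gen_gauss_pow p n). sq_sum n x \<in> T' n} \<in> sets (leb_pow n)" by (simp only: sets_gen_gauss_pow_leb_pow)
    show "?U \<in> sets borel" by simp
    fix u x assume u: "u \<in> ?U" and x: "x \<in> {x \<in> space (leb_pow n). real n powr (2 / p - 1) * sq_sum n x \<in> T}"
    note w = radial_window[OF elim(2) \<delta> u p(1)]
    have "dilate n (u powr (1 / p)) x \<in> space (gen_gauss_pow p n)" by (simp add: space_gen_gauss_pow space_leb_pow dilate_def)
    moreover have "0 \<le> real n powr (2 / p - 1) * sq_sum n x" by (simp add: sq_sum_def sum_nonneg)
    ultimately show "dilate n (u powr (1 / p)) x \<in> {x \<in> space (gen_gauss_pow p n). sq_sum n x \<in> T' n}"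
      using sub[OF elim(2) w(2,3)] x by (simp add: sq_sum_dilate_scaled[OF p(1) elim(2) w(1)])
  qed
  moreover have "ball_prob p n T * (1 / 2) \<le> ball_prob p n T * measure (radial_law p n) ?U"
    using elim(1) by (intro mult_left_mono) (auto simp: ball_prob_def)
  ultimately show ?case by linarith
qed

text \<open>
  The tail of the product law at the slightly smaller level \<open>t (1 - \<delta>) powr (2 / p)\<close>; the rate is
  continuous in the level.
\<close>
lemma ball_prob_upper_tail:
  assumes p: "0 < p" "p < 2" and t: "m_const p < t" and q: "q < (1 / p) * (t - m_const p) powr (p / 2)"
  shows "\<forall>\<^sub>F n in sequentially. ball_prob p n {t..} \<le> exp (- q * real n powr (p / 2))"
proof -
  define Q where "Q \<delta> = (1 / p) * (t * (1 - \<delta>) powr (2 / p) - m_const p) powr (p / 2)" for \<delta>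
  have t0: "0 < t" using t m_const_pos[OF p(1)] by linarith
  have l1: "((\<lambda>\<delta>. t * (1 - \<delta>) powr (2 / p)) \<longlongrightarrow> t * (1 - 0) powr (2 / p)) (at_right 0)"
    by (intro tendsto_intros) auto
  have l2: "(Q \<longlongrightarrow> (1 / p) * (t * (1 - 0) powr (2 / p) - m_const p) powr (p / 2)) (at_right 0)"
    unfolding Q_def using t by (intro tendsto_intros l1) auto
  have "\<forall>\<^sub>F \<delta> in at_right 0. m_const p < t * (1 - \<delta>) powr (2 / p) \<and> q < Q \<delta>"
    using order_tendstoD(1)[OF l1, of "m_const p"] order_tendstoD(1)[OF l2, of q] t q by (simp add: eventually_conj_iff)
  then obtain \<delta> where \<delta>: "0 < \<delta>" "\<delta> < 1" "m_const p < t * (1 - \<delta>) powr (2 / p)" "q < Q \<delta>"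
    by (rule eventually_at_right_0_obtain) blast
  let ?t = "t * (1 - \<delta>) powr (2 / p)"
  let ?G = "\<lambda>n. measure (gen_gauss_pow p n) {x \<in> space (gen_gauss_pow p n). sq_sum n x \<in> {real n * ?t..}}"
  have "\<forall>\<^sub>F n in sequentially. ball_prob p n {t..} \<le> ?G n + ?G n"
  proof (rule ball_prob_eventually_le[OF p \<delta>(1,2)])
    fix n :: nat and w v :: real
    assume w: "(1 - \<delta>) powr (2 / p) \<le> w" and v: "v \<in> {t..}"
    have "t * (1 - \<delta>) powr (2 / p) \<le> v * w" using w v t0 by (intro mult_mono) auto
    then show "real n * (w * v) \<in> {real n * ?t..}" by (auto simp: mult.commute intro: mult_left_mono)
  qed auto
  moreover have "\<forall>\<^sub>F n in sequentially. ?G n + ?G n \<le> exp (- q * real n powr (p / 2))"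
    using gen_gauss_pow_square_sum_upper_tail[OF p \<delta>(3)] p \<delta>(4)
    by (intro eventually_add_le_exp[where Q="Q \<delta>"]) (auto simp: Q_def)
  ultimately show ?thesis by eventually_elim linarith
qed

lemma ball_prob_lower_tail:
  assumes p: "0 < p" "p < 2" and t: "0 \<le> t" "t < m_const p"
  shows "exp_small (p / 2) (\<lambda>n. ball_prob p n {..t})"
proof -
  have l1: "((\<lambda>\<delta>. t * (1 + \<delta>) powr (2 / p)) \<longlongrightarrow> t * (1 + 0) powr (2 / p)) (at_right 0)"
    by (intro tendsto_intros) auto
  have "\<forall>\<^sub>F \<delta> in at_right 0. t * (1 + \<delta>) powr (2 / p) < m_const p"
    using order_tendstoD(2)[OF l1, of "m_const p"] t by simp
  then obtain \<delta> where \<delta>: "0 < \<delta>" "\<delta> < 1" "t * (1 + \<delta>) powr (2 / p) < m_const p"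
    by (rule eventually_at_right_0_obtain) blast
  let ?t = "t * (1 + \<delta>) powr (2 / p)"
  let ?G = "\<lambda>n. measure (gen_gauss_pow p n) {x \<in> space (gen_gauss_pow p n). sq_sum n x \<in> {..real n * ?t}}"
  have "\<forall>\<^sub>F n in sequentially. ball_prob p n {..t} \<le> ?G n + ?G n"
  proof (rule ball_prob_eventually_le[OF p \<delta>(1,2)])
    fix n :: nat and w v :: real
    assume w: "w \<le> (1 + \<delta>) powr (2 / p)" "(1 - \<delta>) powr (2 / p) \<le> w" and v: "v \<in> {..t}" "0 \<le> v"
    have "0 \<le> w" using w(2) by (rule order_trans[rotated]) simp
    then have "v * w \<le> t * (1 + \<delta>) powr (2 / p)" using w v t by (intro mult_mono) auto
    then show "real n * (w * v) \<in> {..real n * ?t}" by (auto simp: mult.commute intro: mult_left_mono)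
  qed auto
  moreover have "exp_small (p / 2) (\<lambda>n. ?G n + ?G n)"
    using gen_gauss_pow_square_sum_lower_tail[OF p \<delta>(3)] p by (intro exp_small_add) auto
  ultimately show ?thesis by (rule exp_small_mono[rotated])
qed

lemma ball_prob_local_lower_bound:
  assumes p: "0 < p" "p < 2" and y: "0 \<le> a" "a < y" "y < b" "m_const p < y"
    and q: "(1 / p) * (y - m_const p) powr (p / 2) < q"
  shows "\<forall>\<^sub>F n in sequentially. exp (- q * real n powr (p / 2)) \<le> ball_prob p n {a<..<b}"
proof -
  have l1: "((\<lambda>\<delta>. a * (1 + \<delta>) powr (2 / p)) \<longlongrightarrow> a * (1 + 0) powr (2 / p)) (at_right 0)"
    by (intro tendsto_intros) auto
  have l2: "((\<lambda>\<delta>. b * (1 - \<delta>) powr (2 / p)) \<longlongrightarrow> b * (1 - 0) powr (2 / p)) (at_right 0)"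
    by (intro tendsto_intros) auto
  have "\<forall>\<^sub>F \<delta> in at_right 0. a * (1 + \<delta>) powr (2 / p) < y \<and> y < b * (1 - \<delta>) powr (2 / p)"
    using order_tendstoD(2)[OF l1, of y] order_tendstoD(1)[OF l2, of y] y by (simp add: eventually_conj_iff)
  then obtain \<delta> where \<delta>: "0 < \<delta>" "\<delta> < 1" "a * (1 + \<delta>) powr (2 / p) < y" "y < b * (1 - \<delta>) powr (2 / p)"
    by (rule eventually_at_right_0_obtain) blast
  let ?a = "a * (1 + \<delta>) powr (2 / p)" and ?b = "b * (1 - \<delta>) powr (2 / p)"
  let ?U = "\<lambda>n. {real n * (1 - \<delta>) .. real n * (1 + \<delta>)}"
  obtain r where r: "(1 / p) * (y - m_const p) powr (p / 2) < r" "r < q" using dense[OF q] by blast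
  have le: "measure (gen_gauss_pow p n) {x \<in> space (gen_gauss_pow p n). sq_sum n x \<in> {real n * ?a<..<real n * ?b}}
    \<le> ball_prob p n {a<..<b} + measure (radial_law p n) (- ?U n)" if n: "0 < n" for n
    unfolding ball_prob_def
  proof (rule gen_gauss_pow_le_ball_law_add[OF p(1)])
    show "{x \<in> space (leb_pow n). real n powr (2 / p - 1) * sq_sum n x \<in> {a<..<b}} \<in> sets (leb_pow n)" by measurable
    have "{x \<in> space (gen_gauss_pow p n). sq_sum n x \<in> {real n * ?a<..<real n * ?b}} \<in> sets (gen_gauss_pow p n)" by measurable
    then show "{x \<in> space (gen_gauss_pow p n). sq_sum n x \<in> {real n * ?a<..<real n * ?b}} \<in> sets (leb_pow n)" by (simp only: sets_gen_gauss_pow_leb_pow)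
    show "?U n \<in> sets borel" by simp
    fix u x assume u: "u \<in> ?U n" and x: "x \<in> space (leb_pow n)"
      and S: "dilate n (u powr (1 / p)) x \<in> {x \<in> space (gen_gauss_pow p n). sq_sum n x \<in> {real n * ?a<..<real n * ?b}}"
    note w = radial_window[OF n \<delta>(1,2) u p(1)]
    define W where "W = (u / real n) powr (2 / p)"
    define v where "v = real n powr (2 / p - 1) * sq_sum n x"
    have W0: "0 < W" using w(1) n by (simp add: W_def)
    have "real n * ?a < real n * (W * v)" "real n * (W * v) < real n * ?b"
      using S unfolding mem_Collect_eq sq_sum_dilate_scaled[OF p(1) n w(1)] W_def[symmetric] v_def[symmetric] by auto
    then have "?a < W * v" "W * v < ?b" using n by simp_all
    moreover have "a * W \<le> ?a" using w(3) y(1) unfolding W_def by (intro mult_left_mono)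
    moreover have "?b \<le> b * W" using w(2) y unfolding W_def by (intro mult_left_mono) auto
    ultimately have "a * W < v * W" "v * W < b * W" by (simp_all only: mult.commute[of v W])
    then have "a < v" "v < b" using W0 by simp_all
    then show "x \<in> {x \<in> space (leb_pow n). real n powr (2 / p - 1) * sq_sum n x \<in> {a<..<b}}"
      using x by (simp add: v_def)
  qed
  show ?thesis
  proof (rule eventually_exp_le_of_add[where q'=r])
    show "exp_small (p / 2) (\<lambda>n. measure (radial_law p n) (- ?U n))"
      using \<delta> by (intro radial_law_concentration p) auto
    show "\<forall>\<^sub>F n in sequentially. exp (- r * real n powr (p / 2)) \<le> ball_prob p n {a<..<b} + measure (radial_law p n) (- ?U n)"
      using gen_gauss_pow_square_sum_local_lower_bound[OF p \<delta>(3,4) y(4) r(1)] eventually_gt_at_top[of 0]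
      by eventually_elim (use le in \<open>blast intro: order_trans\<close>)
  qed (use r p in auto)
qed

section \<open>Orthonormal bases and projections\<close>

lemma inner_Rn_commute: "inner_Rn n x y = inner_Rn n y x"
  by (simp add: inner_Rn_def mult.commute)

lemma inner_Rn_add_left: "inner_Rn n (x + y) z = inner_Rn n x z + inner_Rn n y z"
  by (simp add: inner_Rn_def sum.distrib distrib_right)

lemma inner_Rn_diff_left: "inner_Rn n (x - y) z = inner_Rn n x z - inner_Rn n y z"
  by (simp add: inner_Rn_def sum_subtractf left_diff_distrib)

lemma inner_Rn_scaleR_left: "inner_Rn n (c *\<^sub>R x) z = c * inner_Rn n x z"
  by (simp add: inner_Rn_def sum_distrib_left scaleR_fun_def mult.assoc)

lemma inner_Rn_zero_left: "inner_Rn n 0 z = 0"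
  by (simp add: inner_Rn_def)

lemma inner_Rn_sum_left: "inner_Rn n (\<Sum>a\<in>A. f a) z = (\<Sum>a\<in>A. inner_Rn n (f a) z)"
  by (induction A rule: infinite_finite_induct) (simp_all only: sum.infinite sum.empty sum.insert inner_Rn_add_left inner_Rn_zero_left not_False_eq_True)

lemma inner_Rn_add_right: "inner_Rn n z (x + y) = inner_Rn n z x + inner_Rn n z y"
  by (simp add: inner_Rn_commute[of n z] inner_Rn_add_left)

lemma inner_Rn_diff_right: "inner_Rn n z (x - y) = inner_Rn n z x - inner_Rn n z y"
  by (simp add: inner_Rn_commute[of n z] inner_Rn_diff_left)

lemma inner_Rn_scaleR_right: "inner_Rn n z (c *\<^sub>R x) = c * inner_Rn n z x"
  by (simp add: inner_Rn_commute[of n z] inner_Rn_scaleR_left)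

lemma inner_Rn_sum_right: "inner_Rn n z (\<Sum>a\<in>A. f a) = (\<Sum>a\<in>A. inner_Rn n z (f a))"
  by (simp add: inner_Rn_commute[of n z] inner_Rn_sum_left)

lemmas inner_Rn_simps = inner_Rn_add_left inner_Rn_diff_left inner_Rn_scaleR_left inner_Rn_sum_left
  inner_Rn_add_right inner_Rn_diff_right inner_Rn_scaleR_right inner_Rn_sum_right

lemma inner_Rn_self: "inner_Rn n x x = sq_sum n x"
  by (simp add: inner_Rn_def sq_sum_def power2_eq_square)

lemma sq_sum_nonneg: "0 \<le> sq_sum n x"
  by (simp add: sq_sum_def sum_nonneg)

lemma sq_sum_eq_0_Rn: "x \<in> Rn n \<Longrightarrow> sq_sum n x = 0 \<longleftrightarrow> x = 0"
  by (auto simp: sq_sum_def sum_nonneg_eq_0_iff Rn_def fun_eq_iff not_less[symmetric])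

lemma subspace_Rn: "subspace (Rn n)"
  by (auto simp: subspace_def Rn_def scaleR_fun_def)

definition orthonormal :: "nat \<Rightarrow> (nat \<Rightarrow> real) set \<Rightarrow> bool" where
  "orthonormal n B \<longleftrightarrow> finite B \<and> B \<subseteq> Rn n \<and> (\<forall>b\<in>B. \<forall>c\<in>B. inner_Rn n b c = (if b = c then 1 else 0))"

lemma orthonormal_inner_sum:
  assumes "orthonormal n B" "b \<in> B"
  shows "inner_Rn n (\<Sum>c\<in>B. f c *\<^sub>R c) b = f b"
proof -
  have "inner_Rn n (\<Sum>c\<in>B. f c *\<^sub>R c) b = (\<Sum>c\<in>B. if c = b then f c else 0)"
    unfolding inner_Rn_sum_left inner_Rn_scaleR_left
    using assms by (intro sum.cong) (auto simp: orthonormal_def)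
  then show ?thesis using assms by (simp add: orthonormal_def)
qed

lemma orthonormal_span_expansion:
  assumes B: "orthonormal n B" and x: "x \<in> span B"
  shows "x = (\<Sum>b\<in>B. inner_Rn n x b *\<^sub>R b)"
proof -
  have "finite B" using B by (simp add: orthonormal_def)
  then obtain u where u: "x = (\<Sum>b\<in>B. u b *\<^sub>R b)" using x by (auto simp: span_finite)
  show ?thesis unfolding u by (intro sum.cong refl) (simp add: orthonormal_inner_sum[OF B])
qed

lemma orthonormal_independent:
  assumes B: "orthonormal n B"
  shows "independent B"
proof
  have fin: "finite B" using B by (simp add: orthonormal_def)
  assume "dependent B"
  then obtain u where u: "\<exists>v\<in>B. u v \<noteq> 0" "(\<Sum>v\<in>B. u v *\<^sub>R v) = 0"
    unfolding dependent_finite[OF fin] by blast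
  then show False using orthonormal_inner_sum[OF B, of _ u] by (auto simp: inner_Rn_zero_left)
qed

definition unit_vec :: "nat \<Rightarrow> nat \<Rightarrow> real" where
  "unit_vec j = (\<lambda>l. if l = j then 1 else 0)"

lemma orthonormal_unit_vecs: "orthonormal n (unit_vec ` {..<n})"
  unfolding orthonormal_def
proof (intro conjI ballI)
  show "unit_vec ` {..<n} \<subseteq> Rn n" by (auto simp: unit_vec_def Rn_def)
  fix b c assume "b \<in> unit_vec ` {..<n}" "c \<in> unit_vec ` {..<n}"
  then obtain i j where ij: "i < n" "j < n" "b = unit_vec i" "c = unit_vec j" by auto
  have "inner_Rn n b c = (\<Sum>l<n. if l = i then (if i = j then 1 else 0) else 0)"
    unfolding inner_Rn_def ij by (intro sum.cong) (auto simp: unit_vec_def)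
  also have "\<dots> = (if i = j then 1 else 0)" using ij by simp
  also have "i = j \<longleftrightarrow> b = c" unfolding ij by (auto simp: unit_vec_def fun_eq_iff split: if_splits)
  finally show "inner_Rn n b c = (if b = c then 1 else 0)" .
qed simp

lemma card_unit_vecs: "card (unit_vec ` {..<n}) = n"
proof -
  have "inj unit_vec" by (rule injI) (metis unit_vec_def zero_neq_one)
  then show ?thesis by (simp add: card_image inj_on_subset)
qed

lemma span_unit_vecs: "span (unit_vec ` {..<n}) = Rn n"
proof
  show "span (unit_vec ` {..<n}) \<subseteq> Rn n"
    using orthonormal_unit_vecs[of n] subspace_Rn by (intro span_minimal) (auto simp: orthonormal_def)
  show "Rn n \<subseteq> span (unit_vec ` {..<n})"
  proof
    fix x assume x: "x \<in> Rn n"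
    have "(\<Sum>j\<in>A. x j *\<^sub>R unit_vec j) i = (if i \<in> A then x i else 0)" if "finite A" for i and A :: "nat set"
      using that by (induction A) (auto simp: scaleR_fun_def unit_vec_def)
    then have "x = (\<Sum>j<n. x j *\<^sub>R unit_vec j)" using x by (auto simp: fun_eq_iff Rn_def)
    moreover have "(\<Sum>j<n. x j *\<^sub>R unit_vec j) \<in> span (unit_vec ` {..<n})"
      by (intro span_sum span_scale span_base) auto
    ultimately show "x \<in> span (unit_vec ` {..<n})" by simp
  qed
qed

lemma orthonormal_card_le:
  assumes "orthonormal n B"
  shows "card B \<le> n"
  using independent_span_bound[OF _ orthonormal_independent[OF assms], of "unit_vec ` {..<n}"] assms
  by (simp add: span_unit_vecs card_unit_vecs orthonormal_def)

lemma orthonormal_insert: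
  assumes B: "orthonormal n B" and E: "subspace E" "E \<subseteq> Rn n" "B \<subseteq> E" and x: "x \<in> E" "x \<notin> span B"
  obtains z where "z \<in> E" "z \<notin> B" "orthonormal n (insert z B)"
proof -
  define y where "y = x - (\<Sum>b\<in>B. inner_Rn n x b *\<^sub>R b)"
  have sumE: "(\<Sum>b\<in>B. inner_Rn n x b *\<^sub>R b) \<in> E"
    using E by (intro subspace_sum subspace_scale) auto
  have yE: "y \<in> E" unfolding y_def using sumE E x by (intro subspace_diff)
  have "y \<noteq> 0"
  proof
    assume "y = 0"
    then have "x = (\<Sum>b\<in>B. inner_Rn n x b *\<^sub>R b)" by (simp add: y_def)
    then have "x \<in> span B" by (metis (no_types, lifting) span_base span_scale span_sum)
    with x show False by simp
  qed
  then have y0: "0 < sq_sum n y" using sq_sum_eq_0_Rn[of y n] sq_sum_nonneg[of n y] yE E by force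
  have yb: "inner_Rn n y b = 0" if "b \<in> B" for b
    using orthonormal_inner_sum[OF B that, of "inner_Rn n x"] by (simp add: y_def inner_Rn_diff_left)
  define z where "z = (1 / sqrt (sq_sum n y)) *\<^sub>R y"
  have zE: "z \<in> E" unfolding z_def using yE E by (intro subspace_scale)
  have zb: "inner_Rn n z b = 0" if "b \<in> B" for b
    using yb[OF that] by (simp add: z_def inner_Rn_simps)
  have zz: "inner_Rn n z z = 1"
  proof -
    have "inner_Rn n z z = (1 / sqrt (sq_sum n y)) * ((1 / sqrt (sq_sum n y)) * sq_sum n y)"
      unfolding z_def by (subst inner_Rn_scaleR_left, subst inner_Rn_scaleR_right, simp only: inner_Rn_self)
    then show ?thesis using y0 by simp
  qed
  have "z \<notin> B" using zb zz by force
  moreover have "orthonormal n (insert z B)"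
    unfolding orthonormal_def
  proof (intro conjI ballI)
    show "finite (insert z B)" using B by (simp add: orthonormal_def)
    show "insert z B \<subseteq> Rn n" using zE E by auto
    fix b c assume "b \<in> insert z B" "c \<in> insert z B"
    moreover have "inner_Rn n b z = 0" if "b \<in> B" for b using zb[OF that] by (simp only: inner_Rn_commute)
    moreover have "inner_Rn n b c = (if b = c then 1 else 0)" if "b \<in> B" "c \<in> B" for b c
      using B that by (simp only: orthonormal_def)
    ultimately show "inner_Rn n b c = (if b = c then 1 else 0)"
      using zb zz \<open>z \<notin> B\<close> by (cases "b = z"; cases "c = z") auto
  qed
  ultimately show ?thesis using that zE by blast
qed

text \<open>
  The Gram--Schmidt step can be repeated at most \<open>n\<close> times, since orthonormal vectors in
  \<open>Rn n\<close> are independent.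
\<close>
lemma orthonormal_extend:
  assumes "orthonormal n B" and E: "subspace E" "E \<subseteq> Rn n" and "B \<subseteq> E"
  shows "\<exists>C. B \<subseteq> C \<and> orthonormal n C \<and> span C = E"
  using assms(1,4)
proof (induction "n - card B" arbitrary: B rule: less_induct)
  case less
  show ?case
  proof (cases "span B = E")
    case True then show ?thesis using less by blast
  next
    case False
    then obtain x where x: "x \<in> E" "x \<notin> span B"
      using span_minimal[OF less.prems(2) E(1)] by blast
    obtain z where z: "z \<in> E" "z \<notin> B" "orthonormal n (insert z B)"
      using orthonormal_insert[OF less.prems(1) E less.prems(2) x] .
    have "n - card (insert z B) < n - card B"
      using orthonormal_card_le[OF z(3)] z less.prems by (simp add: orthonormal_def)
    from less.hyps[OF this z(3)] show ?thesis using z less.prems by auto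
  qed
qed

text \<open>
  The basis of \<open>E\<close> is extended to one of \<open>Rn n\<close>, so that the orthogonal complement can be
  treated like a subspace of dimension \<open>n - k\<close>.
\<close>
lemma grassmannian_orthonormal_basis:
  assumes E: "E \<in> grassmannian n k"
  obtains B C where "orthonormal n B" "span B = E" "card B = k" "B \<subseteq> C" "orthonormal n C" "span C = Rn n" "card C = n"
proof -
  have sub: "subspace E" "E \<subseteq> Rn n" "dim E = k" using E by (auto simp: grassmannian_def)
  have "orthonormal n {}" by (simp add: orthonormal_def)
  from orthonormal_extend[OF this sub(1,2)] obtain B where B: "orthonormal n B" "span B = E" by auto
  have "B \<subseteq> Rn n" using B by (simp add: orthonormal_def)
  from orthonormal_extend[OF B(1) subspace_Rn order_refl this] obtain C where
    C: "B \<subseteq> C" "orthonormal n C" "span C = Rn n" by auto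
  have "card B = k" using dim_span_eq_card_independent[OF orthonormal_independent[OF B(1)]] B(2) sub by simp
  moreover have "card C = n"
    using dim_span_eq_card_independent[OF orthonormal_independent[OF C(2)]] C(3)
      dim_span_eq_card_independent[OF orthonormal_independent[OF orthonormal_unit_vecs[of n]]]
    by (simp add: span_unit_vecs card_unit_vecs)
  ultimately show ?thesis using that B C by blast
qed

lemma proj_onto_orthonormal:
  assumes B: "orthonormal n B"
  shows "proj_onto n (span B) x = (\<Sum>b\<in>B. inner_Rn n x b *\<^sub>R b)"
  unfolding proj_onto_def
proof (rule the_equality)
  let ?y = "\<Sum>b\<in>B. inner_Rn n x b *\<^sub>R b"
  have yB: "?y \<in> span B" by (intro span_sum span_scale span_base)
  have sub: "span B \<subseteq> Rn n" using B subspace_Rn by (intro span_minimal) (auto simp: orthonormal_def)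
  have orth: "inner_Rn n (x - ?y) z = 0" if z: "z \<in> span B" for z
  proof -
    have "inner_Rn n (x - ?y) b = 0" if "b \<in> B" for b
      using orthonormal_inner_sum[OF B that, of "inner_Rn n x"] by (simp add: inner_Rn_diff_left)
    then have "(\<Sum>b\<in>B. inner_Rn n z b * inner_Rn n (x - ?y) b) = 0" by simp
    moreover have "inner_Rn n (x - ?y) z = (\<Sum>b\<in>B. inner_Rn n z b * inner_Rn n (x - ?y) b)"
      by (subst orthonormal_span_expansion[OF B z]) (simp only: inner_Rn_sum_right inner_Rn_scaleR_right)
    ultimately show ?thesis by simp
  qed
  show "?y \<in> span B \<and> (\<forall>z\<in>span B. inner_Rn n (x - ?y) z = 0)" using yB orth by blast
  fix y assume y: "y \<in> span B \<and> (\<forall>z\<in>span B. inner_Rn n (x - y) z = 0)"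
  have d: "y - ?y \<in> span B" using y yB by (intro span_diff) auto
  have "inner_Rn n (y - ?y) (y - ?y) = inner_Rn n (x - ?y) (y - ?y) - inner_Rn n (x - y) (y - ?y)"
    by (simp add: inner_Rn_diff_left)
  also have "\<dots> = 0" using orth[OF d] y d by auto
  finally have "y - ?y = 0" using sq_sum_eq_0_Rn[of "y - ?y" n] d sub by (auto simp: inner_Rn_self)
  then show "y = ?y" by simp
qed

text \<open>
  The squared length of the projection, as a quadratic form in the projection matrix: in this
  form it is visibly measurable in the subspace and in the vector together.
\<close>
definition proj_sq :: "nat \<Rightarrow> (nat \<Rightarrow> real) set \<Rightarrow> (nat \<Rightarrow> real) \<Rightarrow> real" where
  "proj_sq n E x = (\<Sum>i<n. \<Sum>j<n. x i * x j * proj_matrix n E (i, j))"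

lemma orthonormal_sq_sum:
  assumes B: "orthonormal n B"
  shows "sq_sum n (\<Sum>b\<in>B. f b *\<^sub>R b) = (\<Sum>b\<in>B. (f b)\<^sup>2)"
proof -
  have "sq_sum n (\<Sum>b\<in>B. f b *\<^sub>R b) = (\<Sum>b\<in>B. f b * inner_Rn n (\<Sum>b\<in>B. f b *\<^sub>R b) b)"
    unfolding inner_Rn_self[symmetric] by (subst inner_Rn_sum_right) (simp only: inner_Rn_scaleR_right)
  then show ?thesis by (simp add: orthonormal_inner_sum[OF B] power2_eq_square)
qed

lemma proj_sq_orthonormal:
  assumes B: "orthonormal n B"
  shows "proj_sq n (span B) x = (\<Sum>b\<in>B. (inner_Rn n x b)\<^sup>2)"
proof -
  have fin: "finite B" using B by (simp add: orthonormal_def)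
  have sumapp: "(\<Sum>b\<in>A. f b *\<^sub>R b) i = (\<Sum>b\<in>A. f b * b i)" if "finite A" for A :: "(nat \<Rightarrow> real) set" and f i
    using that by (induction A) (auto simp: scaleR_fun_def)
  have entry: "proj_matrix n (span B) (i, j) = (\<Sum>b\<in>B. b i * b j)" if "j < n" for i j
  proof -
    have "inner_Rn n (unit_vec j) b = b j" for b
    proof -
      have "inner_Rn n (unit_vec j) b = (\<Sum>l<n. if l = j then b j else 0)"
        unfolding inner_Rn_def by (intro sum.cong) (auto simp: unit_vec_def)
      then show ?thesis using that by simp
    qed
    then show ?thesis
      unfolding proj_matrix_def unit_vec_def[symmetric] prod.case proj_onto_orthonormal[OF B] sumapp[OF fin]
      by (simp add: mult.commute)
  qed
  have "proj_sq n (span B) x = (\<Sum>i<n. \<Sum>j<n. \<Sum>b\<in>B. (x i * b i) * (x j * b j))"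
    unfolding proj_sq_def
  proof (intro sum.cong refl)
    fix i j assume "j \<in> {..<n}"
    then have "x i * x j * proj_matrix n (span B) (i, j) = (\<Sum>b\<in>B. x i * x j * (b i * b j))"
      by (simp only: entry lessThan_iff sum_distrib_left)
    also have "\<dots> = (\<Sum>b\<in>B. (x i * b i) * (x j * b j))"
      by (intro sum.cong refl) (simp only: mult_ac)
    finally show "x i * x j * proj_matrix n (span B) (i, j) = (\<Sum>b\<in>B. (x i * b i) * (x j * b j))" .
  qed
  also have "\<dots> = (\<Sum>i<n. \<Sum>b\<in>B. \<Sum>j<n. (x i * b i) * (x j * b j))"
    by (intro sum.cong refl) (rule sum.swap)
  also have "\<dots> = (\<Sum>b\<in>B. \<Sum>i<n. \<Sum>j<n. (x i * b i) * (x j * b j))"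
    by (rule sum.swap)
  also have "\<dots> = (\<Sum>b\<in>B. (inner_Rn n x b)\<^sup>2)"
    by (simp add: inner_Rn_def power2_eq_square sum_product)
  finally show ?thesis .
qed

lemma proj_sq_eq_sq_sum:
  assumes "E \<in> grassmannian n k"
  shows "proj_sq n E x = sq_sum n (proj_onto n E x)"
proof -
  obtain B where B: "orthonormal n B" "span B = E" using grassmannian_orthonormal_basis[OF assms] by metis
  show ?thesis unfolding B(2)[symmetric] proj_sq_orthonormal[OF B(1)] proj_onto_orthonormal[OF B(1)] orthonormal_sq_sum[OF B(1)] ..
qed

lemma lp_norm_2: "lp_norm 2 n x = sqrt (sq_sum n x)"
  by (simp add: lp_norm_def sq_sum_def powr_half_sqrt sum_nonneg)

section \<open>Projections of Gaussian vectors\<close>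

definition gauss :: "real measure" where
  "gauss = density lborel (\<lambda>x. ennreal (std_normal_density x))"

lemma sets_gauss [simp, measurable_cong]: "sets gauss = sets borel"
  by (simp add: gauss_def)

lemma space_gauss [simp]: "space gauss = UNIV"
  by (simp add: gauss_def)

lemma prob_space_gauss: "prob_space gauss"
  unfolding gauss_def by (rule prob_space_normal_density) simp

lemma nn_integral_normal_density:
  assumes "0 < \<sigma>"
  shows "(\<integral>\<^sup>+x. ennreal (normal_density \<mu> \<sigma> x) \<partial>lborel) = 1"
proof -
  interpret prob_space "density lborel (\<lambda>x. ennreal (normal_density \<mu> \<sigma> x))"
    using assms by (rule prob_space_normal_density)
  show ?thesis using emeasure_space_1 by (simp add: emeasure_density)
qed

lemma gauss_exp_moment: "(\<integral>\<^sup>+x. ennreal (exp (s * x)) \<partial>gauss) = ennreal (exp (s\<^sup>2 / 2))"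
proof -
  have "std_normal_density x * exp (s * x) = exp (s\<^sup>2 / 2) * normal_density s 1 x" for x
  proof -
    have "- x\<^sup>2 / 2 + s * x = s\<^sup>2 / 2 + - (x - s)\<^sup>2 / (2 * 1\<^sup>2)" by (simp add: power2_eq_square field_simps)
    then have "exp (- x\<^sup>2 / 2) * exp (s * x) = exp (s\<^sup>2 / 2) * exp (- (x - s)\<^sup>2 / (2 * 1\<^sup>2))" by (simp only: exp_add[symmetric])
    then show ?thesis by (simp add: std_normal_density_def normal_density_def)
  qed
  then have "(\<integral>\<^sup>+x. ennreal (exp (s * x)) \<partial>gauss) = (\<integral>\<^sup>+x. ennreal (exp (s\<^sup>2 / 2)) * ennreal (normal_density s 1 x) \<partial>lborel)"
    unfolding gauss_def by (subst nn_integral_density) (simp_all add: ennreal_mult'[symmetric] ennreal_mult''[symmetric])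
  also have "\<dots> = ennreal (exp (s\<^sup>2 / 2))" by (simp add: nn_integral_cmult nn_integral_normal_density)
  finally show ?thesis .
qed

lemma gauss_exp_square_moment:
  assumes "t < 1 / 2"
  shows "(\<integral>\<^sup>+x. ennreal (exp (t * x\<^sup>2)) \<partial>gauss) = ennreal ((1 - 2 * t) powr (- (1 / 2)))"
proof -
  define a where "a = 1 - 2 * t"
  have a: "0 < a" using assms by (simp add: a_def)
  have "std_normal_density x * exp (t * x\<^sup>2) = a powr (- (1 / 2)) * normal_density 0 (1 / sqrt a) x" for x
  proof -
    have "- x\<^sup>2 / 2 + t * x\<^sup>2 = - (x - 0)\<^sup>2 / (2 * (1 / sqrt a)\<^sup>2)"
      using a by (simp add: power_divide a_def field_simps)
    then have "exp (- x\<^sup>2 / 2) * exp (t * x\<^sup>2) = exp (- (x - 0)\<^sup>2 / (2 * (1 / sqrt a)\<^sup>2))" by (simp only: exp_add[symmetric])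
    moreover have "a powr (- (1 / 2)) = 1 / sqrt a" using a by (simp add: powr_minus powr_half_sqrt divide_simps)
    moreover have "sqrt (2 * pi * (1 / sqrt a)\<^sup>2) = sqrt (2 * pi) / sqrt a" using a by (simp add: power_divide real_sqrt_divide)
    ultimately show ?thesis using a unfolding std_normal_density_def normal_density_def by simp
  qed
  then have "(\<integral>\<^sup>+x. ennreal (exp (t * x\<^sup>2)) \<partial>gauss) = (\<integral>\<^sup>+x. ennreal (a powr (- (1 / 2))) * ennreal (normal_density 0 (1 / sqrt a) x) \<partial>lborel)"
    unfolding gauss_def by (subst nn_integral_density) (simp_all add: ennreal_mult'[symmetric] ennreal_mult''[symmetric])
  also have "\<dots> = ennreal (a powr (- (1 / 2)))" using a by (simp add: nn_integral_cmult nn_integral_normal_density)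
  finally show ?thesis by (simp only: a_def)
qed

definition gauss_pow :: "nat \<Rightarrow> (nat \<Rightarrow> real) measure" where
  "gauss_pow n = (\<Pi>\<^sub>M i\<in>{..<n}. gauss)"

lemma sets_gauss_pow [measurable_cong]: "sets (gauss_pow n) = sets (\<Pi>\<^sub>M i\<in>{..<n}. borel)"
  unfolding gauss_pow_def by (rule sets_PiM_cong) auto

lemma prob_space_gauss_pow: "prob_space (gauss_pow n)"
  unfolding gauss_pow_def by (intro prob_space_PiM prob_space_gauss)

lemma measurable_inner_Rn [measurable]: "(\<lambda>x. inner_Rn n x b) \<in> borel_measurable (\<Pi>\<^sub>M i\<in>{..<n}. borel)"
  unfolding inner_Rn_def by measurable

lemma powr_neg_half_power: "0 < (a::real) \<Longrightarrow> (a powr (- (1 / 2))) ^ j = a powr (- (real j / 2))"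
  by (simp add: powr_realpow[symmetric] powr_powr)

text \<open>
  The squared length of the projection of a standard Gaussian vector has a chi-square moment
  generating function. Instead of rotating the subspace into coordinate position, each factor
  \<open>exp (t a\<^sup>2)\<close> is written as the Gaussian average of \<open>exp (sqrt (2 t) a h)\<close>. The
  exponent becomes linear in the vector, whose coordinates can then be integrated out one by one;
  orthonormality turns the result back into a product over the auxiliary variables.
\<close>
lemma gauss_pow_exp_projection:
  assumes C: "orthonormal n C" and t: "0 \<le> t" "t < 1 / 2"
  shows "(\<integral>\<^sup>+x. ennreal (exp (t * (\<Sum>c\<in>C. (inner_Rn n x c)\<^sup>2))) \<partial>gauss_pow n)
    = ennreal ((1 - 2 * t) powr (- (real (card C) / 2)))"
proof -
  interpret G: prob_space gauss by (rule prob_space_gauss)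
  interpret P: product_sigma_finite "\<lambda>_::nat. gauss" ..
  interpret Q: product_sigma_finite "\<lambda>_::nat \<Rightarrow> real. gauss" ..
  have fin: "finite C" using C by (simp add: orthonormal_def)
  define H where "H = (\<Pi>\<^sub>M c\<in>C. gauss)"
  interpret GP: prob_space "gauss_pow n" by (rule prob_space_gauss_pow)
  interpret HP: prob_space H unfolding H_def by (intro prob_space_PiM prob_space_gauss)
  interpret PP: pair_sigma_finite "gauss_pow n" H ..
  have sH [measurable_cong]: "sets H = sets (\<Pi>\<^sub>M c\<in>C. borel)" unfolding H_def by (rule sets_PiM_cong) auto
  define s where "s = sqrt (2 * t)"
  have s2: "s\<^sup>2 / 2 = t" using t by (simp add: s_def)
  \<comment> \<open>The exponent as a linear form in \<open>x\<close>.\<close>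
  have lin: "(\<Sum>c\<in>C. s * inner_Rn n x c * h c) = (\<Sum>i<n. s * (\<Sum>c\<in>C. h c *\<^sub>R c) i * x i)" for x h
  proof -
    have "(\<Sum>c\<in>C. s * inner_Rn n x c * h c) = s * inner_Rn n x (\<Sum>c\<in>C. h c *\<^sub>R c)"
      unfolding inner_Rn_sum_right inner_Rn_scaleR_right sum_distrib_left by (intro sum.cong refl) simp
    also have "\<dots> = (\<Sum>i<n. s * (\<Sum>c\<in>C. h c *\<^sub>R c) i * x i)"
      unfolding inner_Rn_def sum_distrib_left by (intro sum.cong refl) simp
    finally show ?thesis .
  qed
  have "(\<integral>\<^sup>+x. ennreal (exp (t * (\<Sum>c\<in>C. (inner_Rn n x c)\<^sup>2))) \<partial>gauss_pow n)
    = (\<integral>\<^sup>+x. (\<integral>\<^sup>+h. ennreal (exp (\<Sum>c\<in>C. s * inner_Rn n x c * h c)) \<partial>H) \<partial>gauss_pow n)"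
  proof (rule nn_integral_cong)
    fix x
    have "(\<integral>\<^sup>+h. ennreal (exp (\<Sum>c\<in>C. s * inner_Rn n x c * h c)) \<partial>H)
      = (\<integral>\<^sup>+h. (\<Prod>c\<in>C. ennreal (exp (s * inner_Rn n x c * h c))) \<partial>H)"
      by (intro nn_integral_cong) (simp only: exp_sum[OF fin] prod_ennreal exp_ge_zero)
    also have "\<dots> = (\<Prod>c\<in>C. \<integral>\<^sup>+z. ennreal (exp (s * inner_Rn n x c * z)) \<partial>gauss)"
      unfolding H_def using fin by (intro Q.product_nn_integral_prod) auto
    also have "\<dots> = (\<Prod>c\<in>C. ennreal (exp (t * (inner_Rn n x c)\<^sup>2)))"
      unfolding gauss_exp_moment power_mult_distrib
      by (intro prod.cong refl arg_cong[where f=ennreal] arg_cong[where f=exp]) (use s2 in simp)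
    also have "\<dots> = ennreal (exp (t * (\<Sum>c\<in>C. (inner_Rn n x c)\<^sup>2)))"
      by (simp only: sum_distrib_left exp_sum[OF fin] prod_ennreal exp_ge_zero)
    finally show "ennreal (exp (t * (\<Sum>c\<in>C. (inner_Rn n x c)\<^sup>2)))
      = (\<integral>\<^sup>+h. ennreal (exp (\<Sum>c\<in>C. s * inner_Rn n x c * h c)) \<partial>H)" by simp
  qed
  also have "\<dots> = (\<integral>\<^sup>+h. (\<integral>\<^sup>+x. ennreal (exp (\<Sum>c\<in>C. s * inner_Rn n x c * h c)) \<partial>gauss_pow n) \<partial>H)"
  proof (rule PP.Fubini'[symmetric])
    have [measurable]: "(\<lambda>z. snd z c) \<in> borel_measurable (gauss_pow n \<Otimes>\<^sub>M H)" if "c \<in> C" for c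
      using that unfolding H_def by measurable
    have [measurable]: "(\<lambda>z. inner_Rn n (fst z) c) \<in> borel_measurable (gauss_pow n \<Otimes>\<^sub>M H)" for c
      by measurable
    show "(\<lambda>(x, h). ennreal (exp (\<Sum>c\<in>C. s * inner_Rn n x c * h c))) \<in> borel_measurable (gauss_pow n \<Otimes>\<^sub>M H)"
      unfolding case_prod_beta' by measurable
  qed
  also have "\<dots> = (\<integral>\<^sup>+h. (\<Prod>c\<in>C. ennreal (exp (t * (h c)\<^sup>2))) \<partial>H)"
  proof (rule nn_integral_cong)
    fix h
    let ?v = "\<Sum>c\<in>C. h c *\<^sub>R c"
    have "(\<integral>\<^sup>+x. ennreal (exp (\<Sum>c\<in>C. s * inner_Rn n x c * h c)) \<partial>gauss_pow n)
      = (\<integral>\<^sup>+x. (\<Prod>i<n. ennreal (exp (s * ?v i * x i))) \<partial>gauss_pow n)"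
      unfolding lin by (intro nn_integral_cong) (simp only: exp_sum[OF finite_lessThan] prod_ennreal exp_ge_zero)
    also have "\<dots> = (\<Prod>i<n. \<integral>\<^sup>+z. ennreal (exp (s * ?v i * z)) \<partial>gauss)"
      unfolding gauss_pow_def by (intro P.product_nn_integral_prod) auto
    also have "\<dots> = (\<Prod>i<n. ennreal (exp (t * (?v i)\<^sup>2)))"
      unfolding gauss_exp_moment power_mult_distrib
      by (intro prod.cong refl arg_cong[where f=ennreal] arg_cong[where f=exp]) (use s2 in simp)
    also have "\<dots> = ennreal (exp (t * sq_sum n ?v))"
      by (simp only: sq_sum_def sum_distrib_left exp_sum[OF finite_lessThan] prod_ennreal exp_ge_zero)
    also have "\<dots> = (\<Prod>c\<in>C. ennreal (exp (t * (h c)\<^sup>2)))"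
      by (simp only: orthonormal_sq_sum[OF C] sum_distrib_left exp_sum[OF fin] prod_ennreal exp_ge_zero)
    finally show "(\<integral>\<^sup>+x. ennreal (exp (\<Sum>c\<in>C. s * inner_Rn n x c * h c)) \<partial>gauss_pow n) = (\<Prod>c\<in>C. ennreal (exp (t * (h c)\<^sup>2)))" .
  qed
  also have "\<dots> = (\<Prod>c\<in>C. \<integral>\<^sup>+z. ennreal (exp (t * z\<^sup>2)) \<partial>gauss)"
    unfolding H_def using fin by (intro Q.product_nn_integral_prod) auto
  also have "\<dots> = ennreal ((1 - 2 * t) powr (- (real (card C) / 2)))"
    unfolding gauss_exp_square_moment[OF t(2)] using t by (simp add: ennreal_power powr_neg_half_power)
  finally show ?thesis .
qed

lemma gauss_pow_exp_sq_sum: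
  assumes t: "t < 1 / 2"
  shows "(\<integral>\<^sup>+x. ennreal (exp (t * sq_sum n x)) \<partial>gauss_pow n) = ennreal ((1 - 2 * t) powr (- (real n / 2)))"
proof -
  interpret G: prob_space gauss by (rule prob_space_gauss)
  interpret P: product_sigma_finite "\<lambda>_::nat. gauss" ..
  have "(\<integral>\<^sup>+x. ennreal (exp (t * sq_sum n x)) \<partial>gauss_pow n) = (\<integral>\<^sup>+x. (\<Prod>i<n. ennreal (exp (t * (x i)\<^sup>2))) \<partial>gauss_pow n)"
    by (intro nn_integral_cong) (simp only: sq_sum_def sum_distrib_left exp_sum[OF finite_lessThan] prod_ennreal exp_ge_zero)
  also have "\<dots> = (\<Prod>i<n. \<integral>\<^sup>+z. ennreal (exp (t * z\<^sup>2)) \<partial>gauss)"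
    unfolding gauss_pow_def by (intro P.product_nn_integral_prod) auto
  also have "\<dots> = ennreal ((1 - 2 * t) powr (- (real n / 2)))"
    unfolding gauss_exp_square_moment[OF t] using t by (simp add: ennreal_power powr_neg_half_power)
  finally show ?thesis .
qed

text \<open>
  If the ratio of the two chi-square variables exceeds \<open>card C / n\<close> by \<open>\<epsilon>\<close>, then the numerator is
  too large or the denominator is too small by \<open>\<delta> * n\<close> with \<open>\<delta> = \<epsilon> / 3\<close>; each case has a Chernoff
  bound with exponent \<open>\<delta> / 8\<close>.
\<close>
lemma gauss_pow_projection_tail:
  assumes C: "orthonormal n C" and \<epsilon>: "0 < \<epsilon>" "\<epsilon> \<le> 1"
  shows "measure (gauss_pow n) {x \<in> space (gauss_pow n). (real (card C) / real n + \<epsilon>) * sq_sum n x \<le> (\<Sum>c\<in>C. (inner_Rn n x c)\<^sup>2)}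
    \<le> 2 * exp (- (\<epsilon>\<^sup>2 / 144) * real n)"
proof (cases "n = 0")
  case True
  interpret GP: prob_space "gauss_pow n" by (rule prob_space_gauss_pow)
  show ?thesis by (rule order_trans[OF GP.prob_le_1]) (simp add: True)
next
  case False
  then have n: "0 < real n" by simp
  interpret GP: prob_space "gauss_pow n" by (rule prob_space_gauss_pow)
  let ?j = "real (card C)"
  have j: "?j \<le> real n" using orthonormal_card_le[OF C] by simp
  define \<delta> where "\<delta> = \<epsilon> / 3"
  have \<delta>: "0 < \<delta>" "\<delta> \<le> 1 / 3" "\<epsilon> = 3 * \<delta>" using \<epsilon> by (auto simp: \<delta>_def)
  let ?q = "\<lambda>x. \<Sum>c\<in>C. (inner_Rn n x c)\<^sup>2"
  let ?U = "{x \<in> space (gauss_pow n). ?j + \<delta> * real n \<le> ?q x}"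
  let ?L = "{x \<in> space (gauss_pow n). sq_sum n x \<le> (1 - \<delta>) * real n}"
  let ?t = "\<delta> / 8"
  have meas [measurable]: "(\<lambda>x. ?q x) \<in> borel_measurable (gauss_pow n)" by measurable
  have UM: "?U \<in> sets (gauss_pow n)" and LM: "?L \<in> sets (gauss_pow n)" by measurable
  have U: "measure (gauss_pow n) ?U \<le> exp (- (\<epsilon>\<^sup>2 / 144) * real n)"
  proof -
    have "emeasure (gauss_pow n) ?U \<le> ennreal (exp (- (?t * (?j + \<delta> * real n)))) * (\<integral>\<^sup>+x. ennreal (exp (?t * ?q x)) \<partial>gauss_pow n)"
      using \<delta> by (intro emeasure_le_exp_nn_integral[OF UM]) (auto intro!: ennreal_leI mult_left_mono divide_right_mono)
    also have "\<dots> = ennreal (exp (- (?t * (?j + \<delta> * real n))) * (1 - 2 * ?t) powr (- (?j / 2)))"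
      using \<delta> by (subst gauss_pow_exp_projection[OF C]) (auto simp: ennreal_mult)
    also have "\<dots> \<le> ennreal (exp (- (?t * (?j + \<delta> * real n))) * exp (?j / 2 * (2 * ?t + 2 * (2 * ?t)\<^sup>2)))"
      using \<delta> by (intro ennreal_leI mult_left_mono one_minus_powr_neg_le) auto
    also have "exp (- (?t * (?j + \<delta> * real n))) * exp (?j / 2 * (2 * ?t + 2 * (2 * ?t)\<^sup>2)) = exp (- \<delta>\<^sup>2 / 8 * real n + \<delta>\<^sup>2 / 16 * ?j)"
      by (simp add: exp_add[symmetric] power2_eq_square field_simps)
    also have "ennreal (exp (- \<delta>\<^sup>2 / 8 * real n + \<delta>\<^sup>2 / 16 * ?j)) \<le> ennreal (exp (- \<delta>\<^sup>2 / 8 * real n + \<delta>\<^sup>2 / 16 * real n))"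
      unfolding ennreal_le_iff[OF exp_ge_zero] exp_le_cancel_iff by (intro add_left_mono mult_left_mono j) simp
    also have "- \<delta>\<^sup>2 / 8 * real n + \<delta>\<^sup>2 / 16 * real n = - (\<epsilon>\<^sup>2 / 144) * real n"
      unfolding \<delta>(3) by (simp add: power2_eq_square field_simps)
    finally show ?thesis by (simp add: GP.emeasure_eq_measure)
  qed
  have L: "measure (gauss_pow n) ?L \<le> exp (- (\<epsilon>\<^sup>2 / 144) * real n)"
  proof -
    have "emeasure (gauss_pow n) ?L \<le> ennreal (exp (- (- ?t * ((1 - \<delta>) * real n)))) * (\<integral>\<^sup>+x. ennreal (exp (- ?t * sq_sum n x)) \<partial>gauss_pow n)"
      using \<delta> by (intro emeasure_le_exp_nn_integral[OF LM]) (auto intro!: ennreal_leI mult_left_mono divide_right_mono)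
    also have "\<dots> = ennreal (exp (- (- ?t * ((1 - \<delta>) * real n))) * (1 - 2 * - ?t) powr (- (real n / 2)))"
      using \<delta> by (subst gauss_pow_exp_sq_sum) (auto simp: ennreal_mult)
    also have "\<dots> \<le> ennreal (exp (- (- ?t * ((1 - \<delta>) * real n))) * exp (real n / 2 * (2 * - ?t + 2 * (2 * - ?t)\<^sup>2)))"
      using \<delta> by (intro ennreal_leI mult_left_mono one_minus_powr_neg_le) auto
    also have "exp (- (- ?t * ((1 - \<delta>) * real n))) * exp (real n / 2 * (2 * - ?t + 2 * (2 * - ?t)\<^sup>2)) = exp (- (\<epsilon>\<^sup>2 / 144) * real n)"
      unfolding \<delta>(3) by (simp add: exp_add[symmetric] power2_eq_square field_simps)
    finally show ?thesis by (simp add: GP.emeasure_eq_measure)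
  qed
  have sub: "{x \<in> space (gauss_pow n). (?j / real n + \<epsilon>) * sq_sum n x \<le> ?q x} \<subseteq> ?U \<union> ?L"
  proof
    fix x assume x: "x \<in> {x \<in> space (gauss_pow n). (?j / real n + \<epsilon>) * sq_sum n x \<le> ?q x}"
    show "x \<in> ?U \<union> ?L"
    proof (cases "sq_sum n x \<le> (1 - \<delta>) * real n")
      case False
      have "\<delta> * real n + \<delta> * ?j + \<delta> * \<epsilon> * real n \<le> \<epsilon> * real n"
      proof -
        have "\<delta> * ?j \<le> \<delta> * real n" "\<delta> * \<epsilon> * real n \<le> \<delta> * 1 * real n"
          using \<delta>(1) \<epsilon>(2) j by (intro mult_left_mono mult_right_mono; simp)+
        moreover have "\<epsilon> * real n = 3 * (\<delta> * real n)" unfolding \<delta>(3) by simp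
        ultimately show ?thesis by linarith
      qed
      note key = this
      have "?j + \<delta> * real n \<le> (?j / real n + \<epsilon>) * ((1 - \<delta>) * real n)"
      proof -
        have "(?j / real n + \<epsilon>) * ((1 - \<delta>) * real n) = (?j + \<epsilon> * real n) * (1 - \<delta>)" using n by (simp add: distrib_right)
        then show ?thesis using key by (simp add: algebra_simps)
      qed
      also have "\<dots> \<le> (?j / real n + \<epsilon>) * sq_sum n x" using False \<epsilon>(1) by (intro mult_left_mono) simp_all
      finally show ?thesis using x by auto
    qed (use x in auto)
  qed
  have "measure (gauss_pow n) {x \<in> space (gauss_pow n). (?j / real n + \<epsilon>) * sq_sum n x \<le> ?q x} \<le> measure (gauss_pow n) (?U \<union> ?L)"
    by (rule GP.finite_measure_mono[OF sub]) (use UM LM in auto)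
  also have "\<dots> \<le> measure (gauss_pow n) ?U + measure (gauss_pow n) ?L" using UM LM by (rule measure_Un_le)
  also have "\<dots> \<le> 2 * exp (- (\<epsilon>\<^sup>2 / 144) * real n)" using U L by simp
  finally show ?thesis .
qed

section \<open>Projections onto Haar-distributed subspaces\<close>

lemma space_grassmannian_borel: "space (grassmannian_borel n k) = grassmannian n k"
  unfolding grassmannian_borel_def by (simp add: space_measure_of_conv)

lemma proj_matrix_measurable: "proj_matrix n \<in> measurable (grassmannian_borel n k) borel"
proof (rule borel_measurableI)
  fix S :: "(nat \<times> nat \<Rightarrow> real) set" assume "open S"
  then have "openin (grassmannian_topology n k) (proj_matrix n -` S \<inter> grassmannian n k)"
    unfolding grassmannian_topology_def openin_pullback_topology by (metis open_openin)
  moreover have "{U. openin (grassmannian_topology n k) U} \<subseteq> Pow (grassmannian n k)"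
    unfolding grassmannian_topology_def openin_pullback_topology by auto
  ultimately have "proj_matrix n -` S \<inter> grassmannian n k \<in> sets (grassmannian_borel n k)"
    unfolding grassmannian_borel_def by (simp add: sigma_sets.Basic)
  then show "proj_matrix n -` S \<inter> space (grassmannian_borel n k) \<in> sets (grassmannian_borel n k)"
    by (simp only: space_grassmannian_borel)
qed

lemma measurable_proj_sq:
  assumes f: "f \<in> measurable N (grassmannian_borel n k)" and g: "\<And>i. i < n \<Longrightarrow> (\<lambda>w. g w i) \<in> borel_measurable N"
  shows "(\<lambda>w. proj_sq n (f w) (g w)) \<in> borel_measurable N"
proof -
  have [measurable]: "(\<lambda>w. proj_matrix n (f w) z) \<in> borel_measurable N" for z
    by (rule measurable_compose[OF measurable_compose[OF f proj_matrix_measurable] measurable_product_coordinates])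
  have "(\<lambda>w. g w i) \<in> borel_measurable N" if "i \<in> {..<n}" for i using that g by simp
  then show ?thesis
    unfolding proj_sq_def by (intro borel_measurable_sum borel_measurable_times) auto
qed

text \<open>
  The Householder reflection in the hyperplane orthogonal to \<open>v\<close>.
\<close>
definition reflect :: "nat \<Rightarrow> (nat \<Rightarrow> real) \<Rightarrow> (nat \<Rightarrow> real) \<Rightarrow> nat \<Rightarrow> real" where
  "reflect n v x = x - (2 * inner_Rn n x v / inner_Rn n v v) *\<^sub>R v"

lemma linear_reflect: "linear (reflect n v)"
  by (rule linearI)
    (simp_all only: reflect_def inner_Rn_add_left inner_Rn_scaleR_left distrib_left add_divide_distrib
      scaleR_add_left scaleR_diff_right scaleR_scaleR mult.left_commute[of 2] times_divide_eq_right add_diff_add)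

lemma inner_reflect:
  assumes "inner_Rn n v v \<noteq> 0"
  shows "inner_Rn n (reflect n v x) (reflect n v y) = inner_Rn n x y"
proof -
  have "inner_Rn n (reflect n v x) (reflect n v y)
    = inner_Rn n x y - 2 * inner_Rn n x v / inner_Rn n v v * inner_Rn n v y
      - 2 * inner_Rn n y v / inner_Rn n v v * (inner_Rn n x v - 2 * inner_Rn n x v / inner_Rn n v v * inner_Rn n v v)"
    unfolding reflect_def by (simp only: inner_Rn_simps)
  then show ?thesis using assms inner_Rn_commute[of n v y] by simp
qed

lemma reflect_involution:
  assumes "inner_Rn n v v \<noteq> 0"
  shows "reflect n v (reflect n v x) = x"
proof -
  have "inner_Rn n (reflect n v x) v = - inner_Rn n x v"
    unfolding reflect_def using assms by (simp add: inner_Rn_diff_left inner_Rn_scaleR_left)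
  then show ?thesis by (simp add: reflect_def[of n v "reflect n v x"]) (simp add: reflect_def)
qed

text \<open>
  Reflections act transitively on spheres.
\<close>
lemma reflect_diff:
  assumes "sq_sum n a = sq_sum n b" "inner_Rn n (a - b) (a - b) \<noteq> 0"
  shows "reflect n (a - b) a = b"
proof -
  have "inner_Rn n (a - b) (a - b) = 2 * inner_Rn n a (a - b)"
    using inner_Rn_diff_left[of n a b "a - b"] inner_Rn_diff_right[of n a a b] inner_Rn_diff_right[of n b a b]
      inner_Rn_self[of n a] inner_Rn_self[of n b] assms(1) inner_Rn_commute[of n b a] by linarith
  then have "2 * inner_Rn n a (a - b) / inner_Rn n (a - b) (a - b) = 1" using assms(2) by simp
  then show ?thesis by (simp only: reflect_def scaleR_one) simp
qed

lemma reflect_orthogonal: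
  assumes "v \<in> Rn n" "inner_Rn n v v \<noteq> 0"
  shows "reflect n v \<in> orthogonal_group n"
  unfolding orthogonal_group_def
proof (intro CollectI conjI ballI)
  show "linear (reflect n v)" by (rule linear_reflect)
  show "reflect n v ` Rn n \<subseteq> Rn n"
    using assms(1) subspace_Rn[of n] by (auto simp: reflect_def intro!: subspace_diff subspace_scale)
qed (rule inner_reflect[OF assms(2)])

lemma orthogonal_orthonormal_image:
  assumes g: "g \<in> orthogonal_group n" and B: "orthonormal n B"
  shows "orthonormal n (g ` B)" "inj_on g B"
proof -
  have ip: "inner_Rn n (g b) (g c) = (if b = c then 1 else 0)" if "b \<in> B" "c \<in> B" for b c
  proof -
    have "b \<in> Rn n" "c \<in> Rn n" using that B by (auto simp: orthonormal_def)
    then have "inner_Rn n (g b) (g c) = inner_Rn n b c" using g by (simp add: orthogonal_group_def)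
    then show ?thesis using that B by (simp add: orthonormal_def)
  qed
  show inj: "inj_on g B" by (rule inj_onI) (metis ip zero_neq_one)
  show "orthonormal n (g ` B)"
    unfolding orthonormal_def
  proof (intro conjI ballI)
    show "finite (g ` B)" using B by (simp add: orthonormal_def)
    show "g ` B \<subseteq> Rn n" using B g unfolding orthonormal_def orthogonal_group_def by blast
    fix b' c' assume "b' \<in> g ` B" "c' \<in> g ` B"
    then obtain b c where bc: "b \<in> B" "c \<in> B" "b' = g b" "c' = g c" by blast
    then show "inner_Rn n b' c' = (if b' = c' then 1 else 0)" using ip[of b c] inj_onD[OF inj, of b c] by auto
  qed
qed

lemma orthogonal_grassmannian:
  assumes g: "g \<in> orthogonal_group n" and E: "E \<in> grassmannian n k"
  shows "g ` E \<in> grassmannian n k"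
    and "x \<in> Rn n \<Longrightarrow> proj_sq n (g ` E) (g x) = proj_sq n E x"
proof -
  obtain B where B: "orthonormal n B" "span B = E" "card B = k" using grassmannian_orthonormal_basis[OF E] by metis
  note gB = orthogonal_orthonormal_image[OF g B(1)]
  have lin: "linear g" using g by (simp add: orthogonal_group_def)
  have gE: "g ` E = span (g ` B)" using linear_span_image[OF lin, of B] B(2) by simp
  have "dim (g ` E) = k"
    unfolding gE using dim_span_eq_card_independent[OF orthonormal_independent[OF gB(1)]] card_image[OF gB(2)] B(3) by simp
  moreover have "span (g ` B) \<subseteq> Rn n" using gB(1) subspace_Rn by (intro span_minimal) (auto simp: orthonormal_def)
  ultimately show "g ` E \<in> grassmannian n k" by (simp add: grassmannian_def gE)
  show "proj_sq n (g ` E) (g x) = proj_sq n E x" if x: "x \<in> Rn n"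
  proof -
    have "proj_sq n (g ` E) (g x) = (\<Sum>b\<in>B. (inner_Rn n (g x) (g b))\<^sup>2)"
      unfolding gE proj_sq_orthonormal[OF gB(1)] by (simp add: sum.reindex[OF gB(2)])
    also have "\<dots> = (\<Sum>b\<in>B. (inner_Rn n x b)\<^sup>2)"
      using g x B(1) by (intro sum.cong refl) (auto simp: orthogonal_group_def orthonormal_def)
    finally show ?thesis using proj_sq_orthonormal[OF B(1)] B(2) by simp
  qed
qed

lemma haar_grassmannian_space:
  assumes "haar_grassmannian n k \<nu>"
  shows "space \<nu> = grassmannian n k"
proof -
  have "sets \<nu> = sets (grassmannian_borel n k)" using assms by (simp add: haar_grassmannian_def)
  from sets_eq_imp_space_eq[OF this] show ?thesis by (simp only: space_grassmannian_borel)
qed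

text \<open>
  A reflection that exchanges \<open>a\<close> and \<open>b\<close> maps the first family of subspaces onto the second.
  Being an involution, it also maps the second into the first, so that the image is the whole
  second family.
\<close>
lemma haar_proj_sq_invariant:
  assumes haar: "haar_grassmannian n k \<nu>" and ab: "a \<in> Rn n" "b \<in> Rn n" "sq_sum n a = sq_sum n b" and T: "T \<in> sets borel"
  shows "emeasure \<nu> {E \<in> grassmannian n k. proj_sq n E a \<in> T} = emeasure \<nu> {E \<in> grassmannian n k. proj_sq n E b \<in> T}"
proof (cases "a = b")
  case False
  define g where "g = reflect n (a - b)"
  have v: "a - b \<in> Rn n" using ab subspace_Rn by (intro subspace_diff)
  have v0: "inner_Rn n (a - b) (a - b) \<noteq> 0" using sq_sum_eq_0_Rn[OF v] False by (simp add: inner_Rn_self)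
  have g: "g \<in> orthogonal_group n" unfolding g_def by (rule reflect_orthogonal[OF v v0])
  have ga: "g a = b" unfolding g_def by (rule reflect_diff[OF ab(3) v0])
  have gen_gauss: "g (g x) = x" for x unfolding g_def by (rule reflect_involution[OF v0])
  have gb: "g b = a" using gen_gauss[of a] ga by simp
  have gen_gauss': "g ` g ` E = E" for E by (simp add: image_image gen_gauss)
  have sets: "sets \<nu> = sets (grassmannian_borel n k)" using haar by (simp add: haar_grassmannian_def)
  let ?A = "\<lambda>x. {E \<in> grassmannian n k. proj_sq n E x \<in> T}"
  have "(\<lambda>E. proj_sq n E a) \<in> borel_measurable (grassmannian_borel n k)"
    using measurable_proj_sq[of "\<lambda>E. E" "grassmannian_borel n k" n k "\<lambda>_. a"] by simp
  from measurable_sets[OF this T] have A: "?A a \<in> sets \<nu>"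
    unfolding sets space_grassmannian_borel by (simp add: vimage_def Int_def conj_commute)
  have "(\<lambda>E. g ` E) ` ?A a = ?A b"
  proof (intro equalityI subsetI)
    fix F assume "F \<in> (\<lambda>E. g ` E) ` ?A a"
    then obtain E where "E \<in> grassmannian n k" "proj_sq n E a \<in> T" "F = g ` E" by blast
    then show "F \<in> ?A b" using orthogonal_grassmannian[OF g, of E k] ab(1) ga by force
  next
    fix F assume "F \<in> ?A b"
    then have "g ` F \<in> ?A a" using orthogonal_grassmannian[OF g, of F k] ab(2) gb by force
    then show "F \<in> (\<lambda>E. g ` E) ` ?A a" using gen_gauss'[of F] by (metis (no_types, lifting) image_eqI)
  qed
  moreover have "emeasure \<nu> ((\<lambda>E. g ` E) ` ?A a) = emeasure \<nu> (?A a)"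
    using haar g A unfolding haar_grassmannian_def by blast
  ultimately show ?thesis by simp
qed simp

definition zero_ext :: "nat \<Rightarrow> (nat \<Rightarrow> real) \<Rightarrow> nat \<Rightarrow> real" where
  "zero_ext n x = (\<lambda>i. if i < n then x i else 0)"

lemma zero_ext_Rn: "zero_ext n x \<in> Rn n"
  by (simp add: zero_ext_def Rn_def)

lemma sq_sum_zero_ext [simp]: "sq_sum n (zero_ext n x) = sq_sum n x"
  by (simp add: sq_sum_def zero_ext_def)

lemma inner_Rn_zero_ext [simp]: "inner_Rn n (zero_ext n x) y = inner_Rn n x y"
  by (simp add: inner_Rn_def zero_ext_def)

lemma proj_sq_zero_ext [simp]: "proj_sq n E (zero_ext n x) = proj_sq n E x"
  by (simp add: proj_sq_def zero_ext_def)

lemma sq_sum_scaleR: "sq_sum n (c *\<^sub>R x) = c\<^sup>2 * sq_sum n x"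
  by (simp add: sq_sum_def scaleR_fun_def sum_distrib_left power_mult_distrib)

lemma proj_sq_scaleR: "proj_sq n E (c *\<^sub>R x) = c\<^sup>2 * proj_sq n E x"
  unfolding proj_sq_def sum_distrib_left
  by (intro sum.cong refl) (simp add: scaleR_fun_def power2_eq_square)

lemma proj_sq_nonneg:
  assumes "E \<in> grassmannian n k"
  shows "0 \<le> proj_sq n E x"
  by (simp add: proj_sq_eq_sq_sum[OF assms] sq_sum_nonneg)

lemma proj_sq_eq_0:
  assumes "sq_sum n x = 0"
  shows "proj_sq n E x = 0"
proof -
  have "x i = 0" if "i < n" for i using assms that by (simp add: sq_sum_def sum_nonneg_eq_0_iff)
  then show ?thesis by (simp add: proj_sq_def)
qed

text \<open>
  By invariance the probability is the same for all directions \<open>x\<close>, so it can be averaged over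
  a Gaussian direction; exchanging the two integrals leaves a fixed subspace. Including the event
  \<open>sq_sum n g = 0\<close> keeps the averaging inequality valid at every \<open>g\<close> and costs nothing in the
  tail bounds.
\<close>
lemma haar_ratio_le_gauss:
  assumes haar: "haar_grassmannian n k \<nu>" and T: "T \<in> sets borel"
    and x: "0 < sq_sum n x"
    and bound: "\<And>E. E \<in> grassmannian n k \<Longrightarrow>
      emeasure (gauss_pow n) {g \<in> space (gauss_pow n). sq_sum n g = 0 \<or> proj_sq n E g / sq_sum n g \<in> T} \<le> C"
  shows "emeasure \<nu> {E \<in> grassmannian n k. proj_sq n E x / sq_sum n x \<in> T} \<le> C"
proof -
  interpret N: prob_space \<nu> using haar by (simp add: haar_grassmannian_def)
  interpret G: prob_space "gauss_pow n" by (rule prob_space_gauss_pow)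
  interpret P: pair_sigma_finite \<nu> "gauss_pow n" ..
  note sp = haar_grassmannian_space[OF haar]
  have sets [measurable_cong]: "sets \<nu> = sets (grassmannian_borel n k)" using haar by (simp add: haar_grassmannian_def)
  note [measurable] = T
  have comp [measurable]: "(\<lambda>z. snd z i) \<in> borel_measurable (\<nu> \<Otimes>\<^sub>M gauss_pow n)" if "i < n" for i
  proof -
    have "(\<lambda>g. g i) \<in> borel_measurable (gauss_pow n)"
      unfolding measurable_cong_sets[OF sets_gauss_pow refl] using that by (intro measurable_component_singleton) simp
    then show ?thesis by (rule measurable_compose[OF measurable_snd])
  qed
  have [measurable]: "(\<lambda>z. proj_sq n (fst z) (snd z)) \<in> borel_measurable (\<nu> \<Otimes>\<^sub>M gauss_pow n)"
  proof (rule measurable_proj_sq)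
    show "fst \<in> measurable (\<nu> \<Otimes>\<^sub>M gauss_pow n) (grassmannian_borel n k)" by measurable
  qed (rule comp)
  have px [measurable]: "(\<lambda>E. proj_sq n E y) \<in> borel_measurable \<nu>" for y
    by (rule measurable_proj_sq[of "\<lambda>E. E" _ n k "\<lambda>_. y"]) (auto simp: measurable_cong_sets[OF sets refl])
  let ?X = "{E \<in> grassmannian n k. proj_sq n E x / sq_sum n x \<in> T}"
  let ?S = "\<lambda>E g. sq_sum n g = 0 \<or> proj_sq n E g / sq_sum n g \<in> T"
  have le: "emeasure \<nu> ?X \<le> (\<integral>\<^sup>+E. indicator {E. ?S E g} E \<partial>\<nu>)" for g
  proof (cases "sq_sum n g = 0")
    case True
    then show ?thesis by (simp add: N.emeasure_space_1 N.emeasure_le_1)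
  next
    case False
    then have g0: "0 < sq_sum n g" using sq_sum_nonneg[of n g] by linarith
    define c where "c = sqrt (sq_sum n x / sq_sum n g)"
    have c2: "c\<^sup>2 = sq_sum n x / sq_sum n g" using x g0 by (simp add: c_def)
    let ?b = "c *\<^sub>R zero_ext n g"
    have bR: "?b \<in> Rn n" by (intro subspace_scale[OF subspace_Rn] zero_ext_Rn)
    have sqb: "sq_sum n ?b = sq_sum n x" using c2 g0 by (simp add: sq_sum_scaleR)
    have pb: "proj_sq n E ?b / sq_sum n x = proj_sq n E g / sq_sum n g" for E
      using x g0 by (simp add: proj_sq_scaleR c2)
    let ?T = "{r. r / sq_sum n x \<in> T}"
    have T': "?T \<in> sets borel" by measurable
    have "emeasure \<nu> ?X = emeasure \<nu> {E \<in> grassmannian n k. proj_sq n E (zero_ext n x) \<in> ?T}" by simp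
    also have "\<dots> = emeasure \<nu> {E \<in> grassmannian n k. proj_sq n E ?b \<in> ?T}"
      by (rule haar_proj_sq_invariant[OF haar zero_ext_Rn bR _ T']) (simp add: sqb)
    also have "{E \<in> grassmannian n k. proj_sq n E ?b \<in> ?T} = {E \<in> space \<nu>. proj_sq n E g / sq_sum n g \<in> T}"
      by (simp only: sp mem_Collect_eq pb)
    also have "emeasure \<nu> \<dots> = (\<integral>\<^sup>+E. indicator {E \<in> space \<nu>. proj_sq n E g / sq_sum n g \<in> T} E \<partial>\<nu>)"
      by (rule nn_integral_indicator[symmetric]) measurable
    also have "\<dots> \<le> (\<integral>\<^sup>+E. indicator {E. ?S E g} E \<partial>\<nu>)"
      by (intro nn_integral_mono) (auto split: split_indicator)
    finally show ?thesis .
  qed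
  have "emeasure \<nu> ?X = (\<integral>\<^sup>+g. emeasure \<nu> ?X \<partial>gauss_pow n)" by (simp add: G.emeasure_space_1)
  also have "\<dots> \<le> (\<integral>\<^sup>+g. (\<integral>\<^sup>+E. indicator {E. ?S E g} E \<partial>\<nu>) \<partial>gauss_pow n)"
    by (intro nn_integral_mono le)
  also have "\<dots> = (\<integral>\<^sup>+E. (\<integral>\<^sup>+g. indicator {E. ?S E g} E \<partial>gauss_pow n) \<partial>\<nu>)"
  proof (rule P.Fubini')
    have "{z \<in> space (\<nu> \<Otimes>\<^sub>M gauss_pow n). ?S (fst z) (snd z)} \<in> sets (\<nu> \<Otimes>\<^sub>M gauss_pow n)" by measurable
    then have "(\<lambda>z. indicator {z \<in> space (\<nu> \<Otimes>\<^sub>M gauss_pow n). ?S (fst z) (snd z)} z :: ennreal) \<in> borel_measurable (\<nu> \<Otimes>\<^sub>M gauss_pow n)"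
      by (rule borel_measurable_indicator)
    then show "(\<lambda>(E, g). indicator {E. ?S E g} E :: ennreal) \<in> borel_measurable (\<nu> \<Otimes>\<^sub>M gauss_pow n)"
      by (rule measurable_cong[THEN iffD1, rotated]) (auto simp: indicator_def)
  qed
  also have "\<dots> \<le> (\<integral>\<^sup>+E. C \<partial>\<nu>)"
  proof (rule nn_integral_mono)
    fix E assume "E \<in> space \<nu>"
    then have E: "E \<in> grassmannian n k" by (simp only: sp)
    have [measurable]: "(\<lambda>g. proj_sq n E g) \<in> borel_measurable (gauss_pow n)"
      unfolding proj_sq_def measurable_cong_sets[OF sets_gauss_pow refl] by measurable
    have "(\<integral>\<^sup>+g. indicator {E. ?S E g} E \<partial>gauss_pow n) = (\<integral>\<^sup>+g. indicator {g \<in> space (gauss_pow n). ?S E g} g \<partial>gauss_pow n)"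
      by (intro nn_integral_cong) (auto split: split_indicator)
    also have "\<dots> = emeasure (gauss_pow n) {g \<in> space (gauss_pow n). ?S E g}"
      by (rule nn_integral_indicator) measurable
    also have "\<dots> \<le> C" by (rule bound[OF E])
    finally show "(\<integral>\<^sup>+g. indicator {E. ?S E g} E \<partial>gauss_pow n) \<le> C" .
  qed
  also have "\<dots> = C" by (simp add: N.emeasure_space_1)
  finally show ?thesis .
qed

lemma orthonormal_basis_parseval:
  assumes "orthonormal n C" "span C = Rn n"
  shows "(\<Sum>c\<in>C. (inner_Rn n x c)\<^sup>2) = sq_sum n x"
proof -
  have "zero_ext n x = (\<Sum>c\<in>C. inner_Rn n (zero_ext n x) c *\<^sub>R c)"
    using assms zero_ext_Rn by (intro orthonormal_span_expansion) auto
  then have "sq_sum n (zero_ext n x) = (\<Sum>c\<in>C. (inner_Rn n (zero_ext n x) c)\<^sup>2)"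
    using orthonormal_sq_sum[OF assms(1)] by metis
  then show ?thesis by simp
qed

text \<open>
  The lower tail is the upper tail of the orthogonal complement, as the two squared lengths add
  up to \<open>sq_sum n g\<close>.
\<close>
lemma gauss_pow_grassmannian_tail:
  assumes E: "E \<in> grassmannian n k" and n: "0 < n" and \<epsilon>: "0 < \<epsilon>" "\<epsilon> \<le> 1"
  shows "emeasure (gauss_pow n) {g \<in> space (gauss_pow n). sq_sum n g = 0 \<or> proj_sq n E g / sq_sum n g \<in> {real k / real n + \<epsilon>..}}
      \<le> ennreal (2 * exp (- (\<epsilon>\<^sup>2 / 144) * real n))" (is "emeasure _ ?U \<le> _")
    and "emeasure (gauss_pow n) {g \<in> space (gauss_pow n). sq_sum n g = 0 \<or> proj_sq n E g / sq_sum n g \<in> {..real k / real n - \<epsilon>}}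
      \<le> ennreal (2 * exp (- (\<epsilon>\<^sup>2 / 144) * real n))" (is "emeasure _ ?L \<le> _")
proof -
  interpret G: prob_space "gauss_pow n" by (rule prob_space_gauss_pow)
  obtain B C where B: "orthonormal n B" "span B = E" "card B = k"
    and C: "B \<subseteq> C" "orthonormal n C" "span C = Rn n" "card C = n"
    using grassmannian_orthonormal_basis[OF E] by metis
  have fin: "finite C" using C by (simp add: orthonormal_def)
  have D: "orthonormal n (C - B)" using C(2) by (auto simp: orthonormal_def)
  have cardD: "real (card (C - B)) / real n = 1 - real k / real n"
    using card_Diff_subset[OF finite_subset[OF C(1) fin] C(1)] card_mono[OF fin C(1)] B(3) C(4) n
    by (simp add: of_nat_diff diff_divide_distrib)
  have pE: "proj_sq n E g = (\<Sum>b\<in>B. (inner_Rn n g b)\<^sup>2)" for g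
    using proj_sq_orthonormal[OF B(1)] B(2) by simp
  have split: "(\<Sum>c\<in>C - B. (inner_Rn n g c)\<^sup>2) = sq_sum n g - proj_sq n E g" for g
    unfolding pE orthonormal_basis_parseval[OF C(2,3), symmetric] by (rule sum_diff[OF fin C(1)])
  have le: "emeasure (gauss_pow n) S \<le> ennreal (2 * exp (- (\<epsilon>\<^sup>2 / 144) * real n))"
    if D: "orthonormal n D" and sub: "\<And>g. g \<in> S \<Longrightarrow> g \<in> space (gauss_pow n) \<and> (real (card D) / real n + \<epsilon>) * sq_sum n g \<le> (\<Sum>c\<in>D. (inner_Rn n g c)\<^sup>2)"
    for D S
  proof -
    let ?W = "{x \<in> space (gauss_pow n). (real (card D) / real n + \<epsilon>) * sq_sum n x \<le> (\<Sum>c\<in>D. (inner_Rn n x c)\<^sup>2)}"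
    have "?W \<in> sets (gauss_pow n)" by measurable
    then have "emeasure (gauss_pow n) S \<le> emeasure (gauss_pow n) ?W" using sub by (intro emeasure_mono) auto
    also have "\<dots> \<le> ennreal (2 * exp (- (\<epsilon>\<^sup>2 / 144) * real n))"
      unfolding G.emeasure_eq_measure by (intro ennreal_leI gauss_pow_projection_tail D \<epsilon>)
    finally show ?thesis .
  qed
  show "emeasure (gauss_pow n) ?U \<le> ennreal (2 * exp (- (\<epsilon>\<^sup>2 / 144) * real n))"
  proof (rule le[OF B(1)])
    fix g assume g: "g \<in> ?U"
    show "g \<in> space (gauss_pow n) \<and> (real (card B) / real n + \<epsilon>) * sq_sum n g \<le> (\<Sum>c\<in>B. (inner_Rn n g c)\<^sup>2)"
    proof (cases "sq_sum n g = 0")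
      case True then show ?thesis using g by (simp add: sum_nonneg)
    next
      case False
      then have "0 < sq_sum n g" using sq_sum_nonneg[of n g] by linarith
      then show ?thesis using g by (simp add: pE[symmetric] B(3) pos_le_divide_eq)
    qed
  qed
  show "emeasure (gauss_pow n) ?L \<le> ennreal (2 * exp (- (\<epsilon>\<^sup>2 / 144) * real n))"
  proof (rule le[OF D])
    fix g assume g: "g \<in> ?L"
    show "g \<in> space (gauss_pow n) \<and> (real (card (C - B)) / real n + \<epsilon>) * sq_sum n g \<le> (\<Sum>c\<in>C - B. (inner_Rn n g c)\<^sup>2)"
    proof (cases "sq_sum n g = 0")
      case True then show ?thesis using g by (simp add: sum_nonneg)
    next
      case False
      then have "0 < sq_sum n g" using sq_sum_nonneg[of n g] by linarith
      then have "proj_sq n E g \<le> (real k / real n - \<epsilon>) * sq_sum n g" using g by (simp add: pos_divide_le_eq)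
      then show ?thesis using g unfolding split cardD by (simp add: algebra_simps)
    qed
  qed
qed

lemma haar_projection_concentration:
  assumes haar: "haar_grassmannian n k \<nu>" and n: "0 < n" and \<epsilon>: "0 < \<epsilon>" "\<epsilon> \<le> 1"
  shows "emeasure \<nu> {E \<in> grassmannian n k. (real k / real n + \<epsilon>) * sq_sum n x < proj_sq n E x \<or> proj_sq n E x < (real k / real n - \<epsilon>) * sq_sum n x}
      \<le> ennreal (4 * exp (- (\<epsilon>\<^sup>2 / 144) * real n))"
proof (cases "sq_sum n x = 0")
  case True
  then show ?thesis by (simp add: proj_sq_eq_0)
next
  case False
  then have x: "0 < sq_sum n x" using sq_sum_nonneg[of n x] by linarith
  let ?b = "2 * exp (- (\<epsilon>\<^sup>2 / 144) * real n)"
  let ?U = "{E \<in> grassmannian n k. proj_sq n E x / sq_sum n x \<in> {real k / real n + \<epsilon>..}}"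
  let ?L = "{E \<in> grassmannian n k. proj_sq n E x / sq_sum n x \<in> {..real k / real n - \<epsilon>}}"
  have sets: "sets \<nu> = sets (grassmannian_borel n k)" using haar by (simp add: haar_grassmannian_def)
  have "(\<lambda>E. proj_sq n E x) \<in> borel_measurable \<nu>"
    by (rule measurable_proj_sq[of "\<lambda>E. E" _ n k "\<lambda>_. x"]) (auto simp: measurable_cong_sets[OF sets refl])
  then have meas: "{E \<in> grassmannian n k. proj_sq n E x / sq_sum n x \<in> T} \<in> sets \<nu>" if "T \<in> sets borel" for T
    unfolding haar_grassmannian_space[OF haar, symmetric] using that by measurable
  have "emeasure \<nu> {E \<in> grassmannian n k. (real k / real n + \<epsilon>) * sq_sum n x < proj_sq n E x \<or> proj_sq n E x < (real k / real n - \<epsilon>) * sq_sum n x}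
    \<le> emeasure \<nu> (?U \<union> ?L)"
    using x meas[of "{real k / real n + \<epsilon>..}"] meas[of "{..real k / real n - \<epsilon>}"]
    by (intro emeasure_mono) (auto simp: pos_le_divide_eq pos_divide_le_eq)
  also have "\<dots> \<le> emeasure \<nu> ?U + emeasure \<nu> ?L"
    by (intro emeasure_subadditive meas) auto
  also have "\<dots> \<le> ennreal ?b + ennreal ?b"
    using gauss_pow_grassmannian_tail[OF _ n \<epsilon>]
    by (intro add_mono haar_ratio_le_gauss[OF haar _ x]) auto
  also have "\<dots> = ennreal (4 * exp (- (\<epsilon>\<^sup>2 / 144) * real n))"
    by (subst ennreal_plus[symmetric]) auto
  finally show ?thesis .
qed

section \<open>Absolute continuity\<close>

text \<open>
  Once all coordinates but \<open>j\<close> are fixed, the hyperplane leaves a single value for that one.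
\<close>
lemma hyperplane_null:
  assumes j: "j < n" "b j \<noteq> 0"
  shows "emeasure (leb_pow n) {x \<in> space (leb_pow n). inner_Rn n x b = 0} = 0"
proof -
  interpret product_sigma_finite "\<lambda>_::nat. lborel :: real measure" by standard
  let ?I = "{..<n} - {j}"
  let ?H = "{x \<in> space (leb_pow n). inner_Rn n x b = 0}"
  have ins: "{..<n} = insert j ?I" using j by auto
  have leb_pow: "leb_pow n = Pi\<^sub>M (insert j ?I) (\<lambda>_. lborel)" unfolding leb_pow_def using ins by simp
  have H: "?H \<in> sets (leb_pow n)" by measurable
  have "emeasure (leb_pow n) ?H = (\<integral>\<^sup>+x. indicator ?H x \<partial>leb_pow n)" using H by simp
  also have "\<dots> = (\<integral>\<^sup>+x. (\<integral>\<^sup>+y. indicator ?H (x(j := y)) \<partial>lborel) \<partial>Pi\<^sub>M ?I (\<lambda>_. lborel))"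
    unfolding leb_pow by (rule product_nn_integral_insert) (use H[unfolded leb_pow] in auto)
  also have "\<dots> = (\<integral>\<^sup>+x. 0 \<partial>Pi\<^sub>M ?I (\<lambda>_. lborel :: real measure))"
  proof (rule nn_integral_cong)
    fix x :: "nat \<Rightarrow> real"
    define r where "r = - (\<Sum>i\<in>?I. x i * b i) / b j"
    have "inner_Rn n (x(j := y)) b = (\<Sum>i\<in>?I. x i * b i) + y * b j" for y
    proof -
      have "inner_Rn n (x(j := y)) b = (\<Sum>i\<in>insert j ?I. (x(j := y)) i * b i)" unfolding inner_Rn_def using ins by simp
      also have "\<dots> = (x(j := y)) j * b j + (\<Sum>i\<in>?I. (x(j := y)) i * b i)" by (rule sum.insert) auto
      also have "(\<Sum>i\<in>?I. (x(j := y)) i * b i) = (\<Sum>i\<in>?I. x i * b i)" by (intro sum.cong) auto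
      finally show ?thesis by (simp only: fun_upd_same add.commute)
    qed
    then have "indicator ?H (x(j := y)) \<le> (indicator {r} y :: ennreal)" for y
    proof -
      have "y = r" if "(\<Sum>i\<in>?I. x i * b i) + y * b j = 0"
      proof -
        have "y * b j = - (\<Sum>i\<in>?I. x i * b i)" using that by linarith
        then show ?thesis unfolding r_def by (rule nonzero_eq_divide_eq[OF j(2), THEN iffD2])
      qed
      then show ?thesis using \<open>\<And>y. inner_Rn n (x(j := y)) b = (\<Sum>i\<in>?I. x i * b i) + y * b j\<close>
        by (auto simp: indicator_def)
    qed
    then have "(\<integral>\<^sup>+y. indicator ?H (x(j := y)) \<partial>lborel) \<le> (\<integral>\<^sup>+y. indicator {r} y \<partial>lborel)" by (intro nn_integral_mono)
    then show "(\<integral>\<^sup>+y. indicator ?H (x(j := y)) \<partial>lborel) = 0" by simp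
  qed
  finally show ?thesis by simp
qed

text \<open>
  On each ray the preimage of \<open>N\<close> is a rescaled copy of \<open>N\<close>, hence null. By Fubini the
  dilated preimages \<open>{x. c * h x \<in> N}\<close> are null for almost every \<open>c\<close>, and all of them have the same
  measure up to a power of \<open>c\<close>.
\<close>
lemma homogeneous_preimage_null:
  assumes h: "h \<in> borel_measurable (leb_pow n)" and hom: "\<And>c x. 0 < c \<Longrightarrow> h (dilate n c x) = c * h x"
    and zero: "emeasure (leb_pow n) {x \<in> space (leb_pow n). h x = 0} = 0" and nonneg: "\<And>x. 0 \<le> h x"
    and N: "N \<in> null_sets lborel"
  shows "emeasure (leb_pow n) {x \<in> space (leb_pow n). h x \<in> N} = 0"
proof -
  interpret L: sigma_finite_measure "leb_pow n" by (rule sigma_finite_leb_pow)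
  interpret P: pair_sigma_finite lborel "leb_pow n" ..
  note [measurable] = h
  have NB [measurable]: "N \<in> sets borel" using null_setsD2[OF N] by simp
  let ?D = "\<lambda>c. {x \<in> space (leb_pow n). c * h x \<in> N}"
  have D: "?D c \<in> sets (leb_pow n)" for c by measurable
  have slice: "(\<integral>\<^sup>+c. indicator {c. 0 < c \<and> c * h x \<in> N} c \<partial>lborel) = 0" if "h x \<noteq> 0" for x
  proof -
    have hx: "0 < h x" using that nonneg[of x] by simp
    have m: "{c. h x * c \<in> N} \<in> sets borel" by measurable
    have "0 = ennreal (h x) * emeasure lborel {c. h x * c \<in> N}"
      using emeasure_lborel_scale[OF hx NB] null_setsD1[OF N] by simp
    then have z: "emeasure lborel {c. h x * c \<in> N} = 0" using hx by (simp add: ennreal_zero_less_mult_iff)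
    have "(\<integral>\<^sup>+c. indicator {c. 0 < c \<and> c * h x \<in> N} c \<partial>lborel) \<le> (\<integral>\<^sup>+c. indicator {c. h x * c \<in> N} c \<partial>lborel)"
      by (intro nn_integral_mono) (auto simp: indicator_def mult.commute)
    also have "\<dots> = 0" using z m by simp
    finally show ?thesis by simp
  qed
  have "(\<integral>\<^sup>+c. indicator {0<..} c * emeasure (leb_pow n) (?D c) \<partial>lborel) = (\<integral>\<^sup>+c. (\<integral>\<^sup>+x. indicator {c. 0 < c \<and> c * h x \<in> N} c \<partial>leb_pow n) \<partial>lborel)"
  proof (rule nn_integral_cong)
    fix c :: real
    have "(\<integral>\<^sup>+x. indicator {c. 0 < c \<and> c * h x \<in> N} c \<partial>leb_pow n) = (\<integral>\<^sup>+x. indicator {0<..} c * indicator (?D c) x \<partial>leb_pow n)"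
      by (intro nn_integral_cong) (auto simp: indicator_def)
    also have "\<dots> = indicator {0<..} c * emeasure (leb_pow n) (?D c)" using D by (simp add: nn_integral_cmult)
    finally show "indicator {0<..} c * emeasure (leb_pow n) (?D c) = (\<integral>\<^sup>+x. indicator {c. 0 < c \<and> c * h x \<in> N} c \<partial>leb_pow n)" by simp
  qed
  also have "\<dots> = (\<integral>\<^sup>+x. (\<integral>\<^sup>+c. indicator {c. 0 < c \<and> c * h x \<in> N} c \<partial>lborel) \<partial>leb_pow n)"
  proof (rule P.Fubini'[symmetric])
    have "{z \<in> space (lborel \<Otimes>\<^sub>M leb_pow n). 0 < fst z \<and> fst z * h (snd z) \<in> N} \<in> sets (lborel \<Otimes>\<^sub>M leb_pow n)" by measurable
    then have "(\<lambda>z. indicator {z \<in> space (lborel \<Otimes>\<^sub>M leb_pow n). 0 < fst z \<and> fst z * h (snd z) \<in> N} z :: ennreal) \<in> borel_measurable (lborel \<Otimes>\<^sub>M leb_pow n)"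
      by (rule borel_measurable_indicator)
    then show "(\<lambda>(c, x). indicator {c. 0 < c \<and> c * h x \<in> N} c :: ennreal) \<in> borel_measurable (lborel \<Otimes>\<^sub>M leb_pow n)"
      by (rule measurable_cong[THEN iffD1, rotated]) (auto simp: indicator_def)
  qed
  also have "\<dots> = (\<integral>\<^sup>+x. 0 \<partial>leb_pow n)"
  proof (rule nn_integral_cong_AE)
    have "AE x in leb_pow n. h x \<noteq> 0"
      by (rule AE_I[of _ _ "{x \<in> space (leb_pow n). h x = 0}"]) (use zero in auto)
    then show "AE x in leb_pow n. (\<integral>\<^sup>+c. indicator {c. 0 < c \<and> c * h x \<in> N} c \<partial>lborel) = 0"
      by eventually_elim (rule slice)
  qed
  finally have int0: "(\<integral>\<^sup>+c. indicator {0<..} c * emeasure (leb_pow n) (?D c) \<partial>lborel) = 0" by simp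
  have "(\<lambda>c. emeasure (leb_pow n) (?D c)) \<in> borel_measurable borel"
  proof -
    have "{z \<in> space (borel \<Otimes>\<^sub>M leb_pow n). fst z * h (snd z) \<in> N} \<in> sets (borel \<Otimes>\<^sub>M leb_pow n)" by measurable
    from L.measurable_emeasure_Pair[OF this] show ?thesis by (simp add: space_pair_measure vimage_def)
  qed
  then have "AE c in lborel. indicator {0<..} c * emeasure (leb_pow n) (?D c) = 0"
    using int0 by (subst (asm) nn_integral_0_iff_AE) auto
  \<comment> \<open>Almost every \<open>c\<close> is good, so some \<open>c\<close> in a set of positive measure is.\<close>
  moreover have "\<not> (AE c in lborel. c \<notin> {0<..<1::real})"
  proof
    assume "AE c in lborel. c \<notin> {0<..<1::real}"
    then have "emeasure lborel {0<..<1::real} = 0" by (subst (asm) AE_iff_null_sets[symmetric]) (auto dest: null_setsD1)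
    then show False by simp
  qed
  ultimately obtain c :: real where c: "0 < c" "emeasure (leb_pow n) (?D c) = 0"
  proof -
    assume ae: "AE c in lborel. indicator {0<..} c * emeasure (leb_pow n) (?D c) = 0"
      and not: "\<not> (AE c in lborel. c \<notin> {0<..<1::real})" and *: "\<And>c. 0 < c \<Longrightarrow> emeasure (leb_pow n) (?D c) = 0 \<Longrightarrow> thesis"
    show thesis
    proof (rule ccontr)
      assume no: "\<not> thesis"
      have "AE c in lborel. c \<notin> {0<..<1::real}"
        using ae by eventually_elim (use * no in \<open>auto simp: indicator_def split: if_splits\<close>)
      with not show False by simp
    qed
  qed
  have sp: "dilate n c x \<in> space (leb_pow n)" for x by (simp add: space_leb_pow dilate_def)
  have "emeasure (leb_pow n) {x \<in> space (leb_pow n). h x \<in> N} = ennreal (c ^ n) * emeasure (leb_pow n) {x \<in> space (leb_pow n). dilate n c x \<in> {x \<in> space (leb_pow n). h x \<in> N}}"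
    by (rule emeasure_leb_pow_dilate[OF c(1)]) measurable
  also have "{x \<in> space (leb_pow n). dilate n c x \<in> {x \<in> space (leb_pow n). h x \<in> N}} = ?D c"
    by (simp only: mem_Collect_eq sp hom[OF c(1)] simp_thms)
  finally show ?thesis using c(2) by simp
qed

lemma proj_sq_dilate: "proj_sq n E (dilate n c x) = c\<^sup>2 * proj_sq n E x"
  unfolding proj_sq_def sum_distrib_left
  by (intro sum.cong refl) (simp add: dilate_def power2_eq_square)

lemma measurable_proj_sq_leb_pow: "(\<lambda>x. proj_sq n E x) \<in> borel_measurable (leb_pow n)"
  unfolding proj_sq_def measurable_cong_sets[OF sets_leb_pow refl] by measurable

lemma projection_norm_preimage_null:
  assumes E: "E \<in> grassmannian n k" and k: "0 < k" and N: "N \<in> null_sets lborel"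
  shows "emeasure (leb_pow n) {x \<in> space (leb_pow n). sqrt (proj_sq n E x) \<in> N} = 0"
proof (rule homogeneous_preimage_null[OF _ _ _ _ N])
  show "(\<lambda>x. sqrt (proj_sq n E x)) \<in> borel_measurable (leb_pow n)"
    using measurable_proj_sq_leb_pow by simp
  show "sqrt (proj_sq n E (dilate n c x)) = c * sqrt (proj_sq n E x)" if "0 < c" for c x
    using that by (simp add: proj_sq_dilate real_sqrt_mult)
  show "0 \<le> sqrt (proj_sq n E x)" for x using proj_sq_nonneg[OF E] by simp
  obtain B where B: "orthonormal n B" "span B = E" "card B = k" using grassmannian_orthonormal_basis[OF E] by metis
  have fin: "finite B" using B(1) by (simp add: orthonormal_def)
  obtain b where b: "b \<in> B" using B(3) k by (metis card.empty ex_in_conv less_irrefl)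
  have "sq_sum n b = 1" using B(1) b by (simp add: orthonormal_def inner_Rn_self[symmetric])
  then obtain j where j: "j < n" "b j \<noteq> 0" unfolding sq_sum_def
    by (metis (no_types, lifting) lessThan_iff power_zero_numeral sum.neutral zero_neq_one)
  have "emeasure (leb_pow n) {x \<in> space (leb_pow n). sqrt (proj_sq n E x) = 0} \<le> emeasure (leb_pow n) {x \<in> space (leb_pow n). inner_Rn n x b = 0}"
  proof (rule emeasure_mono)
    show "{x \<in> space (leb_pow n). sqrt (proj_sq n E x) = 0} \<subseteq> {x \<in> space (leb_pow n). inner_Rn n x b = 0}"
      using proj_sq_orthonormal[OF B(1)] B(2) b fin by (auto simp: sum_nonneg_eq_0_iff)
    show "{x \<in> space (leb_pow n). inner_Rn n x b = 0} \<in> sets (leb_pow n)" by measurable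
  qed
  then show "emeasure (leb_pow n) {x \<in> space (leb_pow n). sqrt (proj_sq n E x) = 0} = 0"
    using hyperplane_null[of j n b, OF j] by simp
qed

lemma measurable_zero_ext: "zero_ext n \<in> measurable (leb_pow n) borel"
proof (rule measurable_coordinatewise_then_product)
  fix i
  show "(\<lambda>x. zero_ext n x i) \<in> borel_measurable (leb_pow n)"
  proof (cases "i < n")
    case True
    then show ?thesis unfolding measurable_cong_sets[OF sets_leb_pow refl] zero_ext_def by (simp add: measurable_component_singleton)
  qed (simp add: zero_ext_def)
qed

lemma lp_ball_borel: "lp_ball p n \<in> sets borel"
proof -
  have [measurable]: "(\<lambda>x. x i) \<in> borel_measurable (borel :: (nat \<Rightarrow> real) measure)" for i
    by (rule measurable_product_coordinates)
  have eq: "lp_ball p n = {x \<in> space borel. (\<forall>i. n \<le> i \<longrightarrow> x i = 0) \<and> lp_norm p n x \<le> 1}"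
    by (auto simp: lp_ball_def Rn_def)
  show ?thesis unfolding eq lp_norm_def by measurable
qed

lemma uniform_lp_ball_eq_ball_law:
  assumes p: "0 < p"
  shows "uniform_measure (lborel_Rn n) (lp_ball p n) = distr (ball_law p n) borel (zero_ext n)"
proof (rule measure_eqI)
  have L: "lborel_Rn n = distr (leb_pow n) borel (zero_ext n)" unfolding lborel_Rn_def leb_pow_def zero_ext_def[abs_def] ..
  have ball: "zero_ext n -` lp_ball p n \<inter> space (leb_pow n) = pow_ball p n"
  proof -
    have "lp_norm p n (zero_ext n x) \<le> 1 \<longleftrightarrow> pow_sum p n x \<le> 1" for x
    proof -
      have "lp_norm p n (zero_ext n x) = pow_sum p n x powr (1 / p)" by (simp add: lp_norm_def pow_sum_def zero_ext_def)
      moreover have "\<bar>pow_sum p n x\<bar> powr (1 / p) \<le> 1 \<longleftrightarrow> \<bar>pow_sum p n x\<bar> \<le> 1 powr (1 / (1 / p))"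
        by (rule abs_powr_le_iff) (use p in auto)
      ultimately show ?thesis using pow_sum_nonneg[of p n x] by simp
    qed
    then show ?thesis using zero_ext_Rn[of n] unfolding lp_ball_def pow_ball_def by blast
  qed
  show "sets (uniform_measure (lborel_Rn n) (lp_ball p n)) = sets (distr (ball_law p n) borel (zero_ext n))"
    by (simp add: lborel_Rn_def)
  fix S assume "S \<in> sets (uniform_measure (lborel_Rn n) (lp_ball p n))"
  then have S: "S \<in> sets borel" by (simp add: lborel_Rn_def)
  have cutS: "zero_ext n -` S \<inter> space (leb_pow n) \<in> sets (leb_pow n)" by (rule measurable_sets[OF measurable_zero_ext S])
  have mb: "zero_ext n \<in> measurable (ball_law p n) borel"
    unfolding measurable_cong_sets[OF sets_ball_law refl] using measurable_zero_ext unfolding measurable_cong_sets[OF sets_leb_pow refl] .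
  have "emeasure (uniform_measure (lborel_Rn n) (lp_ball p n)) S = emeasure (lborel_Rn n) (lp_ball p n \<inter> S) / emeasure (lborel_Rn n) (lp_ball p n)"
    by (rule emeasure_uniform_measure) (use lp_ball_borel S in \<open>simp_all add: lborel_Rn_def\<close>)
  also have "emeasure (lborel_Rn n) (lp_ball p n) = emeasure (leb_pow n) (pow_ball p n)"
    unfolding L ball[symmetric] by (rule emeasure_distr[OF measurable_zero_ext lp_ball_borel])
  also have "emeasure (lborel_Rn n) (lp_ball p n \<inter> S) = emeasure (leb_pow n) (zero_ext n -` (lp_ball p n \<inter> S) \<inter> space (leb_pow n))"
    unfolding L by (rule emeasure_distr[OF measurable_zero_ext]) (use lp_ball_borel S in auto)
  also have "zero_ext n -` (lp_ball p n \<inter> S) \<inter> space (leb_pow n) = pow_ball p n \<inter> (zero_ext n -` S \<inter> space (leb_pow n))"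
    unfolding ball[symmetric] by blast
  also have "emeasure (leb_pow n) \<dots> / emeasure (leb_pow n) (pow_ball p n) = emeasure (ball_law p n) (zero_ext n -` S \<inter> space (leb_pow n))"
    unfolding ball_law_def by (rule emeasure_uniform_measure[symmetric, OF pow_ball_sets cutS])
  also have "\<dots> = emeasure (distr (ball_law p n) borel (zero_ext n)) S"
    using emeasure_distr[OF mb S] by (simp add: space_ball_law)
  finally show "emeasure (uniform_measure (lborel_Rn n) (lp_ball p n)) S = emeasure (distr (ball_law p n) borel (zero_ext n)) S" .
qed

lemma ball_law_null:
  assumes "S \<in> sets (leb_pow n)" "emeasure (leb_pow n) S = 0"
  shows "emeasure (ball_law p n) S = 0"
proof -
  have "emeasure (ball_law p n) S = emeasure (leb_pow n) (pow_ball p n \<inter> S) / emeasure (leb_pow n) (pow_ball p n)"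
    unfolding ball_law_def by (rule emeasure_uniform_measure[OF pow_ball_sets assms(1)])
  moreover have "emeasure (leb_pow n) (pow_ball p n \<inter> S) = 0"
    using emeasure_mono[of "pow_ball p n \<inter> S" S "leb_pow n"] assms by auto
  ultimately show ?thesis by simp
qed

section \<open>The random projection of a uniform point\<close>

locale random_projection = prob_space M for M :: "'w measure" +
  fixes X :: "'w \<Rightarrow> nat \<Rightarrow> real" and E :: "'w \<Rightarrow> (nat \<Rightarrow> real) set" and p :: real and n k :: nat
  assumes p: "0 < p" and n: "0 < n" and k: "0 < k"
    and X_measurable: "X \<in> measurable M borel"
    and X_distr: "distr M borel X = uniform_measure (lborel_Rn n) (lp_ball p n)"
    and E_measurable: "E \<in> measurable M (grassmannian_borel n k)"
    and E_haar: "haar_grassmannian n k (distr M (grassmannian_borel n k) E)"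
    and indep: "indep_set {X -` A \<inter> space M | A. A \<in> sets borel}
      {E -` \<A> \<inter> space M | \<A>. \<A> \<in> sets (grassmannian_borel n k)}"
begin

lemma component_measurable: "(\<lambda>\<omega>. X \<omega> i) \<in> borel_measurable M"
  by (rule measurable_compose[OF X_measurable measurable_product_coordinates])

lemma sq_sum_measurable: "(\<lambda>\<omega>. sq_sum n (X \<omega>)) \<in> borel_measurable M"
  unfolding sq_sum_def using component_measurable by measurable

lemma proj_sq_measurable: "(\<lambda>\<omega>. proj_sq n (E \<omega>) (X \<omega>)) \<in> borel_measurable M"
  by (rule measurable_proj_sq[OF E_measurable component_measurable])

lemma grassmannian_E: "\<omega> \<in> space M \<Longrightarrow> E \<omega> \<in> grassmannian n k"
  using measurable_space[OF E_measurable] by (simp add: space_grassmannian_borel)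

lemma prob_sq_sum:
  assumes T: "T \<in> sets borel"
  shows "prob {\<omega> \<in> space M. real n powr (2 / p - 1) * sq_sum n (X \<omega>) \<in> T} = ball_prob p n T"
proof -
  let ?S = "{x. real n powr (2 / p - 1) * sq_sum n x \<in> T}"
  have "(\<lambda>x. sq_sum n x) \<in> borel_measurable borel"
    unfolding sq_sum_def by (intro borel_measurable_sum borel_measurable_power measurable_product_coordinates)
  then have "{x \<in> space borel. real n powr (2 / p - 1) * sq_sum n x \<in> T} \<in> sets borel" using T by measurable
  then have S: "?S \<in> sets borel" by simp
  have mb: "zero_ext n \<in> measurable (ball_law p n) borel"
    unfolding measurable_cong_sets[OF sets_ball_law refl] using measurable_zero_ext unfolding measurable_cong_sets[OF sets_leb_pow refl] .
  have "prob {\<omega> \<in> space M. real n powr (2 / p - 1) * sq_sum n (X \<omega>) \<in> T} = measure (distr M borel X) ?S"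
    unfolding measure_distr[OF X_measurable S] by (intro arg_cong[where f=prob]) auto
  also have "\<dots> = measure (distr (ball_law p n) borel (zero_ext n)) ?S"
    unfolding X_distr uniform_lp_ball_eq_ball_law[OF p] ..
  also have "\<dots> = ball_prob p n T"
    unfolding measure_distr[OF mb S] ball_prob_def space_ball_law
    by (intro arg_cong[where f="measure (ball_law p n)"]) auto
  finally show ?thesis .
qed

lemma joint_distr:
  "distr M (borel \<Otimes>\<^sub>M grassmannian_borel n k) (\<lambda>\<omega>. (X \<omega>, E \<omega>)) = distr M borel X \<Otimes>\<^sub>M distr M (grassmannian_borel n k) E"
proof -
  let ?G = "grassmannian_borel n k"
  interpret N: prob_space "distr M ?G E" by (rule prob_space_distr[OF E_measurable])
  interpret U: prob_space "distr M borel X" by (rule prob_space_distr[OF X_measurable])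
  have XE: "(\<lambda>\<omega>. (X \<omega>, E \<omega>)) \<in> measurable M (borel \<Otimes>\<^sub>M ?G)"
    by (rule measurable_Pair[OF X_measurable E_measurable])
  have "distr M borel X \<Otimes>\<^sub>M distr M ?G E = distr M (borel \<Otimes>\<^sub>M ?G) (\<lambda>\<omega>. (X \<omega>, E \<omega>))"
  proof (rule pair_measure_eqI)
    show "sigma_finite_measure (distr M borel X)" "sigma_finite_measure (distr M ?G E)" by unfold_locales
    show "sets (distr M borel X \<Otimes>\<^sub>M distr M ?G E) = sets (distr M (borel \<Otimes>\<^sub>M ?G) (\<lambda>\<omega>. (X \<omega>, E \<omega>)))"
      by (simp cong: sets_pair_measure_cong)
    fix A B assume "A \<in> sets (distr M borel X)" "B \<in> sets (distr M ?G E)"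
    then have A: "A \<in> sets borel" and B: "B \<in> sets ?G" by simp_all
    have "emeasure (distr M (borel \<Otimes>\<^sub>M ?G) (\<lambda>\<omega>. (X \<omega>, E \<omega>))) (A \<times> B) = emeasure M ((\<lambda>\<omega>. (X \<omega>, E \<omega>)) -` (A \<times> B) \<inter> space M)"
      by (rule emeasure_distr[OF XE]) (use A B in simp)
    also have "(\<lambda>\<omega>. (X \<omega>, E \<omega>)) -` (A \<times> B) \<inter> space M = (X -` A \<inter> space M) \<inter> (E -` B \<inter> space M)" by auto
    also have "emeasure M \<dots> = ennreal (prob (X -` A \<inter> space M) * prob (E -` B \<inter> space M))"
      unfolding emeasure_eq_measure using A B by (subst indep_setD[OF indep]) auto
    also have "\<dots> = emeasure (distr M borel X) A * emeasure (distr M ?G E) B"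
      unfolding emeasure_distr[OF X_measurable A] emeasure_distr[OF E_measurable B] emeasure_eq_measure
      by (rule ennreal_mult) auto
    finally show "emeasure (distr M borel X) A * emeasure (distr M ?G E) B
      = emeasure (distr M (borel \<Otimes>\<^sub>M ?G) (\<lambda>\<omega>. (X \<omega>, E \<omega>))) (A \<times> B)" by simp
  qed
  then show ?thesis ..
qed

lemma joint_event_emeasure:
  assumes D: "D \<in> sets (borel \<Otimes>\<^sub>M grassmannian_borel n k)"
  shows "emeasure M {\<omega> \<in> space M. (X \<omega>, E \<omega>) \<in> D} = emeasure (distr M borel X \<Otimes>\<^sub>M distr M (grassmannian_borel n k) E) D"
proof -
  have XE: "(\<lambda>\<omega>. (X \<omega>, E \<omega>)) \<in> measurable M (borel \<Otimes>\<^sub>M grassmannian_borel n k)"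
    by (rule measurable_Pair[OF X_measurable E_measurable])
  have "emeasure (distr M (borel \<Otimes>\<^sub>M grassmannian_borel n k) (\<lambda>\<omega>. (X \<omega>, E \<omega>))) D
    = emeasure M ((\<lambda>\<omega>. (X \<omega>, E \<omega>)) -` D \<inter> space M)" by (rule emeasure_distr[OF XE D])
  also have "(\<lambda>\<omega>. (X \<omega>, E \<omega>)) -` D \<inter> space M = {\<omega> \<in> space M. (X \<omega>, E \<omega>) \<in> D}" by auto
  finally show ?thesis by (simp only: joint_distr)
qed

lemma joint_proj_sq_measurable:
  "(\<lambda>z. proj_sq n (snd z) (fst z)) \<in> borel_measurable (borel \<Otimes>\<^sub>M grassmannian_borel n k)"
proof (rule measurable_proj_sq)
  show "snd \<in> measurable (borel \<Otimes>\<^sub>M grassmannian_borel n k) (grassmannian_borel n k)" by (rule measurable_snd)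
  show "(\<lambda>z. fst z i) \<in> borel_measurable (borel \<Otimes>\<^sub>M grassmannian_borel n k)" for i
    by (rule measurable_compose[OF measurable_fst measurable_product_coordinates])
qed

lemma joint_sq_sum_measurable:
  "(\<lambda>z. sq_sum n (fst z)) \<in> borel_measurable (borel \<Otimes>\<^sub>M grassmannian_borel n k)"
  unfolding sq_sum_def
  by (intro borel_measurable_sum borel_measurable_power measurable_compose[OF measurable_fst measurable_product_coordinates])

text \<open>
  The event that \<open>E\<close> captures an untypical share of the squared length of \<open>X\<close>. The strict
  inequalities exclude \<open>X = 0\<close>.
\<close>
definition atypical :: "real \<Rightarrow> 'w set" where
  "atypical \<epsilon> = {\<omega> \<in> space M. (real k / real n + \<epsilon>) * sq_sum n (X \<omega>) < proj_sq n (E \<omega>) (X \<omega>)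
     \<or> proj_sq n (E \<omega>) (X \<omega>) < (real k / real n - \<epsilon>) * sq_sum n (X \<omega>)}"

lemma atypical_event: "atypical \<epsilon> \<in> events"
  unfolding atypical_def using sq_sum_measurable proj_sq_measurable by measurable

text \<open>
  Conditionally on \<open>X\<close> this is the concentration for a fixed vector.
\<close>
lemma prob_atypical:
  assumes \<epsilon>: "0 < \<epsilon>" "\<epsilon> \<le> 1"
  shows "prob (atypical \<epsilon>) \<le> 4 * exp (- (\<epsilon>\<^sup>2 / 144) * real n)"
proof -
  let ?\<nu> = "distr M (grassmannian_borel n k) E" and ?\<mu> = "distr M borel X"
  interpret N: prob_space ?\<nu> by (rule prob_space_distr[OF E_measurable])
  interpret U: prob_space ?\<mu> by (rule prob_space_distr[OF X_measurable])
  note [measurable] = joint_proj_sq_measurable joint_sq_sum_measurable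
  let ?D = "{z \<in> space (borel \<Otimes>\<^sub>M grassmannian_borel n k). (real k / real n + \<epsilon>) * sq_sum n (fst z) < proj_sq n (snd z) (fst z)
     \<or> proj_sq n (snd z) (fst z) < (real k / real n - \<epsilon>) * sq_sum n (fst z)}"
  have D: "?D \<in> sets (borel \<Otimes>\<^sub>M grassmannian_borel n k)" by measurable
  have "emeasure M (atypical \<epsilon>) = emeasure M {\<omega> \<in> space M. (X \<omega>, E \<omega>) \<in> ?D}"
    unfolding atypical_def using grassmannian_E by (intro arg_cong[where f="emeasure M"]) (auto simp: space_pair_measure space_grassmannian_borel)
  also have "\<dots> = emeasure (?\<mu> \<Otimes>\<^sub>M ?\<nu>) ?D" by (rule joint_event_emeasure[OF D])
  also have "\<dots> = (\<integral>\<^sup>+x. emeasure ?\<nu> (Pair x -` ?D) \<partial>?\<mu>)"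
    by (rule N.emeasure_pair_measure_alt) (use D in simp)
  also have "\<dots> \<le> (\<integral>\<^sup>+x. ennreal (4 * exp (- (\<epsilon>\<^sup>2 / 144) * real n)) \<partial>?\<mu>)"
  proof (rule nn_integral_mono)
    fix x
    have "Pair x -` ?D = {F \<in> grassmannian n k. (real k / real n + \<epsilon>) * sq_sum n x < proj_sq n F x \<or> proj_sq n F x < (real k / real n - \<epsilon>) * sq_sum n x}"
      by (auto simp: space_pair_measure space_grassmannian_borel)
    then show "emeasure ?\<nu> (Pair x -` ?D) \<le> ennreal (4 * exp (- (\<epsilon>\<^sup>2 / 144) * real n))"
      using haar_projection_concentration[OF E_haar n \<epsilon>, of x] by simp
  qed
  also have "\<dots> = ennreal (4 * exp (- (\<epsilon>\<^sup>2 / 144) * real n))" using U.emeasure_space_1 by simp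
  finally show ?thesis by (simp add: emeasure_eq_measure)
qed

text \<open>
  Conditionally on \<open>E\<close> the length of the projection is a homogeneous function of \<open>X\<close>, so its law
  is absolutely continuous.
\<close>
lemma projection_norm_null:
  assumes N: "N \<in> null_sets lborel"
  shows "emeasure M {\<omega> \<in> space M. sqrt (proj_sq n (E \<omega>) (X \<omega>)) \<in> N} = 0"
proof -
  let ?\<nu> = "distr M (grassmannian_borel n k) E" and ?\<mu> = "distr M borel X"
  interpret N: prob_space ?\<nu> by (rule prob_space_distr[OF E_measurable])
  interpret U: prob_space ?\<mu> by (rule prob_space_distr[OF X_measurable])
  interpret P: pair_sigma_finite ?\<mu> ?\<nu> ..
  note [measurable] = joint_proj_sq_measurable
  have [measurable]: "N \<in> sets borel" using null_setsD2[OF N] by simp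
  have mb: "zero_ext n \<in> measurable (ball_law p n) borel"
    unfolding measurable_cong_sets[OF sets_ball_law refl] using measurable_zero_ext unfolding measurable_cong_sets[OF sets_leb_pow refl] .
  let ?D = "{z \<in> space (borel \<Otimes>\<^sub>M grassmannian_borel n k). sqrt (proj_sq n (snd z) (fst z)) \<in> N}"
  have D: "?D \<in> sets (borel \<Otimes>\<^sub>M grassmannian_borel n k)" by measurable
  have "emeasure M {\<omega> \<in> space M. sqrt (proj_sq n (E \<omega>) (X \<omega>)) \<in> N} = emeasure M {\<omega> \<in> space M. (X \<omega>, E \<omega>) \<in> ?D}"
    using grassmannian_E by (intro arg_cong[where f="emeasure M"]) (auto simp: space_pair_measure space_grassmannian_borel)
  also have "\<dots> = emeasure (?\<mu> \<Otimes>\<^sub>M ?\<nu>) ?D" by (rule joint_event_emeasure[OF D])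
  also have "\<dots> = (\<integral>\<^sup>+F. emeasure ?\<mu> ((\<lambda>x. (x, F)) -` ?D) \<partial>?\<nu>)"
    by (rule P.emeasure_pair_measure_alt2) (use D in simp)
  also have "\<dots> = (\<integral>\<^sup>+F. 0 \<partial>?\<nu>)"
  proof (rule nn_integral_cong)
    fix F assume "F \<in> space ?\<nu>"
    then have F: "F \<in> grassmannian n k" by (simp add: space_grassmannian_borel)
    let ?S = "{x. sqrt (proj_sq n F x) \<in> N}"
    have slice: "(\<lambda>x. (x, F)) -` ?D = ?S" using F by (auto simp: space_pair_measure space_grassmannian_borel)
    have S: "?S \<in> sets borel"
    proof -
      have "(\<lambda>x. proj_sq n F x) \<in> borel_measurable borel"
        unfolding proj_sq_def by (intro borel_measurable_sum borel_measurable_times measurable_product_coordinates) auto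
      then have "{x \<in> space borel. sqrt (proj_sq n F x) \<in> N} \<in> sets borel" by measurable
      then show ?thesis by simp
    qed
    have "emeasure ?\<mu> ?S = emeasure (ball_law p n) {x \<in> space (leb_pow n). sqrt (proj_sq n F x) \<in> N}"
      unfolding X_distr uniform_lp_ball_eq_ball_law[OF p] emeasure_distr[OF mb S] space_ball_law
      by (intro arg_cong[where f="emeasure (ball_law p n)"]) auto
    also have "\<dots> = 0"
    proof (rule ball_law_null[OF _ projection_norm_preimage_null[OF F k N]])
      show "{x \<in> space (leb_pow n). sqrt (proj_sq n F x) \<in> N} \<in> sets (leb_pow n)"
        using measurable_proj_sq_leb_pow[of n F] by measurable
    qed
    finally show "emeasure ?\<mu> ((\<lambda>x. (x, F)) -` ?D) = 0" unfolding slice .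
  qed
  finally show ?thesis by simp
qed

end

lemma exp_small_gauss_rate:
  assumes "0 < \<epsilon>" "p < 2"
  shows "exp_small (p / 2) (\<lambda>n. 4 * exp (- (\<epsilon>\<^sup>2 / 144) * real n))"
  using assms by (intro exp_small_linear) auto

theorem theorem1p2:
  fixes M :: "'w measure"
    and X :: "nat \<Rightarrow> 'w \<Rightarrow> (nat \<Rightarrow> real)"
    and E :: "nat \<Rightarrow> 'w \<Rightarrow> (nat \<Rightarrow> real) set"
    and k :: "nat \<Rightarrow> nat"
    and p l :: real
  assumes "prob_space M"
    and "1 \<le> p" and "p < 2"
    and "\<And>n. n \<ge> 2 \<Longrightarrow> k n \<in> {1..n - 1}"
    and "(\<lambda>n. real (k n) / real n) \<longlonglongrightarrow> l"
    and "l \<in> {0<..1}"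
    and "\<And>n. n \<ge> 2 \<Longrightarrow> X n \<in> measurable M borel"
    and "\<And>n. n \<ge> 2 \<Longrightarrow> distr M borel (X n) = uniform_measure (lborel_Rn n) (lp_ball p n)"
    and "\<And>n. n \<ge> 2 \<Longrightarrow> E n \<in> measurable M (grassmannian_borel n (k n))"
    and "\<And>n. n \<ge> 2 \<Longrightarrow> haar_grassmannian n (k n) (distr M (grassmannian_borel n (k n)) (E n))"
    and "\<And>n. n \<ge> 2 \<Longrightarrow>
           prob_space.indep_set M
             {X n -` A \<inter> space M | A. A \<in> sets borel}
             {E n -` \<A> \<inter> space M | \<A>. \<A> \<in> sets (grassmannian_borel n (k n))}"
  shows "prob_space.satisfies_LDP M
           (\<lambda>n \<omega>. real n powr (1 / p - 1 / 2) * lp_norm 2 n (proj_onto n (E n \<omega>) (X n \<omega>)))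
           (\<lambda>n. ereal (real n powr (p / 2)))
           (rate_fun p l)"
proof -
  interpret prob_space M by fact
  have p: "0 < p" "p < 2" using assms(2,3) by auto
  have l: "0 < l" using assms(6) by simp
  note klim = assms(5)
  define m where "m = m_const p"
  have m: "0 < m" unfolding m_def by (rule m_const_pos[OF p(1)])
  define y\<^sub>0 where "y\<^sub>0 = sqrt (l * m)"
  have y0: "0 < y\<^sub>0" "y\<^sub>0\<^sup>2 = l * m" using l m by (auto simp: y\<^sub>0_def)
  define J where "J y = 1 / p * (y\<^sup>2 / l - m) powr (p / 2)" for y
  define Y where "Y n \<omega> = real n powr (1 / p - 1 / 2) * lp_norm 2 n (proj_onto n (E n \<omega>) (X n \<omega>))" for n \<omega>
  \<comment> \<open>\<open>V\<close> and \<open>W\<close> are the rescaled squared lengths of the point and of its projection, so \<open>Y\<^sup>2 = W\<close>.\<close>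
  define V where "V n \<omega> = real n powr (2 / p - 1) * sq_sum n (X n \<omega>)" for n \<omega>
  define W where "W n \<omega> = real n powr (2 / p - 1) * proj_sq n (E n \<omega>) (X n \<omega>)" for n \<omega>
  define bad where "bad \<epsilon> n = random_projection.atypical M (X n) (E n) n (k n) \<epsilon>" for \<epsilon> n
  have rp: "random_projection M (X n) (E n) p n (k n)" if "2 \<le> n" for n
    using assms(4)[OF that] assms(7-11)[OF that] p that by unfold_locales auto
  have J_arg: "0 \<le> y\<^sup>2 / l - m" if "y\<^sub>0 \<le> y" for y
  proof -
    have "l * m \<le> y\<^sup>2" using power_mono[OF that, of 2] y0 by simp
    then show ?thesis using l by (simp add: pos_le_divide_eq mult.commute)
  qed
  have Y_nonneg: "0 \<le> Y n \<omega>" for n \<omega> by (simp add: Y_def lp_norm_2 sq_sum_nonneg)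
  have n_powr: "(real n powr (1 / p - 1 / 2))\<^sup>2 = real n powr (2 / p - 1)" if "0 < n" for n
  proof -
    have "(real n powr (1 / p - 1 / 2))\<^sup>2 = real n powr (1 / p - 1 / 2) * real n powr (1 / p - 1 / 2)" by (rule power2_eq_square)
    also have "\<dots> = real n powr ((1 / p - 1 / 2) + (1 / p - 1 / 2))" by (rule powr_add[symmetric])
    also have "(1 / p - 1 / 2) + (1 / p - 1 / 2) = 2 / p - 1" by (simp add: field_simps)
    finally show ?thesis .
  qed
  have Y_eq: "Y n \<omega> = real n powr (1 / p - 1 / 2) * sqrt (proj_sq n (E n \<omega>) (X n \<omega>))"
    and Y_sq: "(Y n \<omega>)\<^sup>2 = W n \<omega>" if "2 \<le> n" "\<omega> \<in> space M" for n \<omega>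
  proof -
    interpret R: random_projection M "X n" "E n" p n "k n" by (rule rp) fact
    note En = R.grassmannian_E[OF that(2)]
    show eq: "Y n \<omega> = real n powr (1 / p - 1 / 2) * sqrt (proj_sq n (E n \<omega>) (X n \<omega>))"
      by (simp add: Y_def lp_norm_2 proj_sq_eq_sq_sum[OF En])
    show "(Y n \<omega>)\<^sup>2 = W n \<omega>"
      unfolding eq W_def power_mult_distrib n_powr[OF R.n] using proj_sq_nonneg[OF En] by simp
  qed
  have Y_meas: "Y n \<in> borel_measurable M" if "2 \<le> n" for n
  proof -
    interpret R: random_projection M "X n" "E n" p n "k n" by (rule rp) fact
    have "(\<lambda>\<omega>. real n powr (1 / p - 1 / 2) * sqrt (proj_sq n (E n \<omega>) (X n \<omega>))) \<in> borel_measurable M"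
      using R.proj_sq_measurable by measurable
    then show ?thesis by (rule measurable_cong[THEN iffD1, rotated]) (simp add: Y_eq[OF that])
  qed
  have V_meas: "V n \<in> borel_measurable M" if "2 \<le> n" for n
  proof -
    interpret R: random_projection M "X n" "E n" p n "k n" by (rule rp) fact
    show ?thesis unfolding V_def[abs_def] using R.sq_sum_measurable by measurable
  qed
  have bad_event: "bad \<epsilon> n \<in> events" if "2 \<le> n" for n \<epsilon>
    unfolding bad_def by (rule random_projection.atypical_event[OF rp[OF that]])
  have bad_small: "exp_small (p / 2) (\<lambda>n. prob (bad \<epsilon> n))" if "0 < \<epsilon>" "\<epsilon> \<le> 1" for \<epsilon>
  proof (rule exp_small_mono[OF exp_small_gauss_rate[OF that(1) p(2)]])
    show "\<forall>\<^sub>F n in sequentially. prob (bad \<epsilon> n) \<le> 4 * exp (- (\<epsilon>\<^sup>2 / 144) * real n)"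
      using eventually_ge_at_top[of 2]
      by eventually_elim (use random_projection.prob_atypical[OF rp that] in \<open>simp add: bad_def\<close>)
  qed
  have V_prob: "prob {\<omega> \<in> space M. V n \<omega> \<in> T} = ball_prob p n T" if "2 \<le> n" "T \<in> sets borel" for n T
    unfolding V_def by (rule random_projection.prob_sq_sum[OF rp[OF that(1)] that(2)])
  \<comment> \<open>Off the exceptional event, \<open>Y\<^sup>2\<close> lies between \<open>(l - \<delta>) V\<close> and \<open>(l + \<delta>) V\<close>.\<close>
  have sandwich: "\<forall>\<^sub>F n in sequentially. 2 \<le> n \<and> (\<forall>\<omega>\<in>space M - bad (\<delta> / 2) n. (l - \<delta>) * V n \<omega> \<le> (Y n \<omega>)\<^sup>2 \<and> (Y n \<omega>)\<^sup>2 \<le> (l + \<delta>) * V n \<omega>)"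
    if \<delta>: "0 < \<delta>" for \<delta>
  proof -
    have "\<forall>\<^sub>F n in sequentially. real (k n) / real n < l + \<delta> / 2"
      "\<forall>\<^sub>F n in sequentially. l - \<delta> / 2 < real (k n) / real n"
      using order_tendstoD(2)[OF klim, of "l + \<delta> / 2"] order_tendstoD(1)[OF klim, of "l - \<delta> / 2"] \<delta> by auto
    then show ?thesis using eventually_ge_at_top[of 2]
    proof eventually_elim
      case (elim n)
      interpret R: random_projection M "X n" "E n" p n "k n" by (rule rp) fact
      have "(l - \<delta>) * V n \<omega> \<le> (Y n \<omega>)\<^sup>2 \<and> (Y n \<omega>)\<^sup>2 \<le> (l + \<delta>) * V n \<omega>" if \<omega>: "\<omega> \<in> space M - bad (\<delta> / 2) n" for \<omega>
      proof -
        let ?s = "sq_sum n (X n \<omega>)" and ?q = "proj_sq n (E n \<omega>) (X n \<omega>)"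
        have s: "0 \<le> ?s" by (rule sq_sum_nonneg)
        have "?q \<le> (real (k n) / real n + \<delta> / 2) * ?s" "(real (k n) / real n - \<delta> / 2) * ?s \<le> ?q"
          using \<omega> by (auto simp: bad_def R.atypical_def)
        moreover have "(real (k n) / real n + \<delta> / 2) * ?s \<le> (l + \<delta>) * ?s" "(l - \<delta>) * ?s \<le> (real (k n) / real n - \<delta> / 2) * ?s"
          using elim(1,2) s by (auto intro!: mult_right_mono)
        ultimately have "?q \<le> (l + \<delta>) * ?s" "(l - \<delta>) * ?s \<le> ?q" by linarith+
        then have "real n powr (2 / p - 1) * ?q \<le> real n powr (2 / p - 1) * ((l + \<delta>) * ?s)"
          "real n powr (2 / p - 1) * ((l - \<delta>) * ?s) \<le> real n powr (2 / p - 1) * ?q"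
          by (auto intro!: mult_left_mono)
        moreover have "(Y n \<omega>)\<^sup>2 = W n \<omega>" using \<omega> by (intro Y_sq elim(3)) auto
        ultimately show ?thesis by (simp add: V_def W_def mult.left_commute)
      qed
      then show ?case using elim(3) by blast
    qed
  qed
  have "satisfies_LDP Y (\<lambda>n. ereal (real n powr (p / 2))) (\<lambda>y. if y\<^sub>0 \<le> y then ereal (J y) else \<infinity>)"
  proof (rule satisfies_LDP_increasing_rate)
    show "0 < p / 2" using p by simp
    show "continuous_on {y\<^sub>0..} J"
      unfolding J_def using p l J_arg by (intro continuous_intros continuous_on_powr') auto
    show "J x \<le> J y" if "y\<^sub>0 \<le> x" "x \<le> y" for x y
    proof -
      have "x\<^sup>2 / l - m \<le> y\<^sup>2 / l - m" using that y0 l by (auto intro!: divide_right_mono power_mono)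
      then show ?thesis unfolding J_def using J_arg[OF that(1)] p by (intro mult_left_mono powr_mono2) auto
    qed
    show "J y\<^sub>0 = 0" using l by (simp add: J_def y0)
    show "\<exists>b\<ge>y\<^sub>0. a < J b" for a
    proof -
      have "filterlim J at_top at_top" unfolding J_def using p l by real_asymp
      then have "\<forall>\<^sub>F b in at_top. a < J b \<and> y\<^sub>0 \<le> b"
        using eventually_ge_at_top[of y\<^sub>0] by (auto simp: filterlim_at_top_dense eventually_conj_iff)
      from eventually_happens[OF this] show ?thesis by auto
    qed
    show "\<forall>\<^sub>F n in sequentially. Y n \<in> borel_measurable M"
      using eventually_ge_at_top[of 2] by eventually_elim (rule Y_meas)
    show "\<forall>\<^sub>F n in sequentially. \<forall>N\<in>null_sets lborel. emeasure M {\<omega> \<in> space M. Y n \<omega> \<in> N} = 0"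
      using eventually_ge_at_top[of 2]
    proof (eventually_elim, intro ballI)
      fix n :: nat and N :: "real set" assume n: "2 \<le> n" and N: "N \<in> null_sets lborel"
      interpret R: random_projection M "X n" "E n" p n "k n" by (rule rp) fact
      define c where "c = real n powr (1 / p - 1 / 2)"
      have c: "0 < c" using n by (simp add: c_def)
      have NB: "N \<in> sets borel" using null_setsD2[OF N] by simp
      have "0 = ennreal c * emeasure lborel {x. c * x \<in> N}"
        using emeasure_lborel_scale[OF c NB] null_setsD1[OF N] by simp
      then have "emeasure lborel {x. c * x \<in> N} = 0" using c by (simp add: ennreal_zero_less_mult_iff)
      moreover have "{x. c * x \<in> N} \<in> sets borel" using NB by measurable
      ultimately have "{x. c * x \<in> N} \<in> null_sets lborel" by (intro null_setsI) simp_all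
      from R.projection_norm_null[OF this]
      have "emeasure M {\<omega> \<in> space M. c * sqrt (proj_sq n (E n \<omega>) (X n \<omega>)) \<in> N} = 0" by simp
      moreover have "{\<omega> \<in> space M. Y n \<omega> \<in> N} = {\<omega> \<in> space M. c * sqrt (proj_sq n (E n \<omega>) (X n \<omega>)) \<in> N}"
        using Y_eq[OF n] unfolding c_def by auto
      ultimately show "emeasure M {\<omega> \<in> space M. Y n \<omega> \<in> N} = 0" by simp
    qed
  next
    fix y q assume y: "y\<^sub>0 < y" and q: "q < J y"
    have z: "m < y\<^sup>2 / l"
    proof -
      have "l * m < y\<^sup>2" using power_strict_mono[OF y, of 2] y0 by simp
      then show ?thesis using l by (simp add: pos_less_divide_eq mult.commute)
    qed
    \<comment> \<open>The parameter \<open>\<delta>\<close> leaves room for the deviation of \<open>W / V\<close> from \<open>l\<close>; the rate \<open>Q\<close> is continuous in it.\<close>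
    define Q where "Q \<delta> = 1 / p * (y\<^sup>2 / (l + \<delta>) - m) powr (p / 2)" for \<delta>
    have l1: "((\<lambda>\<delta>. y\<^sup>2 / (l + \<delta>)) \<longlongrightarrow> y\<^sup>2 / (l + 0)) (at_right 0)" using l by (intro tendsto_intros) auto
    have l2: "(Q \<longlongrightarrow> 1 / p * (y\<^sup>2 / (l + 0) - m) powr (p / 2)) (at_right 0)"
      unfolding Q_def using z by (intro tendsto_intros l1) auto
    have "\<forall>\<^sub>F \<delta> in at_right 0. m < y\<^sup>2 / (l + \<delta>) \<and> q < Q \<delta>"
      using order_tendstoD(1)[OF l1, of m] order_tendstoD(1)[OF l2, of q] z q by (simp add: eventually_conj_iff J_def)
    then obtain \<delta> where \<delta>: "0 < \<delta>" "\<delta> < 1" "m < y\<^sup>2 / (l + \<delta>)" "q < Q \<delta>"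
      by (rule eventually_at_right_0_obtain) blast
    let ?T = "{y\<^sup>2 / (l + \<delta>)..}"
    have "\<forall>\<^sub>F n in sequentially. ball_prob p n ?T + prob (bad (\<delta> / 2) n) \<le> exp (- q * real n powr (p / 2))"
    proof (rule eventually_add_le_exp[where Q="Q \<delta>"])
      show "\<forall>\<^sub>F n in sequentially. ball_prob p n ?T \<le> exp (- q' * real n powr (p / 2))" if "q' < Q \<delta>" for q'
        using \<delta>(3) that unfolding Q_def m_def by (intro ball_prob_upper_tail p)
      show "\<forall>\<^sub>F n in sequentially. prob (bad (\<delta> / 2) n) \<le> exp (- q' * real n powr (p / 2))" for q'
        using bad_small[of "\<delta> / 2"] \<delta> by (simp add: exp_small_def)
    qed (use \<delta> p in auto)
    then show "\<forall>\<^sub>F n in sequentially. prob {\<omega> \<in> space M. y \<le> Y n \<omega>} \<le> exp (- q * real n powr (p / 2))"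
      using sandwich[OF \<delta>(1)]
    proof eventually_elim
      case (elim n)
      then have n: "2 \<le> n" by blast
      note V_meas[OF n, measurable]
      have Vev: "{\<omega> \<in> space M. V n \<omega> \<in> ?T} \<in> events" by measurable
      have "{\<omega> \<in> space M. y \<le> Y n \<omega>} \<subseteq> {\<omega> \<in> space M. V n \<omega> \<in> ?T} \<union> bad (\<delta> / 2) n"
      proof
        fix \<omega> assume \<omega>: "\<omega> \<in> {\<omega> \<in> space M. y \<le> Y n \<omega>}"
        show "\<omega> \<in> {\<omega> \<in> space M. V n \<omega> \<in> ?T} \<union> bad (\<delta> / 2) n"
        proof (cases "\<omega> \<in> bad (\<delta> / 2) n")
          case False
          have "y\<^sup>2 \<le> (Y n \<omega>)\<^sup>2" using \<omega> y y0 by (intro power_mono) auto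
          also have "\<dots> \<le> (l + \<delta>) * V n \<omega>" using elim(2) \<omega> False by blast
          finally have "y\<^sup>2 / (l + \<delta>) \<le> V n \<omega>" using l \<delta> by (simp add: pos_divide_le_eq mult.commute)
          then show ?thesis using \<omega> by simp
        qed simp
      qed
      then have "prob {\<omega> \<in> space M. y \<le> Y n \<omega>} \<le> prob ({\<omega> \<in> space M. V n \<omega> \<in> ?T} \<union> bad (\<delta> / 2) n)"
        using Vev bad_event[OF n] by (intro finite_measure_mono) auto
      also have "\<dots> \<le> prob {\<omega> \<in> space M. V n \<omega> \<in> ?T} + prob (bad (\<delta> / 2) n)"
        using Vev bad_event[OF n] by (intro measure_Un_le) auto
      also have "\<dots> = ball_prob p n ?T + prob (bad (\<delta> / 2) n)" by (subst V_prob[OF n]) auto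
      finally show ?case using elim(1) by linarith
    qed
  next
    fix y assume y: "y < y\<^sub>0"
    show "exp_small (p / 2) (\<lambda>n. prob {\<omega> \<in> space M. Y n \<omega> \<le> y})"
    proof (cases "0 \<le> y")
      case False
      then have empty: "{\<omega> \<in> space M. Y n \<omega> \<le> y} = {}" for n
        using Y_nonneg[of n] by (auto simp: not_le dest: order.strict_trans2)
      show ?thesis unfolding exp_small_def empty by simp
    next
      case True
      have z: "y\<^sup>2 / l < m"
      proof -
        have "y\<^sup>2 < l * m" using power_strict_mono[OF y True, of 2] y0 by simp
        then show ?thesis using l by (simp add: pos_divide_less_eq mult.commute)
      qed
      have l1: "((\<lambda>\<delta>. y\<^sup>2 / (l - \<delta>)) \<longlongrightarrow> y\<^sup>2 / (l - 0)) (at_right 0)" using l by (intro tendsto_intros) auto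
      have l2: "((\<lambda>\<delta>. l - \<delta>) \<longlongrightarrow> l - 0) (at_right 0)" by (intro tendsto_intros)
      have "\<forall>\<^sub>F \<delta> in at_right 0. y\<^sup>2 / (l - \<delta>) < m \<and> 0 < l - \<delta>"
        using order_tendstoD(2)[OF l1, of m] order_tendstoD(1)[OF l2, of 0] z l by (simp add: eventually_conj_iff)
      then obtain \<delta> where \<delta>: "0 < \<delta>" "\<delta> < 1" "y\<^sup>2 / (l - \<delta>) < m" "0 < l - \<delta>"
        by (rule eventually_at_right_0_obtain) blast
      let ?T = "{..y\<^sup>2 / (l - \<delta>)}"
      have "exp_small (p / 2) (\<lambda>n. ball_prob p n ?T + prob (bad (\<delta> / 2) n))"
        using \<delta> p by (intro exp_small_add ball_prob_lower_tail bad_small) (auto simp: m_def)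
      then show ?thesis
      proof (rule exp_small_mono)
        show "\<forall>\<^sub>F n in sequentially. prob {\<omega> \<in> space M. Y n \<omega> \<le> y} \<le> ball_prob p n ?T + prob (bad (\<delta> / 2) n)"
          using sandwich[OF \<delta>(1)]
        proof eventually_elim
          case (elim n)
          then have n: "2 \<le> n" by blast
          note V_meas[OF n, measurable]
          have Vev: "{\<omega> \<in> space M. V n \<omega> \<in> ?T} \<in> events" by measurable
          have "{\<omega> \<in> space M. Y n \<omega> \<le> y} \<subseteq> {\<omega> \<in> space M. V n \<omega> \<in> ?T} \<union> bad (\<delta> / 2) n"
          proof
            fix \<omega> assume \<omega>: "\<omega> \<in> {\<omega> \<in> space M. Y n \<omega> \<le> y}"
            show "\<omega> \<in> {\<omega> \<in> space M. V n \<omega> \<in> ?T} \<union> bad (\<delta> / 2) n"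
            proof (cases "\<omega> \<in> bad (\<delta> / 2) n")
              case False
              have "(l - \<delta>) * V n \<omega> \<le> (Y n \<omega>)\<^sup>2" using elim \<omega> False by blast
              also have "\<dots> \<le> y\<^sup>2" using \<omega> Y_nonneg[of n \<omega>] by (intro power_mono) auto
              finally have "V n \<omega> \<le> y\<^sup>2 / (l - \<delta>)" using \<delta>(4) by (simp add: pos_le_divide_eq mult.commute)
              then show ?thesis using \<omega> by simp
            qed simp
          qed
          then have "prob {\<omega> \<in> space M. Y n \<omega> \<le> y} \<le> prob ({\<omega> \<in> space M. V n \<omega> \<in> ?T} \<union> bad (\<delta> / 2) n)"
            using Vev bad_event[OF n] by (intro finite_measure_mono) auto
          also have "\<dots> \<le> prob {\<omega> \<in> space M. V n \<omega> \<in> ?T} + prob (bad (\<delta> / 2) n)"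
            using Vev bad_event[OF n] by (intro measure_Un_le) auto
          also have "\<dots> = ball_prob p n ?T + prob (bad (\<delta> / 2) n)" by (subst V_prob[OF n]) auto
          finally show ?case .
        qed
      qed
    qed
  next
    fix y e q :: real assume y: "y\<^sub>0 < y" and e: "0 < e" and q: "J y < q"
    have y_pos: "0 < y" using y y0 by linarith
    \<comment> \<open>Shrinking the interval to half-width \<open>d < y\<close> makes squaring monotone on it.\<close>
    define d where "d = min e (y / 2)"
    have d: "0 < d" "d \<le> e" "d < y" using e y_pos unfolding d_def by linarith+
    have z: "m < y\<^sup>2 / l"
    proof -
      have "l * m < y\<^sup>2" using power_strict_mono[OF y, of 2] y0 by simp
      then show ?thesis using l by (simp add: pos_less_divide_eq mult.commute)
    qed
    have l1: "((\<lambda>\<delta>. (y - d)\<^sup>2 / (l - \<delta>)) \<longlongrightarrow> (y - d)\<^sup>2 / (l - 0)) (at_right 0)" using l by (intro tendsto_intros) auto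
    have l2: "((\<lambda>\<delta>. (y + d)\<^sup>2 / (l + \<delta>)) \<longlongrightarrow> (y + d)\<^sup>2 / (l + 0)) (at_right 0)" using l by (intro tendsto_intros) auto
    have l3: "((\<lambda>\<delta>. l - \<delta>) \<longlongrightarrow> l - 0) (at_right 0)" by (intro tendsto_intros)
    have "(y - d)\<^sup>2 < y\<^sup>2" "y\<^sup>2 < (y + d)\<^sup>2" using d y_pos by (auto intro!: power_strict_mono)
    then have "(y - d)\<^sup>2 / l < y\<^sup>2 / l" "y\<^sup>2 / l < (y + d)\<^sup>2 / l" using l by (auto intro!: divide_strict_right_mono)
    then have "\<forall>\<^sub>F \<delta> in at_right 0. (y - d)\<^sup>2 / (l - \<delta>) < y\<^sup>2 / l \<and> y\<^sup>2 / l < (y + d)\<^sup>2 / (l + \<delta>) \<and> 0 < l - \<delta>"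
      using order_tendstoD(2)[OF l1, of "y\<^sup>2 / l"] order_tendstoD(1)[OF l2, of "y\<^sup>2 / l"] order_tendstoD(1)[OF l3, of 0] l
      by (simp add: eventually_conj_iff)
    then obtain \<delta> where \<delta>: "0 < \<delta>" "\<delta> < 1" "(y - d)\<^sup>2 / (l - \<delta>) < y\<^sup>2 / l" "y\<^sup>2 / l < (y + d)\<^sup>2 / (l + \<delta>)" "0 < l - \<delta>"
      by (rule eventually_at_right_0_obtain) blast
    let ?a = "(y - d)\<^sup>2 / (l - \<delta>)" and ?b = "(y + d)\<^sup>2 / (l + \<delta>)"
    have q': "1 / p * (y\<^sup>2 / l - m) powr (p / 2) < q" using q by (simp add: J_def)
    obtain r where r: "1 / p * (y\<^sup>2 / l - m) powr (p / 2) < r" "r < q" using dense[OF q'] by blast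
    show "\<forall>\<^sub>F n in sequentially. exp (- q * real n powr (p / 2)) \<le> prob {\<omega> \<in> space M. Y n \<omega> \<in> {y - e<..<y + e}}"
    proof (rule eventually_exp_le_of_add[where q'=r])
      show "exp_small (p / 2) (\<lambda>n. prob (bad (\<delta> / 2) n))" using \<delta> by (intro bad_small) auto
      have "\<forall>\<^sub>F n in sequentially. exp (- r * real n powr (p / 2)) \<le> ball_prob p n {?a<..<?b}"
        using \<delta> r(1) z by (intro ball_prob_local_lower_bound[OF p]) (auto simp: m_def)
      then show "\<forall>\<^sub>F n in sequentially. exp (- r * real n powr (p / 2)) \<le> prob {\<omega> \<in> space M. Y n \<omega> \<in> {y - e<..<y + e}} + prob (bad (\<delta> / 2) n)"
        using sandwich[OF \<delta>(1)]
      proof eventually_elim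
        case (elim n)
        then have n: "2 \<le> n" by blast
        note Y_meas[OF n, measurable]
        have Yev: "{\<omega> \<in> space M. Y n \<omega> \<in> {y - e<..<y + e}} \<in> events" by measurable
        have "{\<omega> \<in> space M. V n \<omega> \<in> {?a<..<?b}} \<subseteq> {\<omega> \<in> space M. Y n \<omega> \<in> {y - e<..<y + e}} \<union> bad (\<delta> / 2) n"
        proof
          fix \<omega> assume \<omega>: "\<omega> \<in> {\<omega> \<in> space M. V n \<omega> \<in> {?a<..<?b}}"
          show "\<omega> \<in> {\<omega> \<in> space M. Y n \<omega> \<in> {y - e<..<y + e}} \<union> bad (\<delta> / 2) n"
          proof (cases "\<omega> \<in> bad (\<delta> / 2) n")
            case False
            then have Ysq: "(l - \<delta>) * V n \<omega> \<le> (Y n \<omega>)\<^sup>2" "(Y n \<omega>)\<^sup>2 \<le> (l + \<delta>) * V n \<omega>" using elim(2) \<omega> by blast+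
            have "(y - d)\<^sup>2 < (l - \<delta>) * V n \<omega>" using \<omega> \<delta>(5) by (simp add: pos_divide_less_eq mult.commute)
            moreover have "(l + \<delta>) * V n \<omega> < (y + d)\<^sup>2" using \<omega> l \<delta>(1) by (simp add: pos_less_divide_eq mult.commute)
            ultimately have "(y - d)\<^sup>2 < (Y n \<omega>)\<^sup>2" "(Y n \<omega>)\<^sup>2 < (y + d)\<^sup>2" using Ysq by linarith+
            then have "y - d < Y n \<omega>" "Y n \<omega> < y + d"
              using Y_nonneg[of n \<omega>] d y_pos by (auto intro: power_less_imp_less_base)
            then have "Y n \<omega> \<in> {y - e<..<y + e}" using d by auto
            then show ?thesis using \<omega> by blast
          qed simp
        qed
        then have "prob {\<omega> \<in> space M. V n \<omega> \<in> {?a<..<?b}} \<le> prob ({\<omega> \<in> space M. Y n \<omega> \<in> {y - e<..<y + e}} \<union> bad (\<delta> / 2) n)"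
          using Yev bad_event[OF n] by (intro finite_measure_mono) auto
        also have "\<dots> \<le> prob {\<omega> \<in> space M. Y n \<omega> \<in> {y - e<..<y + e}} + prob (bad (\<delta> / 2) n)"
          using Yev bad_event[OF n] by (intro measure_Un_le) auto
        also have "prob {\<omega> \<in> space M. V n \<omega> \<in> {?a<..<?b}} = ball_prob p n {?a<..<?b}" by (rule V_prob[OF n]) simp
        finally show ?case using elim(1) by linarith
      qed
    qed (use r p in auto)
  qed
  moreover have "rate_fun p l = (\<lambda>y. if y\<^sub>0 \<le> y then ereal (J y) else \<infinity>)"
    by (auto simp: rate_fun_def y\<^sub>0_def J_def m_def fun_eq_iff)
  ultimately show ?thesis by (simp only: Y_def[abs_def])
qed

end
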